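(* For every $L>1$ and $\kappa>0$ there exist positive constants $c_0,\dots,c_8$ that depend only on $L$ and $\kappa$ for which the following holds. Let $T\subset\mathbb{R}^n$ be a convex body for which $\|\cdot\|_{T^\circ}$ has gaussian cotype 2 constant $C_2(T^\circ)\leq\kappa$. Let $X$ be an isotropic, $L$-subgaussian random vector in $\mathbb{R}^n$ with independent, identically distributed coordinates, let $N=c_0k_T^*$, and let $X_1,\dots,X_N$ be independent copies of $X$. Then, with probability at least $1-2\exp(-c_1k_T^* )$ with respect to $(X_i)_{i=1}^N$, there exists $I\subset\{1,\dots,N\}$, $|I|\geq c_2k_T^*$ (depending on $(X_i)_{i=1}^N$), such that, setting $\Gamma_I=\sum_{i\in I}\langle X_i,\cdot\rangle e_i:\mathbb{R}^n\to\mathbb{R}^I$: (i) $$c_3\frac{\ell_*(T)}{\sqrt{|I|}}B_\infty^I\subset\Gamma_IT\subset c_4\,\ell_*(T)B_2^I ;$$ (ii) if $\xi$ is a mean-zero, variance $1$, $L$-subgaussian random variable, $M=c_5k_T^*$, $Y_1,\dots,Y_M$ are independent random vectors in $\mathbb{R}^I$ whose coordinates are independent copies of $\xi$ (chosen independently of $(X_i)_{i=1}^N$), and $\Gamma_\tau=\sum_{i=1}^M\langle Y_i,\cdot\rangle e_i:\mathbb{R}^I\to\mathbb{R}^M$, then with probability at least $1-2\exp(-c_6M)$ with respect to $(Y_i)_{i=1}^M$, $$c_7\sqrt{k_T^*}\,\ell_*(T)B_2^M\subset\Gamma_\tau\Gamma_IT\subset c_8\sqrt{k_T^*}\,\ell_*(T)B_2^M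 .$$
   Context: A convex body in $\mathbb{R}^n$ is a compact, convex, centrally symmetric set with nonempty interior. $\|x\|_{T^\circ}=\sup_{t\in T}\langle x,t\rangle$ is the norm whose unit ball is the polar body $T^\circ$. Its gaussian cotype 2 constant $C_2(T^\circ)$ is the smallest $C$ such that for every finite collection $x_1,\dots,x_m\in\mathbb{R}^n$, $(\sum_i\|x_i\|_{T^\circ}^2)^{1/2}\leq C\,(\mathbb{E}\|\sum_ig_ix_i\|_{T^\circ}^2)^{1/2}$, where $g_1,g_2,\dots$ are independent standard gaussian random variables. $\ell_*(T)=\mathbb{E}\sup_{t\in T}\sum_{i=1}^ng_it_i$, $d_T=\sup_{t\in T}\|t\|_{\ell_2^n}$, $k_T^*=(\ell_*(T)/d_T)^2$. $\|f\|_{\psi_2}=\inf\{c>0:\mathbb{E}\exp(|f/c|^2)\leq2\}$. A random vector $X$ in $\mathbb{R}^n$ is isotropic if its law is symmetric and $\mathbb{E}\langle X,t\rangle^2=\|t\|_{\ell_2^n}^2$ for all $t$; it is $L$-subgaussian if $\|\langle X,t\rangle\|_{\psi_2}\leq L\|\langle X,t\rangle\|_{L_2}$ for all $t$. A random variable $\xi$ is $L$-subgaussian if $\|\xi\|_{\psi_2}\leq L\|\xi\|_{L_2}$. $B_\infty^I=[-1,1]^I$, $B_2^I$ is the Euclidean unit ball of $\mathbb{R}^I$, and $B_2^M$ that of $\mathbb{R}^M$. Identities such as $N=c_0k_T^*$ and $M=c_5k_T^*$ between an integer and a real number are understood up to rounding to a positive integer. *)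

theory Defs
  imports "HOL-Probability.Probability"
begin

text \<open>
  The constants in the main theorem must not depend on the dimension, so the dimension cannot be a
  type. For a finite index set \<open>I\<close>, the space of real vectors indexed by \<open>I\<close> is the set of
  extensional functions \<open>PiE I (\<lambda>_. UNIV)\<close>, which is the carrier both of the topology
  \<open>powertop_real I\<close> and of the measurable space \<open>Pi\<^sub>M I (\<lambda>_. borel)\<close>; \<open>n\<close>-dimensional space is
  the case \<open>I = {1..n}\<close>. The Euclidean norm of \<open>x\<close> is \<open>L2_set x I\<close>.
\<close>

definition Rvec :: "'i set \<Rightarrow> ('i \<Rightarrow> real) set" where
  "Rvec I = PiE I (\<lambda>_. UNIV)"

definition inner_on :: "'i set \<Rightarrow> ('i \<Rightarrow> real) \<Rightarrow> ('i \<Rightarrow> real) \<Rightarrow> real" where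
  "inner_on I x y = (\<Sum>i\<in>I. x i * y i)"

definition scale_on :: "'i set \<Rightarrow> real \<Rightarrow> ('i \<Rightarrow> real) \<Rightarrow> 'i \<Rightarrow> real" where
  "scale_on I a x = (\<lambda>i\<in>I. a * x i)"

definition B2 :: "'i set \<Rightarrow> ('i \<Rightarrow> real) set" where
  "B2 I = {x \<in> Rvec I. L2_set x I \<le> 1}"

definition Binf :: "'i set \<Rightarrow> ('i \<Rightarrow> real) set" where
  "Binf I = PiE I (\<lambda>_. {-1..1})"

text \<open>The operator from vectors indexed by \<open>I\<close> to vectors indexed by \<open>J\<close> with rows \<open>A j\<close>.\<close>

definition row_op :: "'j set \<Rightarrow> 'i set \<Rightarrow> ('j \<Rightarrow> 'i \<Rightarrow> real) \<Rightarrow> ('i \<Rightarrow> real) \<Rightarrow> 'j \<Rightarrow> real" where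
  "row_op J I A x = (\<lambda>j\<in>J. inner_on I (A j) x)"

definition convex_body :: "nat \<Rightarrow> (nat \<Rightarrow> real) set \<Rightarrow> bool" where
  "convex_body n T \<longleftrightarrow>
     compactin (powertop_real {1..n}) T \<and>
     (\<forall>x\<in>T. \<forall>y\<in>T. \<forall>u\<ge>0. \<forall>v\<ge>0. u + v = 1 \<longrightarrow> (\<lambda>i\<in>{1..n}. u * x i + v * y i) \<in> T) \<and>
     (\<forall>x\<in>T. scale_on {1..n} (- 1) x \<in> T) \<and>
     (powertop_real {1..n}) interior_of T \<noteq> {}"

definition polar_norm :: "nat \<Rightarrow> (nat \<Rightarrow> real) set \<Rightarrow> (nat \<Rightarrow> real) \<Rightarrow> real" where
  "polar_norm n T x = (SUP t\<in>T. inner_on {1..n} x t)"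

definition gauss :: "nat \<Rightarrow> (nat \<Rightarrow> real) measure" where
  "gauss m = Pi\<^sub>M {1..m} (\<lambda>_. std_normal_distribution)"

definition gaussian_cotype2_const :: "nat \<Rightarrow> (nat \<Rightarrow> real) set \<Rightarrow> ereal" where
  "gaussian_cotype2_const n T = Inf {ereal C | C. 0 \<le> C \<and>
     (\<forall>m. \<forall>x::nat \<Rightarrow> nat \<Rightarrow> real. (\<forall>i\<in>{1..m}. x i \<in> Rvec {1..n}) \<longrightarrow>
        sqrt (\<Sum>i\<in>{1..m}. (polar_norm n T (x i))\<^sup>2)
          \<le> C * sqrt (\<integral>g. (polar_norm n T (\<lambda>j\<in>{1..n}. \<Sum>i\<in>{1..m}. g i * x i j))\<^sup>2 \<partial>gauss m))}"

definition ell_star :: "nat \<Rightarrow> (nat \<Rightarrow> real) set \<Rightarrow> real" where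
  "ell_star n T = (\<integral>g. (SUP t\<in>T. \<Sum>i\<in>{1..n}. g i * t i) \<partial>gauss n)"

definition radius :: "nat \<Rightarrow> (nat \<Rightarrow> real) set \<Rightarrow> real" where
  "radius n T = (SUP t\<in>T. L2_set t {1..n})"

definition k_star :: "nat \<Rightarrow> (nat \<Rightarrow> real) set \<Rightarrow> real" where
  "k_star n T = (ell_star n T / radius n T)\<^sup>2"

text \<open>
  The expectation is a nonnegative Lebesgue integral and the infimum is extended-real, so that a
  variable with no exponential square moment has infinite norm.
\<close>

definition psi2_norm :: "'a measure \<Rightarrow> ('a \<Rightarrow> real) \<Rightarrow> ereal" where
  "psi2_norm M f =
     Inf {ereal c | c. 0 < c \<and> (\<integral>\<^sup>+\<omega>. ennreal (exp (\<bar>f \<omega> / c\<bar>\<^sup>2)) \<partial>M) \<le> 2}"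

definition subgaussian :: "'a measure \<Rightarrow> real \<Rightarrow> ('a \<Rightarrow> real) \<Rightarrow> bool" where
  "subgaussian M L f \<longleftrightarrow> psi2_norm M f \<le> ereal (L * sqrt (\<integral>\<omega>. (f \<omega>)\<^sup>2 \<partial>M))"

text \<open>
  Random vectors enter through their laws: \<open>\<mu>\<close> is the law of a random vector, which is then the
  identity map on \<open>\<mu>\<close>, and \<open>Pi\<^sub>M {1..N} (\<lambda>_. \<mu>)\<close> is the joint law of \<open>N\<close> independent copies.
  This covers all underlying probability spaces, of any type, with the same constants.
\<close>

definition vector_law :: "nat \<Rightarrow> (nat \<Rightarrow> real) measure \<Rightarrow> bool" where
  "vector_law n \<mu> \<longleftrightarrow> prob_space \<mu> \<and> sets \<mu> = sets (Pi\<^sub>M {1..n} (\<lambda>_. borel))"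

definition isotropic_law :: "nat \<Rightarrow> (nat \<Rightarrow> real) measure \<Rightarrow> bool" where
  "isotropic_law n \<mu> \<longleftrightarrow>
     distr \<mu> (Pi\<^sub>M {1..n} (\<lambda>_. borel)) (scale_on {1..n} (- 1)) = \<mu> \<and>
     (\<forall>t\<in>Rvec {1..n}. (\<integral>x. (inner_on {1..n} x t)\<^sup>2 \<partial>\<mu>) = (L2_set t {1..n})\<^sup>2)"

definition subgaussian_law :: "nat \<Rightarrow> real \<Rightarrow> (nat \<Rightarrow> real) measure \<Rightarrow> bool" where
  "subgaussian_law n L \<mu> \<longleftrightarrow> (\<forall>t\<in>Rvec {1..n}. subgaussian \<mu> L (\<lambda>x. inner_on {1..n} x t))"

definition iid_coordinates :: "nat \<Rightarrow> (nat \<Rightarrow> real) measure \<Rightarrow> bool" where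
  "iid_coordinates n \<mu> \<longleftrightarrow>
     prob_space.indep_vars \<mu> (\<lambda>_. borel) (\<lambda>i x. x i) {1..n} \<and>
     (\<forall>i\<in>{1..n}. \<forall>j\<in>{1..n}. distr \<mu> borel (\<lambda>x. x i) = distr \<mu> borel (\<lambda>x. x j))"

text \<open>
  \<open>Q\<close> need not define a measurable set; as usual, the claim is that it holds on a measurable event
  of the stated probability.
\<close>

definition with_prob_at_least :: "'a measure \<Rightarrow> real \<Rightarrow> ('a \<Rightarrow> bool) \<Rightarrow> bool" where
  "with_prob_at_least P p Q \<longleftrightarrow> (\<exists>A\<in>sets P. p \<le> measure P A \<and> (\<forall>\<omega>\<in>A. Q \<omega>))"

text \<open>Rounding of a positive real number to a positive integer.\<close>

definition round_pos :: "real \<Rightarrow> nat" where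
  "round_pos x = nat \<lceil>x\<rceil>"

end

theory Submission
  imports Defs
begin

text \<open>
  Write \<open>h\<close> for the norm whose unit ball is the polar of \<open>T\<close>, \<open>d\<close> for the radius, \<open>l\<close> for \<open>ell_star n T\<close>
  and \<open>k = (l / d)\<^sup>2\<close>. The set \<open>I\<close> can be taken to be all of \<open>{1..N}\<close>, and more is true than
  the first claim asks: the image of \<open>T\<close> lies between two constant multiples of \<open>l\<close> times the
  Euclidean ball, which contains the cube scaled by \<open>1 / sqrt (card I)\<close>. By duality
  (\<open>ball_subset_row_op_image\<close>, \<open>row_op_image_subset_ball\<close>) this says that
  \<open>h (\<Sum>i\<in>I. a i * X i)\<close> is comparable to \<open>l * L2_set a I\<close> for all \<open>a\<close>. The second claim then no
  longer involves \<open>T\<close>: composing with an \<open>M\<close> by \<open>N\<close> matrix with independent entries and \<open>M\<close> a small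
  multiple of \<open>N\<close>, whose transpose is with overwhelming probability an
  isomorphism onto its image with both constants of order \<open>sqrt N\<close>
  (\<open>random_matrix_bounds\<close>), only changes the constants.

  For a fixed unit vector \<open>a\<close> the coordinates of \<open>Z = \<Sum>i\<in>I. a i * X i\<close> are again independent,
  symmetric and subgaussian. If each of \<open>h Z \<le> C * l\<close> and \<open>c * l \<le> h Z\<close> fails with
  probability at most \<open>exp (- r * k)\<close>, then a net of cardinality exponential in \<open>N\<close>, with \<open>N\<close> a small
  multiple of \<open>k\<close>, gives all \<open>a\<close> at once (\<open>random_seminorm_bounds\<close>).

  Both tails come from one inequality (\<open>mgf_product_of_coupling\<close>). Let \<open>W\<close> and \<open>Z\<close> be independent
  and let \<open>x\<close> be a function of both such that, coordinatewise, \<open>x\<close> given \<open>W\<close> is \<open>W\<close> plus centred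
  subgaussian noise, and \<open>Z\<close> given \<open>x\<close> is \<open>r * x\<close> plus such noise. As \<open>h\<close> is a supremum of linear
  forms, \<open>h W - h x\<close> and \<open>h x - h Z / r\<close> are at most linear forms of norm of order \<open>d\<close> in the noise, and
  therefore \<open>E exp (s * h W) * E exp (- (s / r) * h Z) \<le> exp (C * s\<^sup>2 * d\<^sup>2)\<close>.
  \<^item> With \<open>W\<close> and \<open>Z\<close> gaussian and \<open>x = W + Z\<close>, Jensen's inequality for the second factor gives the
    upper tail of \<open>h\<close> at a gaussian vector. Subgaussian symmetric coordinates are dominated by
    multiples of gaussian ones in the convex order, which passes to products
    (\<open>subgauss_convex_le_gaussian\<close>, \<open>convex_le_PiM\<close>), so that \<open>upper_tail\<close> follows.
  \<^item> With \<open>W\<close> a vector of independent signs and \<open>x\<close> the sum of \<open>W\<close> and the signs of \<open>Z\<close>, Jensen's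
    inequality for the first factor gives \<open>lower_tail\<close>, in terms of the mean of \<open>h\<close> at a vector of signs.

  Cotype 2 enters in \<open>gauss_mean_le\<close>, where it bounds \<open>l\<close> by a multiple of the mean of \<open>h\<close> at a
  vector of signs plus \<open>d\<close>; the term \<open>d\<close> is absorbed since \<open>d = l / sqrt k\<close> with \<open>k\<close> large. For
  \<open>k\<close> below a constant, \<open>c1\<close> is chosen so small that the claimed probability is not positive.
\<close>

section \<open>Coordinatewise images of product measures\<close>

abbreviation (input) iid :: "'i set \<Rightarrow> 'a measure \<Rightarrow> ('i \<Rightarrow> 'a) measure" where
  "iid J M \<equiv> Pi\<^sub>M J (\<lambda>_. M)"

text \<open>
  Coordinatewise maps turn statements about two independent vectors into statements about the law of
  one pair of coordinates. All conditioning below is done in this way: two descriptions of the law of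
  a single pair give two descriptions of the law of the vector of pairs.
\<close>

lemma nn_integral_PiM_zip:
  assumes J: "finite J" and a: "prob_space \<alpha>" and b: "prob_space \<beta>"
    and f[measurable]: "f \<in> measurable (\<alpha> \<Otimes>\<^sub>M \<beta>) \<gamma>"
    and \<Phi>[measurable]: "\<Phi> \<in> borel_measurable (Pi\<^sub>M J (\<lambda>_. \<gamma>))"
  shows "(\<integral>\<^sup>+x. \<integral>\<^sup>+y. \<Phi> (\<lambda>j\<in>J. f (x j, y j)) \<partial>iid J \<beta> \<partial>iid J \<alpha>)
       = (\<integral>\<^sup>+z. \<Phi> z \<partial>iid J (distr (\<alpha> \<Otimes>\<^sub>M \<beta>) \<gamma> f))"
proof -
  interpret a: prob_space \<alpha> by fact
  interpret b: prob_space \<beta> by fact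
  interpret A: product_prob_space "\<lambda>_. \<alpha>" J by unfold_locales
  interpret B: product_prob_space "\<lambda>_. \<beta>" J by unfold_locales
  interpret ab: pair_prob_space \<alpha> \<beta> by unfold_locales
  interpret c: prob_space "distr (\<alpha> \<Otimes>\<^sub>M \<beta>) \<gamma> f" by (rule ab.prob_space_distr) fact
  interpret C: product_prob_space "\<lambda>_. distr (\<alpha> \<Otimes>\<^sub>M \<beta>) \<gamma> f" J by unfold_locales
  interpret AB: pair_prob_space "iid J \<alpha>" "iid J \<beta>"
    using A.P.prob_space_axioms B.P.prob_space_axioms
    by (simp add: pair_prob_space_def pair_sigma_finite_def prob_space_imp_sigma_finite)
  let ?Z = "\<lambda>p. \<lambda>j\<in>J. f (fst p j, snd p j)"
  have Z[measurable]: "?Z \<in> measurable (iid J \<alpha> \<Otimes>\<^sub>M iid J \<beta>) (Pi\<^sub>M J (\<lambda>_. \<gamma>))"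
    by measurable
  have "distr (iid J \<alpha> \<Otimes>\<^sub>M iid J \<beta>) (Pi\<^sub>M J (\<lambda>_. \<gamma>)) ?Z
      = iid J (distr (\<alpha> \<Otimes>\<^sub>M \<beta>) \<gamma> f)" (is "?D = _")
  proof (rule C.PiM_eqI[OF J])
    show "sets ?D = sets (iid J (distr (\<alpha> \<Otimes>\<^sub>M \<beta>) \<gamma> f))"
      unfolding sets_distr by (rule sets_PiM_cong) auto
    fix A assume A: "\<And>i. i \<in> J \<Longrightarrow> A i \<in> sets (distr (\<alpha> \<Otimes>\<^sub>M \<beta>) \<gamma> f)"
    then have A'[measurable]: "\<And>i. i \<in> J \<Longrightarrow> A i \<in> sets \<gamma>" by simp
    have PA: "Pi\<^sub>E J A \<in> sets (Pi\<^sub>M J (\<lambda>_. \<gamma>))" using A' J by (auto intro: sets_PiM_I_finite)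
    have m1: "(\<lambda>q. indicator (A j) (f q) :: ennreal) \<in> borel_measurable (\<alpha> \<Otimes>\<^sub>M \<beta>)" if "j \<in> J" for j
      using A'[OF that] by measurable
    have "emeasure ?D (Pi\<^sub>E J A) = (\<integral>\<^sup>+z. indicator (Pi\<^sub>E J A) z \<partial>?D)"
      using PA by simp
    also have "\<dots> = (\<integral>\<^sup>+p. indicator (Pi\<^sub>E J A) (?Z p) \<partial>(iid J \<alpha> \<Otimes>\<^sub>M iid J \<beta>))"
      by (intro nn_integral_distr) (use PA in auto)
    also have "\<dots> = (\<integral>\<^sup>+x. \<integral>\<^sup>+y. indicator (Pi\<^sub>E J A) (?Z (x, y)) \<partial>iid J \<beta> \<partial>iid J \<alpha>)"
      by (rule B.P.nn_integral_fst[symmetric]) (use PA in measurable)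
    also have "\<dots> = (\<integral>\<^sup>+x. \<integral>\<^sup>+y. (\<Prod>j\<in>J. indicator (A j) (f (x j, y j))) \<partial>iid J \<beta> \<partial>iid J \<alpha>)"
    proof -
      have "indicator (Pi\<^sub>E J A) (?Z (x, y)) = (\<Prod>j\<in>J. indicator (A j) (f (x j, y j)) :: ennreal)" for x y
        using J by (auto simp: indicator_def PiE_iff prod_zero_iff intro!: prod.neutral[symmetric])
      then show ?thesis by simp
    qed
    also have "\<dots> = (\<integral>\<^sup>+x. (\<Prod>j\<in>J. \<integral>\<^sup>+y. indicator (A j) (f (x j, y)) \<partial>\<beta>) \<partial>iid J \<alpha>)"
    proof (intro nn_integral_cong B.product_nn_integral_prod[OF J])
      fix x j assume "x \<in> space (iid J \<alpha>)" "j \<in> J"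
      then have "x j \<in> space \<alpha>" by (auto simp: space_PiM)
      then show "(\<lambda>y. indicator (A j) (f (x j, y)) :: ennreal) \<in> borel_measurable \<beta>"
        using m1[OF \<open>j \<in> J\<close>] by measurable
    qed
    also have "\<dots> = (\<Prod>j\<in>J. \<integral>\<^sup>+x. \<integral>\<^sup>+y. indicator (A j) (f (x, y)) \<partial>\<beta> \<partial>\<alpha>)"
      by (intro A.product_nn_integral_prod[OF J] b.borel_measurable_nn_integral_fst m1)
    also have "\<dots> = (\<Prod>j\<in>J. emeasure (distr (\<alpha> \<Otimes>\<^sub>M \<beta>) \<gamma> f) (A j))"
    proof (intro prod.cong refl)
      fix j assume j: "j \<in> J"
      have "(\<integral>\<^sup>+x. \<integral>\<^sup>+y. indicator (A j) (f (x, y)) \<partial>\<beta> \<partial>\<alpha>)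
          = (\<integral>\<^sup>+q. indicator (A j) (f q) \<partial>(\<alpha> \<Otimes>\<^sub>M \<beta>))"
        by (rule b.nn_integral_fst[OF m1[OF j]])
      also have "\<dots> = (\<integral>\<^sup>+z. indicator (A j) z \<partial>distr (\<alpha> \<Otimes>\<^sub>M \<beta>) \<gamma> f)"
        by (intro nn_integral_distr[symmetric]) (use A'[OF j] in auto)
      finally show "(\<integral>\<^sup>+x. \<integral>\<^sup>+y. indicator (A j) (f (x, y)) \<partial>\<beta> \<partial>\<alpha>) = emeasure (distr (\<alpha> \<Otimes>\<^sub>M \<beta>) \<gamma> f) (A j)"
        using A[OF j] by simp
    qed
    finally show "emeasure ?D (Pi\<^sub>E J A) = (\<Prod>j\<in>J. emeasure (distr (\<alpha> \<Otimes>\<^sub>M \<beta>) \<gamma> f) (A j))" .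
  qed
  then have "(\<integral>\<^sup>+z. \<Phi> z \<partial>iid J (distr (\<alpha> \<Otimes>\<^sub>M \<beta>) \<gamma> f)) = (\<integral>\<^sup>+z. \<Phi> z \<partial>?D)" by simp
  also have "\<dots> = (\<integral>\<^sup>+p. \<Phi> (?Z p) \<partial>(iid J \<alpha> \<Otimes>\<^sub>M iid J \<beta>))"
    by (intro nn_integral_distr) auto
  also have "\<dots> = (\<integral>\<^sup>+x. \<integral>\<^sup>+y. \<Phi> (?Z (x, y)) \<partial>iid J \<beta> \<partial>iid J \<alpha>)"
    by (rule B.P.nn_integral_fst[symmetric]) measurable
  finally show ?thesis by simp
qed

lemma nn_integral_PiM_map:
  assumes J: "finite J" and a: "prob_space \<alpha>"
    and f[measurable]: "f \<in> measurable \<alpha> \<gamma>"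
    and \<Phi>[measurable]: "\<Phi> \<in> borel_measurable (Pi\<^sub>M J (\<lambda>_. \<gamma>))"
  shows "(\<integral>\<^sup>+x. \<Phi> (\<lambda>j\<in>J. f (x j)) \<partial>iid J \<alpha>)
       = (\<integral>\<^sup>+z. \<Phi> z \<partial>iid J (distr \<alpha> \<gamma> f))"
proof -
  interpret a: prob_space \<alpha> by fact
  interpret A: product_prob_space "\<lambda>_. \<alpha>" J by unfold_locales
  interpret AA: pair_prob_space \<alpha> \<alpha> by unfold_locales
  have e: "distr (\<alpha> \<Otimes>\<^sub>M \<alpha>) \<gamma> (\<lambda>p. f (fst p)) = distr \<alpha> \<gamma> f"
  proof (rule measure_eqI)
    fix A assume "A \<in> sets (distr (\<alpha> \<Otimes>\<^sub>M \<alpha>) \<gamma> (\<lambda>p. f (fst p)))"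
    then have A[measurable]: "A \<in> sets \<gamma>" by simp
    have "emeasure (distr (\<alpha> \<Otimes>\<^sub>M \<alpha>) \<gamma> (\<lambda>p. f (fst p))) A
        = (\<integral>\<^sup>+z. indicator A z \<partial>distr (\<alpha> \<Otimes>\<^sub>M \<alpha>) \<gamma> (\<lambda>p. f (fst p)))" by simp
    also have "\<dots> = (\<integral>\<^sup>+p. indicator A (f (fst p)) \<partial>(\<alpha> \<Otimes>\<^sub>M \<alpha>))"
      by (intro nn_integral_distr) auto
    also have "\<dots> = (\<integral>\<^sup>+x. \<integral>\<^sup>+y. indicator A (f (fst (x, y))) \<partial>\<alpha> \<partial>\<alpha>)"
      by (rule a.nn_integral_fst[symmetric]) measurable
    also have "\<dots> = (\<integral>\<^sup>+x. indicator A (f x) \<partial>\<alpha>)"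
      by (simp add: a.emeasure_space_1)
    also have "\<dots> = (\<integral>\<^sup>+z. indicator A z \<partial>distr \<alpha> \<gamma> f)"
      by (intro nn_integral_distr[symmetric]) auto
    finally show "emeasure (distr (\<alpha> \<Otimes>\<^sub>M \<alpha>) \<gamma> (\<lambda>p. f (fst p))) A = emeasure (distr \<alpha> \<gamma> f) A" by simp
  qed simp
  have "(\<integral>\<^sup>+x. \<integral>\<^sup>+y. \<Phi> (\<lambda>j\<in>J. f (fst (x j, y j))) \<partial>iid J \<alpha> \<partial>iid J \<alpha>)
       = (\<integral>\<^sup>+z. \<Phi> z \<partial>iid J (distr (\<alpha> \<Otimes>\<^sub>M \<alpha>) \<gamma> (\<lambda>p. f (fst p))))"
    by (rule nn_integral_PiM_zip[OF J a a, where f="\<lambda>p. f (fst p)"]) measurable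
  then show ?thesis by (simp add: e A.P.emeasure_space_1)
qed

section \<open>Support functionals and the coupling inequality\<close>

text \<open>
  The properties of the norm polar to a symmetric compact set that the probabilistic part needs. The
  supremum is required to be attained, since the proofs pick, for each vector, a linear form that
  attains the norm, after conditioning on it.
\<close>

locale support_functional =
  fixes J :: "nat set" and T :: "(nat \<Rightarrow> real) set" and h :: "(nat \<Rightarrow> real) \<Rightarrow> real" and d :: real
  assumes finite_J: "finite J"
    and attained: "\<exists>t\<in>T. h x = inner_on J x t"
    and inner_le: "t \<in> T \<Longrightarrow> inner_on J x t \<le> h x"
    and radius_le: "t \<in> T \<Longrightarrow> L2_set t J \<le> d"
    and h_minus: "h (\<lambda>j. - x j) = h x"
    and h_meas[measurable]: "h \<in> borel_measurable (Pi\<^sub>M J (\<lambda>_. borel))"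
begin

lemma h_cong: "(\<And>j. j \<in> J \<Longrightarrow> x j = y j) \<Longrightarrow> h x = h y"
proof -
  assume e: "\<And>j. j \<in> J \<Longrightarrow> x j = y j"
  have i: "inner_on J x t = inner_on J y t" for t by (auto simp: inner_on_def e)
  show ?thesis using attained[of x] attained[of y] inner_le[of _ x] inner_le[of _ y] i
    by (metis order_antisym)
qed

lemma h_restrict[simp]: "h (restrict x J) = h x" by (rule h_cong) auto

lemma h_add: "h (\<lambda>j. x j + y j) \<le> h x + h y"
proof -
  obtain t where t: "t \<in> T" "h (\<lambda>j. x j + y j) = inner_on J (\<lambda>j. x j + y j) t"
    using attained by blast
  show ?thesis using inner_le[OF t(1), of x] inner_le[OF t(1), of y] t(2)
    by (simp add: inner_on_def algebra_simps sum.distrib)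
qed

lemma h_scale_pos: assumes "c \<ge> 0" shows "h (\<lambda>j. c * x j) = c * h x"
proof (rule order_antisym)
  have i: "inner_on J (\<lambda>j. c * x j) t = c * inner_on J x t" for t
    by (simp add: inner_on_def sum_distrib_left algebra_simps)
  show "h (\<lambda>j. c * x j) \<le> c * h x"
    using attained[of "\<lambda>j. c * x j"] inner_le[of _ x] i mult_left_mono[OF _ assms] by metis
  show "c * h x \<le> h (\<lambda>j. c * x j)"
    using attained[of x] inner_le[of _ "\<lambda>j. c * x j"] i by metis
qed

lemma h_scale: "h (\<lambda>j. c * x j) = \<bar>c\<bar> * h x"
proof (cases "c \<ge> 0")
  case False
  have "h (\<lambda>j. c * x j) = h (\<lambda>j. - ((-c) * x j))" by simp
  also have "\<dots> = (-c) * h x" unfolding h_minus using False by (intro h_scale_pos) auto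
  finally show ?thesis using False by simp
qed (simp add: h_scale_pos)

lemma h_zero[simp]: "h (\<lambda>j. 0) = 0" using h_scale[of 0 "\<lambda>_. 0"] by simp

lemma h_nonneg: "0 \<le> h x"
  using h_add[of x "\<lambda>j. - x j"] by (simp add: h_minus)

lemma d_nonneg: "0 \<le> d"
  using attained[of "\<lambda>_. 0"] radius_le L2_set_nonneg order_trans by metis

lemma h_sum: "finite I \<Longrightarrow> h (\<lambda>j. \<Sum>i\<in>I. x i j) \<le> (\<Sum>i\<in>I. h (x i))"
proof (induction I rule: finite_induct)
  case (insert i I)
  then show ?case using h_add[of "x i" "\<lambda>j. \<Sum>i\<in>I. x i j"] by simp
qed simp

lemma h_convex: "u \<ge> 0 \<Longrightarrow> v \<ge> 0 \<Longrightarrow> h (\<lambda>j. u * x j + v * y j) \<le> u * h x + v * h y"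
  using h_add[of "\<lambda>j. u * x j" "\<lambda>j. v * y j"] by (simp add: h_scale)

lemma h_le_L2: "h x \<le> d * L2_set x J"
proof -
  obtain t where t: "t \<in> T" "h x = inner_on J x t" using attained by blast
  have "h x \<le> (\<Sum>j\<in>J. \<bar>x j\<bar> * \<bar>t j\<bar>)" unfolding t(2) inner_on_def
    by (intro sum_mono) (metis abs_ge_self abs_mult)
  also have "\<dots> \<le> L2_set x J * L2_set t J" by (rule L2_set_mult_ineq)
  also have "\<dots> \<le> L2_set x J * d" by (intro mult_left_mono radius_le t L2_set_nonneg)
  finally show ?thesis by (simp add: mult.commute)
qed

lemma sum_sq_le: "t \<in> T \<Longrightarrow> (\<Sum>j\<in>J. (t j)\<^sup>2) \<le> d\<^sup>2"
  using radius_le[of t] by (simp add: L2_set_def real_sqrt_le_iff sqrt_le_D)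

lemma h_comp_measurable[measurable (raw)]:
  assumes "\<And>j. j \<in> J \<Longrightarrow> (\<lambda>\<omega>. f \<omega> j) \<in> borel_measurable M"
  shows "(\<lambda>\<omega>. h (f \<omega>)) \<in> borel_measurable M"
proof -
  have "(\<lambda>\<omega>. h (\<lambda>j\<in>J. f \<omega> j)) \<in> borel_measurable M"
    by (rule measurable_compose[OF measurable_restrict h_meas]) (use assms in auto)
  then show ?thesis by simp
qed

end

lemma nn_integral_exp_sum_PiM:
  assumes J: "finite J" and b: "prob_space \<theta>"
    and m[measurable]: "\<And>j. j \<in> J \<Longrightarrow> \<phi> j \<in> borel_measurable \<theta>"
    and B: "\<And>j. j \<in> J \<Longrightarrow> (\<integral>\<^sup>+y. ennreal (exp (s j * \<phi> j y)) \<partial>\<theta>) \<le> ennreal (exp (B * (s j)\<^sup>2))"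
  shows "(\<integral>\<^sup>+y. ennreal (exp (\<Sum>j\<in>J. s j * \<phi> j (y j))) \<partial>iid J \<theta>) \<le> ennreal (exp (B * (\<Sum>j\<in>J. (s j)\<^sup>2)))"
proof -
  interpret b: prob_space \<theta> by fact
  interpret B: product_prob_space "\<lambda>_. \<theta>" J by unfold_locales
  have "(\<integral>\<^sup>+y. ennreal (exp (\<Sum>j\<in>J. s j * \<phi> j (y j))) \<partial>iid J \<theta>)
      = (\<integral>\<^sup>+y. (\<Prod>j\<in>J. ennreal (exp (s j * \<phi> j (y j)))) \<partial>iid J \<theta>)"
    by (simp add: exp_sum J prod_ennreal)
  also have "\<dots> = (\<Prod>j\<in>J. \<integral>\<^sup>+y. ennreal (exp (s j * \<phi> j y)) \<partial>\<theta>)"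
    by (rule B.product_nn_integral_prod[OF J]) measurable
  also have "\<dots> \<le> (\<Prod>j\<in>J. ennreal (exp (B * (s j)\<^sup>2)))"
    by (intro prod_mono_ennreal B)
  also have "\<dots> = ennreal (exp (B * (\<Sum>j\<in>J. (s j)\<^sup>2)))"
    by (simp add: prod_ennreal exp_sum[symmetric] J sum_distrib_left)
  finally show ?thesis .
qed

context support_functional begin

text \<open>
  Here \<open>\<alpha>\<close> is the law of a coordinate \<open>w\<close> of \<open>W\<close>; the coordinate \<open>\<zeta> y\<close> of \<open>Z\<close> and the coordinate
  \<open>\<psi> (w, y)\<close> of the intermediate vector \<open>x\<close> are functions of a further variable \<open>y\<close> of law \<open>\<beta>\<close>. The
  assumption \<open>law\<close> is the disintegration along \<open>x\<close>: the pair consisting of \<open>\<psi> (w, y)\<close> and \<open>\<zeta> y\<close> can also be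
  generated by drawing \<open>x\<close> from \<open>\<omega>\<close> and then \<open>k (x, y)\<close> with independent \<open>y\<close> of law \<open>\<theta>\<close>. The
  exponent splits as \<open>h W - h x\<close> plus \<open>h x - h Z / r\<close>. The first is bounded with a form maximal at
  \<open>W\<close>, after conditioning on \<open>W\<close>, the second with a form maximal at \<open>x\<close>, after conditioning on \<open>x\<close>.
\<close>

lemma mgf_product_of_coupling:
  assumes a: "prob_space \<alpha>" and sa[measurable_cong]: "sets \<alpha> = sets borel"
    and b: "prob_space \<beta>"
    and w: "prob_space \<omega>" and sw[measurable_cong]: "sets \<omega> = sets borel"
    and th: "prob_space \<theta>"
    and \<psi>[measurable]: "\<psi> \<in> borel_measurable (borel \<Otimes>\<^sub>M \<beta>)"
    and \<zeta>[measurable]: "\<zeta> \<in> borel_measurable \<beta>"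
    and k[measurable]: "k \<in> borel_measurable (borel \<Otimes>\<^sub>M \<theta>)"
    and law: "distr (\<alpha> \<Otimes>\<^sub>M \<beta>) (borel \<Otimes>\<^sub>M borel) (\<lambda>(w, y). (\<psi> (w, y), \<zeta> y))
            = distr (\<omega> \<Otimes>\<^sub>M \<theta>) (borel \<Otimes>\<^sub>M borel) (\<lambda>(x, y). (x, k (x, y)))"
    and A: "\<And>w s. (\<integral>\<^sup>+y. ennreal (exp (s * (\<psi> (w, y) - w))) \<partial>\<beta>) \<le> ennreal (exp (A * s\<^sup>2))"
    and B: "\<And>x s. (\<integral>\<^sup>+y. ennreal (exp (s * (k (x, y) - r * x))) \<partial>\<theta>) \<le> ennreal (exp (B * s\<^sup>2))"
    and r: "r > 0" and la: "la \<ge> 0" and AB: "A \<ge> 0" "B \<ge> 0" and C: "C \<ge> 4 * A" "C \<ge> 4 * B / r\<^sup>2"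
  shows "(\<integral>\<^sup>+x. ennreal (exp (la * h x)) \<partial>iid J \<alpha>)
       * (\<integral>\<^sup>+y. ennreal (exp (- (la / r) * h (\<lambda>j. \<zeta> (y j)))) \<partial>iid J \<beta>)
       \<le> ennreal (exp (C * la\<^sup>2 * d\<^sup>2))"
proof -
  interpret a: prob_space \<alpha> by fact
  interpret b: prob_space \<beta> by fact
  interpret w: prob_space \<omega> by fact
  interpret th: prob_space \<theta> by fact
  interpret PA: product_prob_space "\<lambda>_. \<alpha>" J by unfold_locales
  interpret PB: product_prob_space "\<lambda>_. \<beta>" J by unfold_locales
  interpret PW: product_prob_space "\<lambda>_. \<omega>" J by unfold_locales
  interpret PT: product_prob_space "\<lambda>_. \<theta>" J by unfold_locales
  note J = finite_J
  let ?A = "iid J \<alpha>" and ?B = "iid J \<beta>"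
  let ?P = "\<lambda>x y. la * (h x - h (\<lambda>j. \<psi> (x j, y j)))"
  let ?Q = "\<lambda>x y. la * h (\<lambda>j. \<psi> (x j, y j)) - (la / r) * h (\<lambda>j. \<zeta> (y j))"
  have P2: "(\<integral>\<^sup>+y. ennreal (exp (2 * ?P x y)) \<partial>?B) \<le> ennreal (exp (C * la\<^sup>2 * d\<^sup>2))" for x
  proof -
    obtain t where t: "t \<in> T" "h x = inner_on J x t" using attained by blast
    have "(\<integral>\<^sup>+y. ennreal (exp (2 * ?P x y)) \<partial>?B)
        \<le> (\<integral>\<^sup>+y. ennreal (exp (\<Sum>j\<in>J. (- 2 * la * t j) * (\<psi> (x j, y j) - x j))) \<partial>?B)"
    proof (intro nn_integral_mono ennreal_leI, subst exp_le_cancel_iff)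
      fix y
      have "h x - h (\<lambda>j. \<psi> (x j, y j)) \<le> inner_on J x t - inner_on J (\<lambda>j. \<psi> (x j, y j)) t"
        using t inner_le[OF t(1)] by simp
      then have "2 * ?P x y \<le> 2 * (la * (inner_on J x t - inner_on J (\<lambda>j. \<psi> (x j, y j)) t))"
        using la by (intro mult_left_mono) auto
      also have "\<dots> = (\<Sum>j\<in>J. (- 2 * la * t j) * (\<psi> (x j, y j) - x j))"
        by (simp add: inner_on_def sum_subtractf[symmetric] sum_distrib_left algebra_simps)
      finally show "2 * ?P x y \<le> (\<Sum>j\<in>J. (- 2 * la * t j) * (\<psi> (x j, y j) - x j))" .
    qed
    also have "\<dots> \<le> ennreal (exp (A * (\<Sum>j\<in>J. (- 2 * la * t j)\<^sup>2)))"
      by (rule nn_integral_exp_sum_PiM[OF J b, where \<phi>="\<lambda>j y. \<psi> (x j, y) - x j"]) (measurable, rule A)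
    also have "\<dots> \<le> ennreal (exp (C * la\<^sup>2 * d\<^sup>2))"
    proof -
      have "A * (\<Sum>j\<in>J. (- 2 * la * t j)\<^sup>2) = 4 * A * la\<^sup>2 * (\<Sum>j\<in>J. (t j)\<^sup>2)"
        by (simp add: power_mult_distrib sum_distrib_left algebra_simps)
      also have "\<dots> \<le> C * la\<^sup>2 * d\<^sup>2"
        using sum_sq_le[OF t(1)] C AB by (intro mult_mono) (auto intro: sum_nonneg)
      finally show ?thesis by (intro ennreal_leI) simp
    qed
    finally show ?thesis .
  qed
  have Q2: "(\<integral>\<^sup>+x. \<integral>\<^sup>+y. ennreal (exp (2 * ?Q x y)) \<partial>?B \<partial>?A) \<le> ennreal (exp (C * la\<^sup>2 * d\<^sup>2))"
  proof -
    define \<Phi> :: "(nat \<Rightarrow> real \<times> real) \<Rightarrow> ennreal"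
      where "\<Phi> = (\<lambda>z. ennreal (exp (2 * (la * h (\<lambda>j. fst (z j)) - (la / r) * h (\<lambda>j. snd (z j))))))"
    have \<Phi>m: "\<Phi> \<in> borel_measurable (Pi\<^sub>M J (\<lambda>_. borel \<Otimes>\<^sub>M borel))" unfolding \<Phi>_def by measurable
    have "(\<integral>\<^sup>+x. \<integral>\<^sup>+y. ennreal (exp (2 * ?Q x y)) \<partial>?B \<partial>?A)
        = (\<integral>\<^sup>+x. \<integral>\<^sup>+y. \<Phi> (\<lambda>j\<in>J. (\<lambda>(w, y). (\<psi> (w, y), \<zeta> y)) (x j, y j)) \<partial>?B \<partial>?A)"
      unfolding \<Phi>_def by (intro nn_integral_cong arg_cong[where f=ennreal] arg_cong[where f=exp] arg_cong2[where f="(*)"] arg_cong2[where f="(-)"] h_cong refl) auto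
    also have "\<dots> = (\<integral>\<^sup>+z. \<Phi> z \<partial>iid J (distr (\<alpha> \<Otimes>\<^sub>M \<beta>) (borel \<Otimes>\<^sub>M borel) (\<lambda>(w, y). (\<psi> (w, y), \<zeta> y))))"
      by (intro nn_integral_PiM_zip[OF J a b] \<Phi>m) measurable
    also have "\<dots> = (\<integral>\<^sup>+x. \<integral>\<^sup>+y. \<Phi> (\<lambda>j\<in>J. (\<lambda>(x, y). (x, k (x, y))) (x j, y j)) \<partial>iid J \<theta> \<partial>iid J \<omega>)"
      unfolding law by (intro nn_integral_PiM_zip[OF J w th, symmetric] \<Phi>m) measurable
    also have "\<dots> \<le> (\<integral>\<^sup>+x. ennreal (exp (C * la\<^sup>2 * d\<^sup>2)) \<partial>iid J \<omega>)"
    proof (intro nn_integral_mono)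
      fix x :: "nat \<Rightarrow> real"
      obtain t where t: "t \<in> T" "h x = inner_on J x t" using attained by blast
      have "(\<integral>\<^sup>+y. \<Phi> (\<lambda>j\<in>J. (\<lambda>(x, y). (x, k (x, y))) (x j, y j)) \<partial>iid J \<theta>)
        \<le> (\<integral>\<^sup>+y. ennreal (exp (\<Sum>j\<in>J. (- 2 * (la / r) * t j) * (k (x j, y j) - r * x j))) \<partial>iid J \<theta>)"
        unfolding \<Phi>_def
      proof (intro nn_integral_mono ennreal_leI, subst exp_le_cancel_iff)
        fix y
        have e1: "h (\<lambda>j. fst ((\<lambda>j\<in>J. (\<lambda>(x, y). (x, k (x, y))) (x j, y j)) j)) = h x"
          by (rule h_cong) simp
        have e2: "h (\<lambda>j. snd ((\<lambda>j\<in>J. (\<lambda>(x, y). (x, k (x, y))) (x j, y j)) j)) = h (\<lambda>j. k (x j, y j))"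
          by (rule h_cong) simp
        have *: "(la / r) * inner_on J (\<lambda>j. k (x j, y j)) t \<le> (la / r) * h (\<lambda>j. k (x j, y j))"
          using la r by (intro mult_left_mono inner_le t) auto
        have "2 * (la * h x - (la / r) * h (\<lambda>j. k (x j, y j)))
            \<le> 2 * ((la / r) * (r * inner_on J x t - inner_on J (\<lambda>j. k (x j, y j)) t))"
        proof -
          have "(la / r) * (r * inner_on J x t) = la * h x" using r t(2) by simp
          with * show ?thesis unfolding right_diff_distrib by linarith
        qed
        also have "\<dots> = (\<Sum>j\<in>J. (- 2 * (la / r) * t j) * (k (x j, y j) - r * x j))"
          unfolding inner_on_def sum_distrib_left sum_subtractf[symmetric]
          by (intro sum.cong refl) (simp add: algebra_simps)
        finally show "2 * (la * h (\<lambda>j. fst ((\<lambda>j\<in>J. (\<lambda>(x, y). (x, k (x, y))) (x j, y j)) j))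
            - (la / r) * h (\<lambda>j. snd ((\<lambda>j\<in>J. (\<lambda>(x, y). (x, k (x, y))) (x j, y j)) j)))
            \<le> (\<Sum>j\<in>J. (- 2 * (la / r) * t j) * (k (x j, y j) - r * x j))" unfolding e1 e2 .
      qed
      also have "\<dots> \<le> ennreal (exp (B * (\<Sum>j\<in>J. (- 2 * (la / r) * t j)\<^sup>2)))"
        by (rule nn_integral_exp_sum_PiM[OF J th, where \<phi>="\<lambda>j y. k (x j, y) - r * x j"]) (measurable, rule B)
      also have "\<dots> \<le> ennreal (exp (C * la\<^sup>2 * d\<^sup>2))"
      proof -
        have "B * (\<Sum>j\<in>J. (- 2 * (la / r) * t j)\<^sup>2) = (4 * B / r\<^sup>2) * la\<^sup>2 * (\<Sum>j\<in>J. (t j)\<^sup>2)"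
          by (simp add: power_mult_distrib power_divide sum_distrib_left sum_divide_distrib algebra_simps)
        also have "\<dots> \<le> C * la\<^sup>2 * d\<^sup>2"
          using sum_sq_le[OF t(1)] C AB by (intro mult_mono) (auto intro: sum_nonneg order_trans[OF _ C(2)])
        finally show ?thesis by (intro ennreal_leI) simp
      qed
      finally show "(\<integral>\<^sup>+y. \<Phi> (\<lambda>j\<in>J. (\<lambda>(x, y). (x, k (x, y))) (x j, y j)) \<partial>iid J \<theta>)
         \<le> ennreal (exp (C * la\<^sup>2 * d\<^sup>2))" .
    qed
    also have "\<dots> = ennreal (exp (C * la\<^sup>2 * d\<^sup>2))" by (simp add: PW.P.emeasure_space_1)
    finally show ?thesis .
  qed
  have "(\<integral>\<^sup>+x. ennreal (exp (la * h x)) \<partial>?A) * (\<integral>\<^sup>+y. ennreal (exp (- (la / r) * h (\<lambda>j. \<zeta> (y j)))) \<partial>?B)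
      = (\<integral>\<^sup>+x. \<integral>\<^sup>+y. ennreal (exp (?P x y + ?Q x y)) \<partial>?B \<partial>?A)"
  proof -
    have "(\<integral>\<^sup>+x. \<integral>\<^sup>+y. ennreal (exp (?P x y + ?Q x y)) \<partial>?B \<partial>?A)
        = (\<integral>\<^sup>+x. \<integral>\<^sup>+y. ennreal (exp (la * h x)) * ennreal (exp (- (la / r) * h (\<lambda>j. \<zeta> (y j)))) \<partial>?B \<partial>?A)"
      by (intro nn_integral_cong) (simp add: ennreal_mult[symmetric] exp_add[symmetric] algebra_simps)
    also have "\<dots> = (\<integral>\<^sup>+x. ennreal (exp (la * h x)) * (\<integral>\<^sup>+y. ennreal (exp (- (la / r) * h (\<lambda>j. \<zeta> (y j)))) \<partial>?B) \<partial>?A)"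
      by (intro nn_integral_cong nn_integral_cmult) measurable
    finally show ?thesis by (subst (asm) nn_integral_multc) auto
  qed
  (* The product of the two exponentials is at most half the sum of their squares, and both
     squares obey the same bound. *)
  also have "\<dots> \<le> (\<integral>\<^sup>+x. \<integral>\<^sup>+y. (ennreal (1/2) * ennreal (exp (2 * ?P x y)) + ennreal (1/2) * ennreal (exp (2 * ?Q x y))) \<partial>?B \<partial>?A)"
  proof (intro nn_integral_mono)
    fix x y
    have "exp (p + q) \<le> (1/2) * exp (2 * p) + (1/2) * exp (2 * q)" for p q :: real
      using sum_squares_bound[of "exp p" "exp q"] by (simp add: exp_add exp_double)
    then have "ennreal (exp (p + q)) \<le> ennreal (1/2) * ennreal (exp (2 * p)) + ennreal (1/2) * ennreal (exp (2 * q))" for p q :: real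
    proof -
      have "ennreal (exp (p + q)) \<le> ennreal ((1/2) * exp (2 * p) + (1/2) * exp (2 * q))"
        by (intro ennreal_leI \<open>\<And>p q. exp (p + q) \<le> (1/2) * exp (2 * p) + (1/2) * exp (2 * q)\<close>)
      also have "\<dots> = ennreal ((1/2) * exp (2 * p)) + ennreal ((1/2) * exp (2 * q))"
        by (rule ennreal_plus) auto
      also have "\<dots> = ennreal (1/2) * ennreal (exp (2 * p)) + ennreal (1/2) * ennreal (exp (2 * q))"
        by (intro arg_cong2[where f="(+)"] ennreal_mult) auto
      finally show ?thesis .
    qed
    then show "ennreal (exp (?P x y + ?Q x y)) \<le> ennreal (1/2) * ennreal (exp (2 * ?P x y)) + ennreal (1/2) * ennreal (exp (2 * ?Q x y))" .
  qed
  also have "\<dots> = (\<integral>\<^sup>+x. ennreal (1/2) * (\<integral>\<^sup>+y. ennreal (exp (2 * ?P x y)) \<partial>?B) + ennreal (1/2) * (\<integral>\<^sup>+y. ennreal (exp (2 * ?Q x y)) \<partial>?B) \<partial>?A)"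
  proof (intro nn_integral_cong)
    fix x assume "x \<in> space ?A"
    show "(\<integral>\<^sup>+y. (ennreal (1/2) * ennreal (exp (2 * ?P x y)) + ennreal (1/2) * ennreal (exp (2 * ?Q x y))) \<partial>?B)
      = ennreal (1/2) * (\<integral>\<^sup>+y. ennreal (exp (2 * ?P x y)) \<partial>?B) + ennreal (1/2) * (\<integral>\<^sup>+y. ennreal (exp (2 * ?Q x y)) \<partial>?B)"
      by (subst nn_integral_add) (auto simp: nn_integral_cmult)
  qed
  also have "\<dots> = (\<integral>\<^sup>+x. ennreal (1/2) * (\<integral>\<^sup>+y. ennreal (exp (2 * ?P x y)) \<partial>?B) \<partial>?A) + ennreal (1/2) * (\<integral>\<^sup>+x. (\<integral>\<^sup>+y. ennreal (exp (2 * ?Q x y)) \<partial>?B) \<partial>?A)"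
    by (subst nn_integral_add) (auto simp: nn_integral_cmult)
  also have "\<dots> \<le> (\<integral>\<^sup>+x. ennreal (1/2) * ennreal (exp (C * la\<^sup>2 * d\<^sup>2)) \<partial>?A) + ennreal (1/2) * ennreal (exp (C * la\<^sup>2 * d\<^sup>2))"
    by (intro add_mono mult_left_mono nn_integral_mono P2 Q2) auto
  also have "\<dots> = ennreal (exp (C * la\<^sup>2 * d\<^sup>2))"
  proof -
    have "ennreal (1/2) * e + ennreal (1/2) * e = e" for e
      by (subst distrib_right[symmetric], subst ennreal_plus[symmetric]) auto
    then show ?thesis by (simp only: nn_integral_const PA.P.emeasure_space_1 mult_1_right)
  qed
  finally show ?thesis .
qed

end

section \<open>Gaussian and Rademacher laws\<close>

lemma distr_eqI_nn_integral:
  assumes [measurable]: "f \<in> measurable M N" "g \<in> measurable M' N"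
    and e: "\<And>\<Phi>. \<Phi> \<in> borel_measurable N \<Longrightarrow> (\<integral>\<^sup>+x. \<Phi> (f x) \<partial>M) = (\<integral>\<^sup>+x. \<Phi> (g x) \<partial>M')"
  shows "distr M N f = distr M' N g"
proof (rule measure_eqI)
  fix A assume "A \<in> sets (distr M N f)"
  then have A[measurable]: "A \<in> sets N" by simp
  have "emeasure (distr M N f) A = (\<integral>\<^sup>+z. indicator A z \<partial>distr M N f)" by simp
  also have "\<dots> = (\<integral>\<^sup>+x. indicator A (f x) \<partial>M)" by (intro nn_integral_distr) auto
  also have "\<dots> = (\<integral>\<^sup>+x. indicator A (g x) \<partial>M')" by (rule e) auto
  also have "\<dots> = (\<integral>\<^sup>+z. indicator A z \<partial>distr M' N g)" by (intro nn_integral_distr[symmetric]) auto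
  finally show "emeasure (distr M N f) A = emeasure (distr M' N g) A" by simp
qed simp

abbreviation gaussian :: "real measure" where "gaussian \<equiv> std_normal_distribution"

lemma prob_space_gaussian: "prob_space gaussian"
  by (rule prob_space_normal_density) simp

lemma nn_integral_normal:
  assumes "\<sigma> > 0"
  shows "(\<integral>\<^sup>+x. ennreal (normal_density m \<sigma> x) \<partial>lborel) = 1"
  using prob_space.emeasure_space_1[OF prob_space_normal_density[OF assms, of m]]
  by (simp add: emeasure_density)

lemma normal_mgf:
  assumes "\<sigma> > 0"
  shows "(\<integral>\<^sup>+x. ennreal (exp (s * x)) \<partial>density lborel (normal_density 0 \<sigma>)) = ennreal (exp (\<sigma>\<^sup>2 * s\<^sup>2 / 2))"
proof -
  have e: "normal_density 0 \<sigma> x * exp (s * x) = exp (\<sigma>\<^sup>2 * s\<^sup>2 / 2) * normal_density (\<sigma>\<^sup>2 * s) \<sigma> x" for x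
  proof -
    have "- x\<^sup>2 / (2 * \<sigma>\<^sup>2) + s * x = \<sigma>\<^sup>2 * s\<^sup>2 / 2 + (- (x - \<sigma>\<^sup>2 * s)\<^sup>2 / (2 * \<sigma>\<^sup>2))"
      using assms by (simp add: field_simps power2_eq_square)
    then have "exp (- x\<^sup>2 / (2 * \<sigma>\<^sup>2)) * exp (s * x) = exp (\<sigma>\<^sup>2 * s\<^sup>2 / 2) * exp (- (x - \<sigma>\<^sup>2 * s)\<^sup>2 / (2 * \<sigma>\<^sup>2))"
      by (metis exp_add)
    then show ?thesis unfolding normal_density_def by simp
  qed
  have "(\<integral>\<^sup>+x. ennreal (exp (s * x)) \<partial>density lborel (normal_density 0 \<sigma>))
      = (\<integral>\<^sup>+x. ennreal (normal_density 0 \<sigma> x) * ennreal (exp (s * x)) \<partial>lborel)"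
    by (intro nn_integral_density) auto
  also have "\<dots> = (\<integral>\<^sup>+x. ennreal (exp (\<sigma>\<^sup>2 * s\<^sup>2 / 2)) * ennreal (normal_density (\<sigma>\<^sup>2 * s) \<sigma> x) \<partial>lborel)"
    by (intro nn_integral_cong) (simp add: ennreal_mult[symmetric] e)
  also have "\<dots> = ennreal (exp (\<sigma>\<^sup>2 * s\<^sup>2 / 2))"
    using assms by (subst nn_integral_cmult) (auto simp: nn_integral_normal)
  finally show ?thesis .
qed

lemma gaussian_mgf: "(\<integral>\<^sup>+x. ennreal (exp (s * x)) \<partial>gaussian) = ennreal (exp (s\<^sup>2 / 2))"
  using normal_mgf[of 1 s] by simp

lemma gaussian_exp_square: "(\<integral>\<^sup>+x. ennreal (exp (x\<^sup>2 / 4)) \<partial>gaussian) \<le> 2"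
proof -
  have s2: "sqrt 2 \<le> 2" by (rule real_le_lsqrt) auto
  have e: "std_normal_density x * exp (x\<^sup>2 / 4) = sqrt 2 * normal_density 0 (sqrt 2) x" for x
  proof -
    have "exp (- x\<^sup>2 / 2) * exp (x\<^sup>2 / 4) = exp (- x\<^sup>2 / 4)" by (simp add: exp_add[symmetric])
    moreover have "sqrt 2 / sqrt (2 * pi * (sqrt 2)\<^sup>2) = 1 / sqrt (2 * pi)"
      by (simp add: real_sqrt_mult field_simps)
    ultimately show ?thesis by (simp add: normal_density_def) (simp add: field_simps)
  qed
  have "(\<integral>\<^sup>+x. ennreal (exp (x\<^sup>2 / 4)) \<partial>gaussian)
      = (\<integral>\<^sup>+x. ennreal (std_normal_density x) * ennreal (exp (x\<^sup>2 / 4)) \<partial>lborel)"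
    by (intro nn_integral_density) auto
  also have "\<dots> = (\<integral>\<^sup>+x. ennreal (sqrt 2) * ennreal (normal_density 0 (sqrt 2) x) \<partial>lborel)"
    by (intro nn_integral_cong) (simp add: ennreal_mult[symmetric] e)
  also have "\<dots> = ennreal (sqrt 2)"
    by (subst nn_integral_cmult) (auto simp: nn_integral_normal)
  also have "\<dots> \<le> ennreal 2" by (rule ennreal_leI) (rule s2)
  finally show ?thesis by simp
qed

text \<open>
  For independent standard gaussians \<open>w\<close> and \<open>y\<close>, given \<open>x = w + y\<close> the variable \<open>y\<close> is gaussian with
  mean \<open>x / 2\<close> and variance \<open>1 / 2\<close>: the densities satisfy
  \<open>\<phi> (x - v) * \<phi> v = a x * b (v - x / 2)\<close>.
\<close>

lemma gaussian_rotation: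
  "distr (gaussian \<Otimes>\<^sub>M gaussian) (borel \<Otimes>\<^sub>M borel) (\<lambda>(w, y). (w + y, y))
   = distr (density lborel (normal_density 0 (sqrt 2)) \<Otimes>\<^sub>M density lborel (normal_density 0 (sqrt (1/2))))
       (borel \<Otimes>\<^sub>M borel) (\<lambda>(x, y). (x, x / 2 + y))"
proof (rule distr_eqI_nn_integral)
  fix \<Phi> :: "real \<times> real \<Rightarrow> ennreal" assume [measurable]: "\<Phi> \<in> borel_measurable (borel \<Otimes>\<^sub>M borel)"
  let ?\<phi> = std_normal_density and ?a = "normal_density 0 (sqrt 2)" and ?b = "normal_density 0 (sqrt (1/2))"
  interpret g: prob_space gaussian by (rule prob_space_gaussian)
  interpret b: prob_space "density lborel ?b" by (rule prob_space_normal_density) simp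
  have id: "?\<phi> (x - v) * ?\<phi> v = ?a x * ?b (v - x / 2)" for x v :: real
  proof -
    have "- (x - v)\<^sup>2 / 2 + - v\<^sup>2 / 2 = - x\<^sup>2 / 4 + - (v - x / 2)\<^sup>2"
      by (simp add: field_simps power2_eq_square)
    then have "exp (- (x - v)\<^sup>2 / 2) * exp (- v\<^sup>2 / 2) = exp (- x\<^sup>2 / 4) * exp (- (v - x / 2)\<^sup>2)"
      by (metis exp_add)
    then show ?thesis by (simp add: normal_density_def real_sqrt_mult field_simps)
  qed
  have "(\<integral>\<^sup>+p. \<Phi> (case p of (w, y) \<Rightarrow> (w + y, y)) \<partial>(gaussian \<Otimes>\<^sub>M gaussian))
      = (\<integral>\<^sup>+u. \<integral>\<^sup>+v. \<Phi> (u + v, v) \<partial>gaussian \<partial>gaussian)"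
    by (subst g.nn_integral_fst[symmetric]) auto
  also have "\<dots> = (\<integral>\<^sup>+u. \<integral>\<^sup>+v. ennreal (?\<phi> u) * (ennreal (?\<phi> v) * \<Phi> (u + v, v)) \<partial>lborel \<partial>lborel)"
    by (simp add: nn_integral_density nn_integral_cmult)
  also have "\<dots> = (\<integral>\<^sup>+v. \<integral>\<^sup>+u. ennreal (?\<phi> u) * (ennreal (?\<phi> v) * \<Phi> (u + v, v)) \<partial>lborel \<partial>lborel)"
    by (rule lborel_pair.Fubini'[symmetric]) measurable
  also have "\<dots> = (\<integral>\<^sup>+v. \<integral>\<^sup>+x. ennreal (?\<phi> (x - v)) * (ennreal (?\<phi> v) * \<Phi> (x, v)) \<partial>lborel \<partial>lborel)"
  proof (rule nn_integral_cong)
    fix v :: real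
    show "(\<integral>\<^sup>+u. ennreal (?\<phi> u) * (ennreal (?\<phi> v) * \<Phi> (u + v, v)) \<partial>lborel)
       = (\<integral>\<^sup>+x. ennreal (?\<phi> (x - v)) * (ennreal (?\<phi> v) * \<Phi> (x, v)) \<partial>lborel)"
      using nn_integral_real_affine[where c=1 and t=v and f="\<lambda>x. ennreal (?\<phi> (x - v)) * (ennreal (?\<phi> v) * \<Phi> (x, v))"]
      by (simp add: add.commute)
  qed
  also have "\<dots> = (\<integral>\<^sup>+v. \<integral>\<^sup>+x. ennreal (?a x) * (ennreal (?b (v - x / 2)) * \<Phi> (x, v)) \<partial>lborel \<partial>lborel)"
    by (intro nn_integral_cong) (simp add: mult.assoc[symmetric] ennreal_mult[symmetric] id)
  also have "\<dots> = (\<integral>\<^sup>+x. \<integral>\<^sup>+v. ennreal (?a x) * (ennreal (?b (v - x / 2)) * \<Phi> (x, v)) \<partial>lborel \<partial>lborel)"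
    by (rule lborel_pair.Fubini') measurable
  also have "\<dots> = (\<integral>\<^sup>+x. \<integral>\<^sup>+y. ennreal (?a x) * (ennreal (?b y) * \<Phi> (x, x / 2 + y)) \<partial>lborel \<partial>lborel)"
  proof (rule nn_integral_cong)
    fix x :: real
    show "(\<integral>\<^sup>+v. ennreal (?a x) * (ennreal (?b (v - x / 2)) * \<Phi> (x, v)) \<partial>lborel)
       = (\<integral>\<^sup>+y. ennreal (?a x) * (ennreal (?b y) * \<Phi> (x, x / 2 + y)) \<partial>lborel)"
      by (subst nn_integral_real_affine[where c=1 and t="x / 2"]) auto
  qed
  also have "\<dots> = (\<integral>\<^sup>+x. \<integral>\<^sup>+y. \<Phi> (x, x / 2 + y) \<partial>density lborel ?b \<partial>density lborel ?a)"
    by (simp add: nn_integral_density nn_integral_cmult)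
  also have "\<dots> = (\<integral>\<^sup>+p. \<Phi> (case p of (x, y) \<Rightarrow> (x, x / 2 + y)) \<partial>(density lborel ?a \<Otimes>\<^sub>M density lborel ?b))"
    by (subst b.nn_integral_fst[symmetric]) auto
  finally show "(\<integral>\<^sup>+p. \<Phi> (case p of (w, y) \<Rightarrow> (w + y, y)) \<partial>(gaussian \<Otimes>\<^sub>M gaussian))
    = (\<integral>\<^sup>+p. \<Phi> (case p of (x, y) \<Rightarrow> (x, x / 2 + y)) \<partial>(density lborel ?a \<Otimes>\<^sub>M density lborel ?b))" .
qed auto

lemma (in support_functional) gaussian_mgf_product:
  assumes "la \<ge> 0"
  shows "(\<integral>\<^sup>+x. ennreal (exp (la * h x)) \<partial>iid J gaussian)
       * (\<integral>\<^sup>+x. ennreal (exp (- (2 * la) * h x)) \<partial>iid J gaussian) \<le> ennreal (exp (4 * la\<^sup>2 * d\<^sup>2))"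
proof -
  interpret g: prob_space gaussian by (rule prob_space_gaussian)
  have "(\<integral>\<^sup>+x. ennreal (exp (la * h x)) \<partial>iid J gaussian)
       * (\<integral>\<^sup>+y. ennreal (exp (- (la / (1/2)) * h (\<lambda>j. (\<lambda>y. y) (y j)))) \<partial>iid J gaussian)
       \<le> ennreal (exp (4 * la\<^sup>2 * d\<^sup>2))"
  proof (rule mgf_product_of_coupling[where \<alpha>=gaussian and \<beta>=gaussian and \<omega>="density lborel (normal_density 0 (sqrt 2))"
      and \<theta>="density lborel (normal_density 0 (sqrt (1/2)))" and \<psi>="\<lambda>(w, y). w + y" and \<zeta>="\<lambda>y. y"
      and k="\<lambda>(x, y). x / 2 + y" and A="1/2" and B="1/4"])
    show "distr (gaussian \<Otimes>\<^sub>M gaussian) (borel \<Otimes>\<^sub>M borel) (\<lambda>(w, y). (case (w, y) of (w, y) \<Rightarrow> w + y, y)) =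
      distr (density lborel (normal_density 0 (sqrt 2)) \<Otimes>\<^sub>M density lborel (normal_density 0 (sqrt (1/2))))
       (borel \<Otimes>\<^sub>M borel) (\<lambda>(x, y). (x, case (x, y) of (x, y) \<Rightarrow> x / 2 + y))"
      using gaussian_rotation by simp
    show "prob_space (density lborel (normal_density 0 (sqrt 2)))" "prob_space (density lborel (normal_density 0 (sqrt (1/2))))"
      by (rule prob_space_normal_density; simp)+
    show "(\<integral>\<^sup>+y. ennreal (exp (s * ((case (w, y) of (w, y) \<Rightarrow> w + y) - w))) \<partial>gaussian) \<le> ennreal (exp (1/2 * s\<^sup>2))" for w s
      using gaussian_mgf[of s] by simp
    show "(\<integral>\<^sup>+y. ennreal (exp (s * ((case (x, y) of (x, y) \<Rightarrow> x / 2 + y) - 1/2 * x))) \<partial>density lborel (normal_density 0 (sqrt (1/2))))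
       \<le> ennreal (exp (1/4 * s\<^sup>2))" for x s
      using normal_mgf[of "sqrt (1/2)" s] by simp
  qed (auto simp: prob_space_gaussian power_divide assms)
  then show ?thesis by (simp add: mult.commute)
qed

definition rademacher :: "real measure" where
  "rademacher = distr (measure_pmf (pmf_of_set {1, -1})) borel (\<lambda>x. x)"

lemma sets_rademacher[simp, measurable_cong]: "sets rademacher = sets borel"
  by (simp add: rademacher_def)

lemma prob_space_rademacher: "prob_space rademacher"
  unfolding rademacher_def by (rule measure_pmf.prob_space_distr) simp

lemma nn_integral_rademacher:
  assumes [measurable]: "f \<in> borel_measurable borel"
  shows "(\<integral>\<^sup>+x. f x \<partial>rademacher) = ennreal (1/2) * (f 1 + f (-1))"
proof -
  have "(\<integral>\<^sup>+x. f x \<partial>rademacher) = (\<integral>\<^sup>+x. f x \<partial>measure_pmf (pmf_of_set {1, -1 :: real}))"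
    unfolding rademacher_def by (rule nn_integral_distr) auto
  also have "\<dots> = (f 1 + f (-1)) / 2"
    by (subst nn_integral_pmf_of_set) auto
  finally show ?thesis by (simp add: divide_ennreal_def mult.commute)
qed

lemma exp_minus_le_quadratic: "exp (- y) \<le> 1 - y + y\<^sup>2 / 2" if "y \<ge> 0" for y :: real
proof -
  have "1 \<le> (1 - y + y\<^sup>2 / 2) * (1 + y + y\<^sup>2 / 2)"
  proof -
    have "(1 - y + y\<^sup>2 / 2) * (1 + y + y\<^sup>2 / 2) = 1 + (y\<^sup>2)\<^sup>2 / 4"
      by (simp add: field_simps power2_eq_square)
    then show ?thesis by simp
  qed
  also have "\<dots> \<le> (1 - y + y\<^sup>2 / 2) * exp y"
  proof (intro mult_left_mono exp_lower_Taylor_quadratic that)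
    show "0 \<le> 1 - y + y\<^sup>2 / 2" using zero_le_power2[of "1 - y"] by (simp add: power2_diff)
  qed
  finally show ?thesis by (simp add: exp_minus field_simps)
qed

text \<open>
  Applied to a centred variable this replaces the exponential moment by a square exponential
  moment.
\<close>

lemma exp_le_add_exp_square: "exp x \<le> x + exp (x\<^sup>2)" for x :: real
proof -
  have sq: "1 + x\<^sup>2 \<le> exp (x\<^sup>2)" by (rule exp_ge_add_one_self)
  consider "x > 1" | "0 \<le> x" "x \<le> 1" | "x < 0" by linarith
  then show ?thesis
  proof cases
    case 1
    then have "x \<le> x\<^sup>2" by (simp add: power2_eq_square)
    then have "exp x \<le> exp (x\<^sup>2)" by simp
    with 1 show ?thesis by linarith
  next
    case 2 then show ?thesis using exp_bound[of x] sq by linarith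
  next
    case 3
    then have "exp x \<le> 1 + x + x\<^sup>2 / 2" using exp_minus_le_quadratic[of "- x"] by simp
    with sq show ?thesis using zero_le_power2[of x] by linarith
  qed
qed

lemma rademacher_mgf: "(\<integral>\<^sup>+x. ennreal (exp (s * x)) \<partial>rademacher) \<le> ennreal (exp (s\<^sup>2))"
proof -
  have "(\<integral>\<^sup>+x. ennreal (exp (s * x)) \<partial>rademacher) = ennreal ((1/2) * (exp s + exp (- s)))"
  proof -
    have "(\<integral>\<^sup>+x. ennreal (exp (s * x)) \<partial>rademacher) = ennreal (1/2) * (ennreal (exp (s * 1)) + ennreal (exp (s * -1)))"
      by (rule nn_integral_rademacher) measurable
    also have "\<dots> = ennreal (1/2) * ennreal (exp s + exp (- s))" by (subst ennreal_plus) auto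
    also have "\<dots> = ennreal ((1/2) * (exp s + exp (- s)))" by (rule ennreal_mult[symmetric]) auto
    finally show ?thesis .
  qed
  also have "\<dots> \<le> ennreal (exp (s\<^sup>2))"
    using exp_le_add_exp_square[of s] exp_le_add_exp_square[of "- s"] by (intro ennreal_leI) simp
  finally show ?thesis .
qed

definition subgauss_law :: "real \<Rightarrow> real measure \<Rightarrow> bool" where
  "subgauss_law c \<rho> \<longleftrightarrow> prob_space \<rho> \<and> sets \<rho> = sets borel \<and>
     (\<forall>s. (\<integral>\<^sup>+z. ennreal (exp (s * z)) \<partial>\<rho>) \<le> ennreal (exp (c * s\<^sup>2)))"

definition symmetric_law :: "real measure \<Rightarrow> bool" where
  "symmetric_law \<rho> \<longleftrightarrow> distr \<rho> borel uminus = \<rho>"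

lemma symmetric_law_nn_integral:
  assumes "symmetric_law \<rho>" and [measurable_cong]: "sets \<rho> = sets borel" and [measurable]: "f \<in> borel_measurable borel"
  shows "(\<integral>\<^sup>+z. f (- z) \<partial>\<rho>) = (\<integral>\<^sup>+z. f z \<partial>\<rho>)"
proof -
  have "(\<integral>\<^sup>+z. f z \<partial>\<rho>) = (\<integral>\<^sup>+z. f z \<partial>distr \<rho> borel uminus)"
    using assms(1) by (simp add: symmetric_law_def)
  also have "\<dots> = (\<integral>\<^sup>+z. f (- z) \<partial>\<rho>)" by (rule nn_integral_distr) auto
  finally show ?thesis ..
qed

lemma symmetric_sign_law:
  assumes r: "prob_space \<rho>" and s[measurable_cong]: "sets \<rho> = sets borel" and sy: "symmetric_law \<rho>"
  shows "distr (rademacher \<Otimes>\<^sub>M \<rho>) borel (\<lambda>(\<sigma>, z). \<sigma> * \<bar>z\<bar>) = \<rho>"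
proof -
  interpret r: prob_space \<rho> by fact
  have "distr (rademacher \<Otimes>\<^sub>M \<rho>) borel (\<lambda>(\<sigma>, z). \<sigma> * \<bar>z\<bar>) = distr \<rho> borel (\<lambda>z. z)"
  proof (rule distr_eqI_nn_integral)
    fix \<Phi> :: "real \<Rightarrow> ennreal" assume [measurable]: "\<Phi> \<in> borel_measurable borel"
    have "(\<integral>\<^sup>+p. \<Phi> (case p of (\<sigma>, z) \<Rightarrow> \<sigma> * \<bar>z\<bar>) \<partial>(rademacher \<Otimes>\<^sub>M \<rho>))
        = (\<integral>\<^sup>+\<sigma>. \<integral>\<^sup>+z. \<Phi> (\<sigma> * \<bar>z\<bar>) \<partial>\<rho> \<partial>rademacher)"
      by (subst r.nn_integral_fst[symmetric]) auto
    also have "\<dots> = ennreal (1/2) * ((\<integral>\<^sup>+z. \<Phi> (1 * \<bar>z\<bar>) \<partial>\<rho>) + (\<integral>\<^sup>+z. \<Phi> (-1 * \<bar>z\<bar>) \<partial>\<rho>))"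
      by (rule nn_integral_rademacher) measurable
    also have "(\<integral>\<^sup>+z. \<Phi> (1 * \<bar>z\<bar>) \<partial>\<rho>) + (\<integral>\<^sup>+z. \<Phi> (-1 * \<bar>z\<bar>) \<partial>\<rho>) = (\<integral>\<^sup>+z. (\<Phi> (1 * \<bar>z\<bar>) + \<Phi> (-1 * \<bar>z\<bar>)) \<partial>\<rho>)"
      by (rule nn_integral_add[symmetric]) auto
    also have "\<dots> = (\<integral>\<^sup>+z. (\<Phi> z + \<Phi> (- z)) \<partial>\<rho>)"
      by (intro nn_integral_cong) (auto simp: abs_if add.commute)
    also have "\<dots> = (\<integral>\<^sup>+z. \<Phi> z \<partial>\<rho>) + (\<integral>\<^sup>+z. \<Phi> (- z) \<partial>\<rho>)"
      by (rule nn_integral_add) auto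
    also have "(\<integral>\<^sup>+z. \<Phi> (- z) \<partial>\<rho>) = (\<integral>\<^sup>+z. \<Phi> z \<partial>\<rho>)"
      by (rule symmetric_law_nn_integral[OF sy s]) auto
    also have "ennreal (1/2) * ((\<integral>\<^sup>+z. \<Phi> z \<partial>\<rho>) + (\<integral>\<^sup>+z. \<Phi> z \<partial>\<rho>)) = (\<integral>\<^sup>+z. \<Phi> z \<partial>\<rho>)"
      by (simp only: distrib_left, subst distrib_right[symmetric], subst ennreal_plus[symmetric]) auto
    finally show "(\<integral>\<^sup>+p. \<Phi> (case p of (\<sigma>, z) \<Rightarrow> \<sigma> * \<bar>z\<bar>) \<partial>(rademacher \<Otimes>\<^sub>M \<rho>)) = (\<integral>\<^sup>+z. \<Phi> z \<partial>\<rho>)" .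
  qed auto
  also have "\<dots> = \<rho>" by (rule distr_id2) (simp add: s)
  finally show ?thesis .
qed

lemma exp_jensen:
  assumes P: "prob_space P" and int: "integrable P f"
  shows "ennreal (exp (\<integral>x. f x \<partial>P)) \<le> (\<integral>\<^sup>+x. ennreal (exp (f x)) \<partial>P)"
proof (cases "(\<integral>\<^sup>+x. ennreal (exp (f x)) \<partial>P) = \<infinity>")
  case False
  interpret prob_space P by fact
  note [measurable] = borel_measurable_integrable[OF int]
  have i: "integrable P (\<lambda>x. exp (f x))"
    by (intro integrableI_nonneg) (use False in \<open>auto simp: less_top\<close>)
  have "exp (\<integral>x. f x \<partial>P) \<le> (\<integral>x. exp (f x) \<partial>P)"
    by (rule jensens_inequality[where I=UNIV]) (use i int in \<open>auto intro: exp_convex\<close>)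
  with i show ?thesis by (subst nn_integral_eq_integral) (auto intro: ennreal_leI)
qed simp

text \<open>
  By Jensen's inequality the mean can be replaced by the modulus of an independent copy \<open>z'\<close>; the
  difference of the moduli is symmetric and at most \<open>\<bar>z - z'\<bar>\<close>, and the hyperbolic cosine is
  increasing in the modulus.
\<close>

lemma subgauss_abs_deviation:
  assumes "subgauss_law c \<rho>" and int: "integrable \<rho> (\<lambda>z. z)"
  shows "(\<integral>\<^sup>+z. ennreal (exp (s * (\<bar>z\<bar> - (\<integral>z. \<bar>z\<bar> \<partial>\<rho>)))) \<partial>\<rho>) \<le> ennreal (exp (2 * c * s\<^sup>2))"
proof -
  from assms have r: "prob_space \<rho>" and sb[measurable_cong]: "sets \<rho> = sets borel"
    and m: "\<And>s. (\<integral>\<^sup>+z. ennreal (exp (s * z)) \<partial>\<rho>) \<le> ennreal (exp (c * s\<^sup>2))" by (auto simp: subgauss_law_def)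
  interpret r: prob_space \<rho> by fact
  interpret rr: pair_prob_space \<rho> \<rho> by unfold_locales
  define m where "m = (\<integral>z. \<bar>z\<bar> \<partial>\<rho>)"
  have J: "ennreal (exp (- s * m)) \<le> (\<integral>\<^sup>+z. ennreal (exp (- s * \<bar>z\<bar>)) \<partial>\<rho>)"
    using exp_jensen[OF r, of "\<lambda>z. - s * \<bar>z\<bar>"] int by (simp add: m_def)
  let ?I = "\<lambda>f. (\<integral>\<^sup>+z. \<integral>\<^sup>+z'. ennreal (f z z') \<partial>\<rho> \<partial>\<rho>)"
  have "(\<integral>\<^sup>+z. ennreal (exp (s * (\<bar>z\<bar> - m))) \<partial>\<rho>) = (\<integral>\<^sup>+z. ennreal (exp (s * \<bar>z\<bar>)) * ennreal (exp (- s * m)) \<partial>\<rho>)"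
    by (intro nn_integral_cong) (simp add: ennreal_mult[symmetric] exp_add[symmetric] algebra_simps)
  also have "\<dots> \<le> (\<integral>\<^sup>+z. ennreal (exp (s * \<bar>z\<bar>)) * (\<integral>\<^sup>+z'. ennreal (exp (- s * \<bar>z'\<bar>)) \<partial>\<rho>) \<partial>\<rho>)"
    by (intro nn_integral_mono mult_left_mono J) auto
  also have "\<dots> = ?I (\<lambda>z z'. exp (s * (\<bar>z\<bar> - \<bar>z'\<bar>)))"
    by (intro nn_integral_cong, subst nn_integral_cmult[symmetric])
       (auto simp: ennreal_mult[symmetric] exp_add[symmetric] algebra_simps)
  finally have 1: "(\<integral>\<^sup>+z. ennreal (exp (s * (\<bar>z\<bar> - m))) \<partial>\<rho>) \<le> ?I (\<lambda>z z'. exp (s * (\<bar>z\<bar> - \<bar>z'\<bar>)))" .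
  have sw: "?I (\<lambda>z z'. exp (s * (\<bar>z\<bar> - \<bar>z'\<bar>))) = ?I (\<lambda>z z'. exp (s * (\<bar>z'\<bar> - \<bar>z\<bar>)))"
    by (rule rr.Fubini') measurable
  have add: "?I f + ?I g = ?I (\<lambda>z z'. f z z' + g z z')"
    if [measurable]: "case_prod f \<in> borel_measurable (borel \<Otimes>\<^sub>M borel)" "case_prod g \<in> borel_measurable (borel \<Otimes>\<^sub>M borel)"
     and p: "\<And>z z'. f z z' \<ge> 0" "\<And>z z'. g z z' \<ge> 0" for f g
    using p by (simp add: nn_integral_add)
  have "?I (\<lambda>z z'. exp (s * (\<bar>z\<bar> - \<bar>z'\<bar>))) + ?I (\<lambda>z z'. exp (s * (\<bar>z'\<bar> - \<bar>z\<bar>)))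
      \<le> ?I (\<lambda>z z'. exp (s * (z - z')) + exp (s * (z' - z)))"
  proof (subst add)
    show "?I (\<lambda>z z'. exp (s * (\<bar>z\<bar> - \<bar>z'\<bar>)) + exp (s * (\<bar>z'\<bar> - \<bar>z\<bar>))) \<le> ?I (\<lambda>z z'. exp (s * (z - z')) + exp (s * (z' - z)))"
    proof (intro nn_integral_mono ennreal_leI)
      fix z z' :: real
      have c: "exp a + exp (- a) \<le> exp b + exp (- b)" if "\<bar>a\<bar> \<le> \<bar>b\<bar>" for a b :: real
        using cosh_real_nonneg_le_iff[of "\<bar>a\<bar>" "\<bar>b\<bar>"] that by (auto simp: cosh_def abs_if split: if_splits)
      have "\<bar>s * (\<bar>z\<bar> - \<bar>z'\<bar>)\<bar> \<le> \<bar>s * (z - z')\<bar>" unfolding abs_mult by (intro mult_left_mono) auto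
      from c[OF this] show "exp (s * (\<bar>z\<bar> - \<bar>z'\<bar>)) + exp (s * (\<bar>z'\<bar> - \<bar>z\<bar>)) \<le> exp (s * (z - z')) + exp (s * (z' - z))"
        by (simp add: algebra_simps)
    qed
  qed auto
  also have "\<dots> = ?I (\<lambda>z z'. exp (s * (z - z'))) + ?I (\<lambda>z z'. exp (s * (z' - z)))"
    by (rule add[symmetric]) auto
  also have "\<dots> \<le> ennreal (exp (2 * c * s\<^sup>2)) + ennreal (exp (2 * c * s\<^sup>2))"
  proof -
    have "?I (\<lambda>z z'. exp (s * (z - z'))) \<le> ennreal (exp (2 * c * s\<^sup>2))" for s
    proof -
      have "?I (\<lambda>z z'. exp (s * (z - z'))) = (\<integral>\<^sup>+z. ennreal (exp (s * z)) * (\<integral>\<^sup>+z'. ennreal (exp ((- s) * z')) \<partial>\<rho>) \<partial>\<rho>)"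
        by (intro nn_integral_cong, subst nn_integral_cmult[symmetric])
           (auto simp: ennreal_mult[symmetric] exp_add[symmetric] algebra_simps)
      also have "\<dots> = (\<integral>\<^sup>+z. ennreal (exp (s * z)) \<partial>\<rho>) * (\<integral>\<^sup>+z'. ennreal (exp ((- s) * z')) \<partial>\<rho>)"
        by (rule nn_integral_multc) auto
      also have "\<dots> \<le> ennreal (exp (c * s\<^sup>2)) * ennreal (exp (c * (- s)\<^sup>2))"
        by (intro mult_mono m) auto
      also have "\<dots> = ennreal (exp (2 * c * s\<^sup>2))" by (simp add: ennreal_mult[symmetric] exp_add[symmetric])
      finally show ?thesis .
    qed
    from this[of s] this[of "- s"] show ?thesis by (intro add_mono) (auto simp: algebra_simps)
  qed
  finally have "2 * ?I (\<lambda>z z'. exp (s * (\<bar>z\<bar> - \<bar>z'\<bar>))) \<le> 2 * ennreal (exp (2 * c * s\<^sup>2))"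
    unfolding sw[symmetric] mult_2 .
  then have "?I (\<lambda>z z'. exp (s * (\<bar>z\<bar> - \<bar>z'\<bar>))) \<le> ennreal (exp (2 * c * s\<^sup>2))"
    by (subst (asm) ennreal_mult_le_mult_iff) auto
  with 1 show ?thesis unfolding m_def by (rule order_trans)
qed

section \<open>The coupling inequality for Rademacher against subgaussian coordinates\<close>

lemma ennreal_half: "ennreal (1/2) * x + ennreal (1/2) * x = x"
  by (subst distrib_right[symmetric], subst ennreal_plus[symmetric]) auto

lemma ennreal_half': "inverse 2 * x + inverse 2 * x = (x :: ennreal)"
  using ennreal_half[of x] by simp

lemma nn_integral_rademacher_pair:
  assumes "prob_space M" and [measurable]: "f \<in> borel_measurable (borel \<Otimes>\<^sub>M M)"
  shows "(\<integral>\<^sup>+p. f p \<partial>(rademacher \<Otimes>\<^sub>M M)) = ennreal (1/2) * ((\<integral>\<^sup>+z. f (1, z) \<partial>M) + (\<integral>\<^sup>+z. f (-1, z) \<partial>M))"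
proof -
  interpret r: prob_space M by fact
  have "(\<integral>\<^sup>+p. f p \<partial>(rademacher \<Otimes>\<^sub>M M)) = (\<integral>\<^sup>+\<sigma>. \<integral>\<^sup>+z. f (\<sigma>, z) \<partial>M \<partial>rademacher)"
    by (rule r.nn_integral_fst[symmetric]) measurable
  also have "\<dots> = ennreal (1/2) * ((\<integral>\<^sup>+z. f (1, z) \<partial>M) + (\<integral>\<^sup>+z. f (-1, z) \<partial>M))"
    by (rule nn_integral_rademacher) measurable
  finally show ?thesis .
qed

text \<open>
  The coupling of signs \<open>w\<close> with a symmetric variable \<open>z = \<sigma> * \<bar>z\<bar>\<close> uses \<open>x = w + \<sigma>\<close>. Given \<open>x = 2\<close> or
  \<open>x = - 2\<close>, the variable is \<open>\<bar>z\<bar>\<close> or \<open>- \<bar>z\<bar>\<close>; given \<open>x = 0\<close>, its sign is still uniform. So its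
  conditional mean is \<open>(m / 2) * x\<close> with \<open>m\<close> the mean of \<open>\<bar>z\<bar>\<close>.
\<close>

lemma (in support_functional) rademacher_mgf_product:
  assumes law: "subgauss_law c \<rho>" and sy: "symmetric_law \<rho>" and int: "integrable \<rho> (\<lambda>z. z)"
    and m: "m = (\<integral>z. \<bar>z\<bar> \<partial>\<rho>)" "m > 0" and c: "c \<ge> 0" and la: "la \<ge> 0"
    and C: "C \<ge> 4" "C \<ge> 32 * c / m\<^sup>2"
  shows "(\<integral>\<^sup>+x. ennreal (exp (la * h x)) \<partial>iid J rademacher)
       * (\<integral>\<^sup>+x. ennreal (exp (- (2 * la / m) * h x)) \<partial>iid J \<rho>) \<le> ennreal (exp (C * la\<^sup>2 * d\<^sup>2))"
proof -
  from law have r: "prob_space \<rho>" and sb[measurable_cong]: "sets \<rho> = sets borel"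
    and mg: "\<And>s. (\<integral>\<^sup>+z. ennreal (exp (s * z)) \<partial>\<rho>) \<le> ennreal (exp (c * s\<^sup>2))" by (auto simp: subgauss_law_def)
  interpret r: prob_space \<rho> by fact
  interpret q: prob_space rademacher by (rule prob_space_rademacher)
  interpret qr: pair_prob_space rademacher \<rho> by unfold_locales
  interpret qq: pair_prob_space rademacher rademacher by unfold_locales
  let ?b = "rademacher \<Otimes>\<^sub>M \<rho>"
  let ?\<zeta> = "\<lambda>(\<sigma>::real, z::real). \<sigma> * \<bar>z\<bar>"
  let ?\<psi> = "\<lambda>(w::real, y::real \<times> real). w + fst y"
  (* Only the values x = 2, - 2, 0 occur; the last branch keeps the conditional mean right elsewhere. *)
  define k :: "real \<times> real \<times> real \<Rightarrow> real" where
    "k = (\<lambda>(x, \<eta>, z). if x = 2 then \<bar>z\<bar> else if x = -2 then - \<bar>z\<bar> else if x = 0 then \<eta> * \<bar>z\<bar> else m / 2 * x)"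
  have [measurable]: "k \<in> borel_measurable (borel \<Otimes>\<^sub>M borel \<Otimes>\<^sub>M borel)" unfolding k_def by measurable
  define om where "om = distr (rademacher \<Otimes>\<^sub>M rademacher) borel (\<lambda>(a, b). a + b)"
  have so[measurable_cong, simp]: "sets om = sets borel" by (simp add: om_def)
  interpret om: prob_space om unfolding om_def by (rule qq.prob_space_distr) measurable
  have mgfB: "(\<integral>\<^sup>+z. ennreal (exp (s * z)) \<partial>\<rho>) \<le> ennreal (exp (2 * c * s\<^sup>2))" for s
    by (rule order_trans[OF mg]) (use c in \<open>auto intro!: ennreal_leI mult_right_mono\<close>)
  have hl: "ennreal (1/2) * (x + y) \<le> t" if "x \<le> t" "y \<le> t" for x y t :: ennreal
  proof -
    have "ennreal (1/2) * (x + y) \<le> ennreal (1/2) * (t + t)" by (intro mult_left_mono add_mono that) auto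
    then show ?thesis by (simp only: distrib_left ennreal_half)
  qed
  have "(\<integral>\<^sup>+x. ennreal (exp (la * h x)) \<partial>iid J rademacher)
       * (\<integral>\<^sup>+y. ennreal (exp (- (la / (m/2)) * h (\<lambda>j. ?\<zeta> (y j)))) \<partial>iid J ?b)
       \<le> ennreal (exp (C * la\<^sup>2 * d\<^sup>2))"
  proof (rule mgf_product_of_coupling[where \<alpha>=rademacher and \<beta>="?b" and \<omega>=om and \<theta>="?b" and \<psi>="?\<psi>" and \<zeta>="?\<zeta>"
      and k=k and A=1 and B="2 * c"])
    show "prob_space om" by (rule om.prob_space_axioms)
    show "prob_space ?b" "prob_space ?b" by unfold_locales
    show "distr (rademacher \<Otimes>\<^sub>M ?b) (borel \<Otimes>\<^sub>M borel) (\<lambda>(w, y). (?\<psi> (w, y), ?\<zeta> y))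
        = distr (om \<Otimes>\<^sub>M ?b) (borel \<Otimes>\<^sub>M borel) (\<lambda>(x, y). (x, k (x, y)))"
    proof (rule distr_eqI_nn_integral)
      fix \<Phi> :: "real \<times> real \<Rightarrow> ennreal" assume [measurable]: "\<Phi> \<in> borel_measurable (borel \<Otimes>\<^sub>M borel)"
      let ?I = "\<lambda>x f. (\<integral>\<^sup>+z. \<Phi> (x, f \<bar>z\<bar>) \<partial>\<rho>)"
      let ?h = "ennreal (1/2)"
      have "(\<integral>\<^sup>+p. \<Phi> (case p of (w, y) \<Rightarrow> (?\<psi> (w, y), ?\<zeta> y)) \<partial>(rademacher \<Otimes>\<^sub>M ?b))
         = ?h * (?h * (?I 2 (\<lambda>z. z) + ?I 0 uminus) + ?h * (?I 0 (\<lambda>z. z) + ?I (-2) uminus))"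
        by (subst nn_integral_rademacher_pair, unfold_locales, measurable)
           (simp add: nn_integral_rademacher_pair[OF r])
      also have "\<dots> = ?h * (?h * (?I 2 (\<lambda>z. z) + ?h * (?I 0 (\<lambda>z. z) + ?I 0 uminus)) + ?h * (?h * (?I 0 (\<lambda>z. z) + ?I 0 uminus) + ?I (-2) uminus))"
      proof -
        have "?h * (a + b') + ?h * (b + c) = ?h * (a + ?h * (b + b')) + ?h * (?h * (b + b') + c)" for a b b' c
        proof -
          have "?h * (a + ?h * (b + b')) + ?h * (?h * (b + b') + c)
             = ?h * a + ?h * c + (?h * (?h * (b + b')) + ?h * (?h * (b + b')))"
            by (simp only: distrib_left ac_simps)
          also have "\<dots> = ?h * a + ?h * c + ?h * (b + b')" by (simp only: ennreal_half)
          finally show ?thesis by (simp only: distrib_left distrib_right ac_simps)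
        qed
        then show ?thesis by simp
      qed
      also have "\<dots> = (\<integral>\<^sup>+x. \<integral>\<^sup>+y. \<Phi> (x, k (x, y)) \<partial>?b \<partial>om)"
      proof -
        let ?g = "\<lambda>x. \<integral>\<^sup>+y. \<Phi> (x, k (x, y)) \<partial>?b"
        have "(\<integral>\<^sup>+x. ?g x \<partial>om) = (\<integral>\<^sup>+p. ?g (case p of (a, b) \<Rightarrow> a + b) \<partial>(rademacher \<Otimes>\<^sub>M rademacher))"
          unfolding om_def by (rule nn_integral_distr) measurable
        also have "\<dots> = ?h * (?h * (?g 2 + ?g 0) + ?h * (?g 0 + ?g (-2)))"
          by (subst nn_integral_rademacher_pair[OF prob_space_rademacher], measurable) (simp add: nn_integral_rademacher)
        also have "?g 2 = ?I 2 (\<lambda>z. z)"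
          by (subst nn_integral_rademacher_pair[OF r], measurable) (simp add: k_def distrib_left ennreal_half')
        also have "?g (-2) = ?I (-2) uminus"
          by (subst nn_integral_rademacher_pair[OF r], measurable) (simp add: k_def distrib_left ennreal_half')
        also have "?g 0 = ?h * (?I 0 (\<lambda>z. z) + ?I 0 uminus)"
          by (subst nn_integral_rademacher_pair[OF r], measurable) (simp add: k_def)
        finally show ?thesis ..
      qed
      also have "\<dots> = (\<integral>\<^sup>+p. \<Phi> (case p of (x, y) \<Rightarrow> (x, k (x, y))) \<partial>(om \<Otimes>\<^sub>M ?b))"
        by (subst qr.P.nn_integral_fst[symmetric]) auto
      finally show "(\<integral>\<^sup>+p. \<Phi> (case p of (w, y) \<Rightarrow> (?\<psi> (w, y), ?\<zeta> y)) \<partial>(rademacher \<Otimes>\<^sub>M ?b))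
        = (\<integral>\<^sup>+p. \<Phi> (case p of (x, y) \<Rightarrow> (x, k (x, y))) \<partial>(om \<Otimes>\<^sub>M ?b))" .
    qed measurable
    show "(\<integral>\<^sup>+y. ennreal (exp (s * (?\<psi> (w, y) - w))) \<partial>?b) \<le> ennreal (exp (1 * s\<^sup>2))" for w s
    proof -
      have "(\<integral>\<^sup>+y. ennreal (exp (s * (?\<psi> (w, y) - w))) \<partial>?b) = (\<integral>\<^sup>+y. ennreal (exp (s * fst y)) \<partial>?b)"
        by simp
      also have "\<dots> = ennreal (1/2) * (ennreal (exp (s * 1)) + ennreal (exp (s * -1)))"
        by (subst nn_integral_rademacher_pair[OF r], measurable) (simp add: r.emeasure_space_1)
      also have "\<dots> = (\<integral>\<^sup>+x. ennreal (exp (s * x)) \<partial>rademacher)"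
        by (rule nn_integral_rademacher[symmetric]) measurable
      finally show ?thesis using rademacher_mgf[of s] by simp
    qed
    show "(\<integral>\<^sup>+y. ennreal (exp (s * (k (x, y) - m/2 * x))) \<partial>?b) \<le> ennreal (exp (2 * c * s\<^sup>2))" for x s
    proof -
      have "(\<integral>\<^sup>+y. ennreal (exp (s * (k (x, y) - m/2 * x))) \<partial>?b)
        = ennreal (1/2) * ((\<integral>\<^sup>+z. ennreal (exp (s * (k (x, 1, z) - m/2 * x))) \<partial>\<rho>) + (\<integral>\<^sup>+z. ennreal (exp (s * (k (x, -1, z) - m/2 * x))) \<partial>\<rho>))"
        by (subst nn_integral_rademacher_pair[OF r], measurable)
      also have "\<dots> \<le> ennreal (exp (2 * c * s\<^sup>2))"
      proof -
        consider "x = 2" | "x = -2" | "x = 0" | "x \<noteq> 2" "x \<noteq> -2" "x \<noteq> 0" by auto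
        then show ?thesis
        proof cases
          case 1 then show ?thesis using subgauss_abs_deviation[OF law int, of s]
            by (intro hl) (auto simp: k_def m)
        next
          case 2 then show ?thesis using subgauss_abs_deviation[OF law int, of "- s"]
            by (intro hl) (auto simp: k_def m algebra_simps)
        next
          case 3
          have "ennreal (1/2) * ((\<integral>\<^sup>+z. ennreal (exp (s * (k (x, 1, z) - m/2 * x))) \<partial>\<rho>) + (\<integral>\<^sup>+z. ennreal (exp (s * (k (x, -1, z) - m/2 * x))) \<partial>\<rho>))
             = ennreal (1/2) * (\<integral>\<^sup>+z. (ennreal (exp (s * \<bar>z\<bar>)) + ennreal (exp (s * (- \<bar>z\<bar>)))) \<partial>\<rho>)"
            by (subst nn_integral_add) (auto simp: k_def 3)
          also have "\<dots> = ennreal (1/2) * (\<integral>\<^sup>+z. (ennreal (exp (s * z)) + ennreal (exp ((- s) * z))) \<partial>\<rho>)"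
            by (intro arg_cong[where f="(*) (ennreal (1/2))"] nn_integral_cong) (auto simp: abs_if add.commute)
          also have "\<dots> = ennreal (1/2) * ((\<integral>\<^sup>+z. ennreal (exp (s * z)) \<partial>\<rho>) + (\<integral>\<^sup>+z. ennreal (exp ((- s) * z)) \<partial>\<rho>))"
            by (subst nn_integral_add) auto
          also have "\<dots> \<le> ennreal (exp (2 * c * s\<^sup>2))" by (intro hl) (use mgfB[of s] mgfB[of "- s"] in auto)
          finally show ?thesis .
        next
          case 4 then show ?thesis using c by (intro hl) (auto simp: k_def r.emeasure_space_1)
        qed
      qed
      finally show ?thesis .
    qed
    show "4 * (2 * c) / (m/2)\<^sup>2 \<le> C" using C(2) by (simp add: power_divide field_simps)
  qed (use m c la C in \<open>auto simp: prob_space_rademacher\<close>)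
  moreover have "(\<integral>\<^sup>+y. ennreal (exp (- (la / (m/2)) * h (\<lambda>j. ?\<zeta> (y j)))) \<partial>iid J ?b)
     = (\<integral>\<^sup>+x. ennreal (exp (- (2 * la / m) * h x)) \<partial>iid J \<rho>)"
  proof -
    have "(\<integral>\<^sup>+y. ennreal (exp (- (2 * la / m) * h (\<lambda>j\<in>J. ?\<zeta> (y j)))) \<partial>iid J ?b)
       = (\<integral>\<^sup>+x. ennreal (exp (- (2 * la / m) * h x)) \<partial>iid J (distr ?b borel ?\<zeta>))"
      by (rule nn_integral_PiM_map[OF finite_J qr.P.prob_space_axioms]) measurable
    then show ?thesis unfolding symmetric_sign_law[OF r sb sy] by (simp add: mult.commute)
  qed
  ultimately show ?thesis by simp
qed

section \<open>Subgaussian laws and linear forms\<close>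

lemma subgauss_lawD:
  assumes "subgauss_law c \<rho>"
  shows "prob_space \<rho>" "sets \<rho> = sets borel" "(\<integral>\<^sup>+z. ennreal (exp (s * z)) \<partial>\<rho>) \<le> ennreal (exp (c * s\<^sup>2))"
  using assms by (auto simp: subgauss_law_def)

text \<open>
  The bound on the \<open>\<psi>\<^sub>2\<close> norm yields a constant \<open>c < 2 * L\<close> with \<open>E exp ((f / c)\<^sup>2) \<le> 2\<close>. Put \<open>p = s\<^sup>2 * c\<^sup>2\<close>. For
  \<open>p \<le> 1\<close> the mean is removed with \<open>exp u \<le> u + exp u\<^sup>2\<close>, and convexity bounds
  \<open>exp (p * (f / c)\<^sup>2)\<close>; for \<open>p > 1\<close> the inequality \<open>s * f \<le> p / 2 + (f / c)\<^sup>2 / 2\<close> is enough.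
\<close>

lemma subgaussian_mgf:
  fixes f :: "'a \<Rightarrow> real"
  assumes M: "prob_space M" and f[measurable]: "f \<in> borel_measurable M"
    and f0: "(\<integral>x. f x \<partial>M) = 0" and f2: "(\<integral>x. (f x)\<^sup>2 \<partial>M) = 1"
    and L: "L > 1" and sg: "subgaussian M L f"
  shows "(\<integral>\<^sup>+x. ennreal (exp (s * f x)) \<partial>M) \<le> ennreal (exp (4 * L\<^sup>2 * s\<^sup>2))"
proof -
  interpret prob_space M by fact
  have "psi2_norm M f < ereal (2 * L)"
    using sg L f2 by (auto simp: subgaussian_def intro: le_less_trans)
  then obtain c where c: "0 < c" "(\<integral>\<^sup>+\<omega>. ennreal (exp (\<bar>f \<omega> / c\<bar>\<^sup>2)) \<partial>M) \<le> 2" "c < 2 * L"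
    unfolding psi2_norm_def Inf_less_iff by auto
  define E where "E = (\<lambda>x. exp ((f x / c)\<^sup>2))"
  have E2: "(\<integral>\<^sup>+x. ennreal (E x) \<partial>M) \<le> 2" using c(2) by (simp add: E_def power_divide)
  have iE: "integrable M E"
    by (rule integrableI_nonneg) (use E2 in \<open>auto simp: E_def intro: le_less_trans\<close>)
  have E2': "(\<integral>x. E x \<partial>M) \<le> 2"
  proof -
    have "ennreal (\<integral>x. E x \<partial>M) = (\<integral>\<^sup>+x. ennreal (E x) \<partial>M)"
      by (rule nn_integral_eq_integral[OF iE, symmetric]) (auto simp: E_def)
    with E2 have "ennreal (\<integral>x. E x \<partial>M) \<le> ennreal 2" by simp
    then show ?thesis by (subst (asm) ennreal_le_iff) auto
  qed
  have if2: "integrable M (\<lambda>x. (f x)\<^sup>2)" using f2 by (metis not_integrable_integral_eq zero_neq_one)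
  have if1: "integrable M f" using if2 by (rule square_integrable_imp_integrable[rotated]) auto
  define p where "p = s\<^sup>2 * c\<^sup>2"
  have p0: "p \<ge> 0" by (simp add: p_def)
  have key: "\<exists>g. integrable M g \<and> (\<integral>x. g x \<partial>M) \<le> exp p \<and> (\<forall>x. exp (s * f x) \<le> g x)"
  proof (cases "p \<le> 1")
    case True
    let ?g = "\<lambda>x. s * f x + ((1 - p) + p * E x)"
    have "exp (s * f x) \<le> ?g x" for x
    proof -
      have "exp ((1 - p) * 0 + p * (f x / c)\<^sup>2) \<le> (1 - p) * exp 0 + p * exp ((f x / c)\<^sup>2)"
        using convex_onD[OF exp_convex, of p 0 "(f x / c)\<^sup>2"] True p0 by simp
      moreover have "(s * f x)\<^sup>2 = p * (f x / c)\<^sup>2" using c(1) by (simp add: p_def power_mult_distrib power_divide)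
      ultimately show ?thesis using exp_le_add_exp_square[of "s * f x"] by (simp add: E_def)
    qed
    moreover have "integrable M ?g" using if1 iE by auto
    moreover have "(\<integral>x. ?g x \<partial>M) \<le> exp p"
    proof -
      have "(\<integral>x. ?g x \<partial>M) = (1 - p) + p * (\<integral>x. E x \<partial>M)" using if1 iE f0 by (simp add: prob_space)
      also have "\<dots> \<le> 1 + p" using mult_left_mono[OF E2' p0] by linarith
      also have "\<dots> \<le> exp p" by (rule exp_ge_add_one_self)
      finally show ?thesis .
    qed
    ultimately show ?thesis by blast
  next
    case False
    let ?g = "\<lambda>x. exp (p / 2) * (1/2 + 1/2 * E x)"
    have "exp (s * f x) \<le> ?g x" for x
    proof -
      let ?a = "f x / c"
      have "s * f x = (s * c) * ?a" using c(1) by simp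
      also have "\<dots> \<le> p / 2 + ?a\<^sup>2 / 2" using sum_squares_bound[of "s * c" ?a] c(1) by (simp add: p_def power_mult_distrib field_simps)
      finally have "exp (s * f x) \<le> exp (p / 2) * exp (?a\<^sup>2 / 2)" by (simp add: exp_add[symmetric])
      also have "exp (?a\<^sup>2 / 2) \<le> 1/2 + 1/2 * E x"
        using convex_onD[OF exp_convex, of "1/2" 0 "?a\<^sup>2"] by (simp add: E_def)
      finally show ?thesis by simp
    qed
    moreover have "integrable M ?g" using iE by auto
    moreover have "(\<integral>x. ?g x \<partial>M) \<le> exp p"
    proof -
      have "(\<integral>x. ?g x \<partial>M) = exp (p / 2) * (1/2 + 1/2 * (\<integral>x. E x \<partial>M))" using iE by (simp add: prob_space)
      also have "\<dots> \<le> exp (p / 2) * exp (1/2)" using E2' exp_ge_add_one_self[of "1/2 :: real"] by (intro mult_left_mono) auto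
      also have "\<dots> \<le> exp p" using False by (simp add: exp_add[symmetric])
      finally show ?thesis .
    qed
    ultimately show ?thesis by blast
  qed
  then obtain g where g: "integrable M g" "(\<integral>x. g x \<partial>M) \<le> exp p" "\<And>x. exp (s * f x) \<le> g x" by blast
  have "(\<integral>\<^sup>+x. ennreal (exp (s * f x)) \<partial>M) \<le> (\<integral>\<^sup>+x. ennreal (g x) \<partial>M)"
    by (intro nn_integral_mono ennreal_leI g)
  also have "\<dots> = ennreal (\<integral>x. g x \<partial>M)"
    by (rule nn_integral_eq_integral[OF g(1)]) (auto intro: order_trans[OF exp_ge_zero g(3)])
  also have "\<dots> \<le> ennreal (exp (4 * L\<^sup>2 * s\<^sup>2))"
  proof (intro ennreal_leI order_trans[OF g(2)], subst exp_le_cancel_iff)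
    have "c\<^sup>2 \<le> (2 * L)\<^sup>2" using c by (intro power_mono) auto
    then show "p \<le> 4 * L\<^sup>2 * s\<^sup>2" using mult_left_mono[of "c\<^sup>2" "(2 * L)\<^sup>2" "s\<^sup>2"] by (simp add: p_def algebra_simps)
  qed
  finally show ?thesis .
qed

lemma fourth_power_le_exp: "z ^ 4 \<le> 64 * (exp z + exp (- z))" for z :: real
proof -
  have "(z\<^sup>2 / 8)\<^sup>2 \<le> (exp (\<bar>z\<bar> / 2))\<^sup>2"
    using exp_lower_Taylor_quadratic[of "\<bar>z\<bar> / 2"] by (intro power_mono) (auto simp: power_divide)
  also have "\<dots> = exp \<bar>z\<bar>" by (simp add: exp_double[symmetric])
  also have "\<dots> \<le> exp z + exp (- z)" by (auto simp: abs_if)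
  finally show ?thesis by (simp add: power_divide)
qed

lemma subgauss_fourth_moment:
  assumes "subgauss_law c \<rho>"
  shows "(\<integral>\<^sup>+z. ennreal (z ^ 4) \<partial>\<rho>) \<le> ennreal (128 * exp c)"
proof -
  note [measurable_cong] = subgauss_lawD(2)[OF assms]
  have "(\<integral>\<^sup>+z. ennreal (z ^ 4) \<partial>\<rho>) \<le> (\<integral>\<^sup>+z. ennreal 64 * (ennreal (exp (1 * z)) + ennreal (exp (- 1 * z))) \<partial>\<rho>)"
  proof (intro nn_integral_mono)
    fix z :: real
    show "ennreal (z ^ 4) \<le> ennreal 64 * (ennreal (exp (1 * z)) + ennreal (exp (- 1 * z)))"
      using ennreal_leI[OF fourth_power_le_exp[of z]] by (simp add: ennreal_mult)
  qed
  also have "\<dots> = ennreal 64 * ((\<integral>\<^sup>+z. ennreal (exp (1 * z)) \<partial>\<rho>) + (\<integral>\<^sup>+z. ennreal (exp (- 1 * z)) \<partial>\<rho>))"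
    by (subst nn_integral_cmult) (auto simp: nn_integral_add)
  also have "\<dots> \<le> ennreal 64 * (ennreal (exp (c * 1\<^sup>2)) + ennreal (exp (c * (-1)\<^sup>2)))"
    by (intro mult_left_mono add_mono subgauss_lawD[OF assms]) auto
  also have "\<dots> = ennreal (128 * exp c)"
    by (subst ennreal_plus[symmetric], simp, simp, subst ennreal_mult[symmetric]) auto
  finally show ?thesis .
qed

lemma subgauss_fourth_moment':
  assumes "subgauss_law c \<rho>"
  shows "integrable \<rho> (\<lambda>z. z ^ 4)" "(\<integral>z. z ^ 4 \<partial>\<rho>) \<le> 128 * exp c"
proof -
  note [measurable_cong] = subgauss_lawD(2)[OF assms]
  note b = subgauss_fourth_moment[OF assms]
  show i: "integrable \<rho> (\<lambda>z. z ^ 4)"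
    by (rule integrableI_nonneg) (use b in \<open>auto intro: le_less_trans\<close>)
  have "ennreal (\<integral>z. z ^ 4 \<partial>\<rho>) = (\<integral>\<^sup>+z. ennreal (z ^ 4) \<partial>\<rho>)"
    by (rule nn_integral_eq_integral[OF i, symmetric]) auto
  with b have "ennreal (\<integral>z. z ^ 4 \<partial>\<rho>) \<le> ennreal (128 * exp c)" by simp
  then show "(\<integral>z. z ^ 4 \<partial>\<rho>) \<le> 128 * exp c" by (subst (asm) ennreal_le_iff) auto
qed

lemma integrable_if_second_moment:
  fixes \<rho> :: "real measure"
  assumes "prob_space \<rho>" "sets \<rho> = sets borel" and z2: "(\<integral>z. z\<^sup>2 \<partial>\<rho>) = 1"
  shows "integrable \<rho> (\<lambda>z. z\<^sup>2)" "integrable \<rho> (\<lambda>z. z)"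
proof -
  interpret prob_space \<rho> by fact
  note [measurable_cong] = assms(2)
  show "integrable \<rho> (\<lambda>z. z\<^sup>2)" using z2 by (metis not_integrable_integral_eq zero_neq_one)
  then show "integrable \<rho> (\<lambda>z. z)" by (rule square_integrable_imp_integrable[rotated]) auto
qed

text \<open>
  A unit second moment and a bounded fourth moment prevent the first moment from being small:
  \<open>z\<^sup>2 \<le> b * \<bar>z\<bar> + z ^ 4 / b\<^sup>2\<close> for every \<open>b > 0\<close>.
\<close>

lemma subgauss_abs_moment:
  assumes law: "subgauss_law c \<rho>" and z2: "(\<integral>z. z\<^sup>2 \<partial>\<rho>) = 1"
  shows "exp (- c / 2) / 32 \<le> (\<integral>z. \<bar>z\<bar> \<partial>\<rho>)"
proof -
  interpret prob_space \<rho> by (rule subgauss_lawD[OF law])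
  note [measurable_cong] = subgauss_lawD(2)[OF law]
  note i = integrable_if_second_moment[OF subgauss_lawD(1,2)[OF law] z2]
  define b where "b = 16 * exp (c / 2)"
  have b: "b > 0" "b\<^sup>2 = 256 * exp c" by (auto simp: b_def power_mult_distrib exp_double[symmetric])
  have "z\<^sup>2 \<le> b * \<bar>z\<bar> + z ^ 4 / b\<^sup>2" for z :: real
  proof (cases "\<bar>z\<bar> \<le> b")
    case True
    then have "\<bar>z\<bar> * \<bar>z\<bar> \<le> b * \<bar>z\<bar>" by (intro mult_right_mono) auto
    then have "z\<^sup>2 \<le> b * \<bar>z\<bar>" by (simp add: power2_eq_square)
    moreover have "0 \<le> z ^ 4 / b\<^sup>2" by simp
    ultimately show ?thesis by linarith
  next
    case False
    then have "b\<^sup>2 \<le> \<bar>z\<bar>\<^sup>2" using b by (intro power_mono) auto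
    then have "z\<^sup>2 * b\<^sup>2 \<le> z\<^sup>2 * z\<^sup>2" by (intro mult_left_mono) auto
    also have "\<dots> = z ^ 4" by simp
    finally have "z\<^sup>2 \<le> z ^ 4 / b\<^sup>2" using b by (simp add: field_simps)
    then show ?thesis using b by (simp add: add_increasing)
  qed
  then have "(\<integral>z. z\<^sup>2 \<partial>\<rho>) \<le> (\<integral>z. b * \<bar>z\<bar> + z ^ 4 / b\<^sup>2 \<partial>\<rho>)"
    using i subgauss_fourth_moment'(1)[OF law] by (intro integral_mono) auto
  also have "\<dots> = b * (\<integral>z. \<bar>z\<bar> \<partial>\<rho>) + (\<integral>z. z ^ 4 \<partial>\<rho>) / b\<^sup>2"
    using i subgauss_fourth_moment'(1)[OF law] by simp
  also have "\<dots> \<le> b * (\<integral>z. \<bar>z\<bar> \<partial>\<rho>) + 128 * exp c / b\<^sup>2"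
    using subgauss_fourth_moment'(2)[OF law] by (intro add_left_mono divide_right_mono) auto
  finally have "1/2 \<le> b * (\<integral>z. \<bar>z\<bar> \<partial>\<rho>)" using z2 b by simp
  then have "1 / (2 * b) \<le> (\<integral>z. \<bar>z\<bar> \<partial>\<rho>)" using b by (simp add: field_simps)
  then show ?thesis by (simp add: b_def exp_minus field_simps)
qed

lemma subgauss_exp_minus_square:
  assumes law: "subgauss_law c \<rho>" and z2: "(\<integral>z. z\<^sup>2 \<partial>\<rho>) = 1" and s: "s = exp (- c) / 128"
  shows "(\<integral>\<^sup>+z. ennreal (exp (- s * z\<^sup>2)) \<partial>\<rho>) \<le> ennreal (exp (- s / 2))"
proof -
  interpret prob_space \<rho> by (rule subgauss_lawD[OF law])
  note [measurable_cong] = subgauss_lawD(2)[OF law]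
  note i = integrable_if_second_moment[OF subgauss_lawD(1,2)[OF law] z2] subgauss_fourth_moment'(1)[OF law]
  let ?g = "\<lambda>z. 1 - s * z\<^sup>2 + s\<^sup>2 / 2 * z ^ 4"
  have le: "exp (- s * z\<^sup>2) \<le> ?g z" for z
  proof -
    have "s \<ge> 0" by (simp add: s)
    then show ?thesis using exp_minus_le_quadratic[of "s * z\<^sup>2"] by (simp add: power_mult_distrib)
  qed
  have ig: "integrable \<rho> ?g" using i by auto
  have "(\<integral>\<^sup>+z. ennreal (exp (- s * z\<^sup>2)) \<partial>\<rho>) \<le> (\<integral>\<^sup>+z. ennreal (?g z) \<partial>\<rho>)"
    by (intro nn_integral_mono ennreal_leI le)
  also have "\<dots> = ennreal (\<integral>z. ?g z \<partial>\<rho>)"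
    by (rule nn_integral_eq_integral[OF ig]) (intro AE_I2 order_trans[OF exp_ge_zero le])
  also have "(\<integral>z. ?g z \<partial>\<rho>) = 1 - s * 1 + s\<^sup>2 / 2 * (\<integral>z. z ^ 4 \<partial>\<rho>)"
    using i z2 by (simp add: prob_space)
  also have "ennreal (1 - s * 1 + s\<^sup>2 / 2 * (\<integral>z. z ^ 4 \<partial>\<rho>)) \<le> ennreal (exp (- s / 2))"
  proof (rule ennreal_leI)
    have "s\<^sup>2 / 2 * (\<integral>z. z ^ 4 \<partial>\<rho>) \<le> s\<^sup>2 / 2 * (128 * exp c)"
      by (intro mult_left_mono subgauss_fourth_moment'[OF law]) auto
    also have "\<dots> = s / 2" by (simp add: s power2_eq_square exp_minus field_simps)
    finally show "1 - s * 1 + s\<^sup>2 / 2 * (\<integral>z. z ^ 4 \<partial>\<rho>) \<le> exp (- s / 2)"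
      using exp_ge_add_one_self[of "- s / 2"] by linarith
  qed
  finally show ?thesis .
qed

text \<open>
  A gaussian average linearises the square, \<open>exp (z\<^sup>2 / (8 * c)) = E exp (t * z * g)\<close> with
  \<open>t\<^sup>2 = 1 / (4 * c)\<close>, and then the averages are interchanged.
\<close>

lemma subgauss_exp_square:
  assumes law: "subgauss_law c \<rho>" and c: "c > 0"
  shows "(\<integral>\<^sup>+z. ennreal (exp (z\<^sup>2 / (8 * c))) \<partial>\<rho>) \<le> 2"
proof -
  interpret r: prob_space \<rho> by (rule subgauss_lawD[OF law])
  note [measurable_cong] = subgauss_lawD(2)[OF law]
  interpret g: prob_space gaussian by (rule prob_space_gaussian)
  interpret rg: pair_prob_space \<rho> gaussian by unfold_locales
  define t where "t = 1 / (2 * sqrt c)"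
  have t: "t\<^sup>2 = 1 / (4 * c)" using c by (simp add: t_def power_divide power_mult_distrib)
  have "(\<integral>\<^sup>+z. ennreal (exp (z\<^sup>2 / (8 * c))) \<partial>\<rho>) = (\<integral>\<^sup>+z. \<integral>\<^sup>+g. ennreal (exp ((t * z) * g)) \<partial>gaussian \<partial>\<rho>)"
    by (intro nn_integral_cong) (simp only: gaussian_mgf, simp add: power_mult_distrib t)
  also have "\<dots> = (\<integral>\<^sup>+g. \<integral>\<^sup>+z. ennreal (exp ((t * z) * g)) \<partial>\<rho> \<partial>gaussian)"
    by (rule rg.Fubini'[symmetric]) measurable
  also have "\<dots> \<le> (\<integral>\<^sup>+g. ennreal (exp (g\<^sup>2 / 4)) \<partial>gaussian)"
  proof (rule nn_integral_mono)
    fix g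
    show "(\<integral>\<^sup>+z. ennreal (exp ((t * z) * g)) \<partial>\<rho>) \<le> ennreal (exp (g\<^sup>2 / 4))"
      using subgauss_lawD(3)[OF law, of "t * g"] c by (simp add: power_mult_distrib t ac_simps)
  qed
  also have "\<dots> \<le> 2" by (rule gaussian_exp_square)
  finally show ?thesis .
qed

definition lin_law :: "real measure \<Rightarrow> 'i set \<Rightarrow> ('i \<Rightarrow> real) \<Rightarrow> real measure" where
  "lin_law \<rho> I a = distr (iid I \<rho>) borel (\<lambda>x. \<Sum>i\<in>I. a i * x i)"

lemma sets_lin_law[simp, measurable_cong]: "sets (lin_law \<rho> I a) = sets borel"
  by (simp add: lin_law_def)

lemma prob_space_lin_law:
  assumes "prob_space \<rho>" and [measurable_cong]: "sets \<rho> = sets borel"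
  shows "prob_space (lin_law \<rho> I a)"
proof -
  interpret prob_space "iid I \<rho>" by (rule prob_space_PiM) (rule assms)
  show ?thesis unfolding lin_law_def by (rule prob_space_distr) measurable
qed

lemma nn_integral_lin_law:
  assumes [measurable_cong]: "sets \<rho> = sets borel" and [measurable]: "f \<in> borel_measurable borel"
  shows "(\<integral>\<^sup>+z. f z \<partial>lin_law \<rho> I a) = (\<integral>\<^sup>+x. f (\<Sum>i\<in>I. a i * x i) \<partial>iid I \<rho>)"
  unfolding lin_law_def by (rule nn_integral_distr) measurable

lemma subgauss_lin_law:
  assumes I: "finite I" and law: "subgauss_law c \<rho>"
  shows "subgauss_law (c * (\<Sum>i\<in>I. (a i)\<^sup>2)) (lin_law \<rho> I a)"
proof -
  note [measurable_cong] = subgauss_lawD(2)[OF law]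
  have "(\<integral>\<^sup>+z. ennreal (exp (s * z)) \<partial>lin_law \<rho> I a) \<le> ennreal (exp (c * (\<Sum>i\<in>I. (a i)\<^sup>2) * s\<^sup>2))" for s
  proof -
    have "(\<integral>\<^sup>+z. ennreal (exp (s * z)) \<partial>lin_law \<rho> I a) = (\<integral>\<^sup>+x. ennreal (exp (\<Sum>i\<in>I. (s * a i) * x i)) \<partial>iid I \<rho>)"
      by (subst nn_integral_lin_law) (auto simp: subgauss_lawD[OF law] sum_distrib_left ac_simps)
    also have "\<dots> \<le> ennreal (exp (c * (\<Sum>i\<in>I. (s * a i)\<^sup>2)))"
      by (rule nn_integral_exp_sum_PiM[OF I subgauss_lawD(1)[OF law], where \<phi>="\<lambda>_ z. z"])
         (auto intro: subgauss_lawD(3)[OF law])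
    also have "c * (\<Sum>i\<in>I. (s * a i)\<^sup>2) = c * (\<Sum>i\<in>I. (a i)\<^sup>2) * s\<^sup>2"
      by (simp add: power_mult_distrib sum_distrib_left sum_distrib_right ac_simps)
    finally show ?thesis .
  qed
  then show ?thesis using prob_space_lin_law[OF subgauss_lawD(1,2)[OF law]] by (auto simp: subgauss_law_def)
qed

lemma symmetric_lin_law:
  fixes I :: "'i set"
  assumes I: "finite I" and r: "prob_space \<rho>" and s[measurable_cong]: "sets \<rho> = sets borel" and sy: "symmetric_law \<rho>"
  shows "symmetric_law (lin_law \<rho> I a)"
  unfolding symmetric_law_def
proof -
  have "distr (lin_law \<rho> I a) borel uminus = distr (lin_law \<rho> I a) borel (\<lambda>x. x)"
  proof (rule distr_eqI_nn_integral)
    fix \<Phi> :: "real \<Rightarrow> ennreal" assume [measurable]: "\<Phi> \<in> borel_measurable borel"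
    have "(\<integral>\<^sup>+z. \<Phi> (- z) \<partial>lin_law \<rho> I a) = (\<integral>\<^sup>+x. \<Phi> (- (\<Sum>i\<in>I. a i * x i)) \<partial>iid I \<rho>)"
      by (rule nn_integral_lin_law) (auto simp: s)
    also have "\<dots> = (\<integral>\<^sup>+x. (\<lambda>x. \<Phi> (\<Sum>i\<in>I. a i * x i)) (\<lambda>i\<in>I. uminus (x i)) \<partial>iid I \<rho>)"
      by (intro nn_integral_cong) (simp add: sum_negf)
    also have "\<dots> = (\<integral>\<^sup>+x. \<Phi> (\<Sum>i\<in>I. a i * x i) \<partial>iid I (distr \<rho> borel uminus))"
      by (rule nn_integral_PiM_map[OF I r]) measurable
    also have "\<dots> = (\<integral>\<^sup>+z. \<Phi> z \<partial>lin_law \<rho> I a)"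
      using sy by (simp add: symmetric_law_def nn_integral_lin_law s)
    finally show "(\<integral>\<^sup>+z. \<Phi> (- z) \<partial>lin_law \<rho> I a) = (\<integral>\<^sup>+z. \<Phi> z \<partial>lin_law \<rho> I a)" .
  qed auto
  also have "\<dots> = lin_law \<rho> I a" by (rule distr_id2) simp
  finally show "distr (lin_law \<rho> I a) borel uminus = lin_law \<rho> I a" .
qed

lemma second_moment_lin_law:
  fixes I :: "'i set"
  assumes I: "finite I" and r: "prob_space \<rho>" and s[measurable_cong]: "sets \<rho> = sets borel"
    and z1: "(\<integral>z. z \<partial>\<rho>) = 0" and z2: "(\<integral>z. z\<^sup>2 \<partial>\<rho>) = 1"
  shows "(\<integral>z. z\<^sup>2 \<partial>lin_law \<rho> I a) = (\<Sum>i\<in>I. (a i)\<^sup>2)"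
proof -
  interpret r: prob_space \<rho> by fact
  interpret R: product_prob_space "\<lambda>_. \<rho>" I by unfold_locales
  note i = integrable_if_second_moment[OF r s z2]
  define e where "e i j k = (if k = i then 1 else 0) + (if k = j then 1 else 0 :: nat)" for i j k :: 'i
  have ik: "integrable \<rho> (\<lambda>z. z ^ e i j k)" for i j k
    using i by (auto simp: e_def numeral_2_eq_2[symmetric] power2_eq_square)
  have prod: "x i * x j = (\<Prod>k\<in>I. x k ^ e i j k)" if "i \<in> I" "j \<in> I" for x :: "'i \<Rightarrow> real" and i j
    using that I by (simp add: e_def power_add prod.distrib if_distrib[where f="\<lambda>n. _ ^ n"] cong: if_cong)
  have int: "integrable (iid I \<rho>) (\<lambda>x. x i * x j)" if "i \<in> I" "j \<in> I" for i j
    unfolding prod[OF that] by (rule R.product_integrable_prod[OF I ik])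
  have val: "(\<integral>x. x i * x j \<partial>iid I \<rho>) = (if i = j then 1 else 0)" if "i \<in> I" "j \<in> I" for i j
  proof -
    have "(\<integral>x. x i * x j \<partial>iid I \<rho>) = (\<Prod>k\<in>I. \<integral>z. z ^ e i j k \<partial>\<rho>)"
      unfolding prod[OF that] by (rule R.product_integral_prod[OF I ik])
    also have "\<dots> = (if i = j then 1 else 0)"
    proof (cases "i = j")
      case True
      have "(\<integral>z. z ^ e i j k \<partial>\<rho>) = 1" for k
        using True z2 by (simp add: e_def r.prob_space numeral_2_eq_2[symmetric])
      then show ?thesis using True by simp
    next
      case False
      then have "(\<integral>z. z ^ e i j i \<partial>\<rho>) = 0" using z1 by (simp add: e_def)
      then show ?thesis using False I that by (auto simp: prod_zero_iff)
    qed
    finally show ?thesis .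
  qed
  have "(\<integral>z. z\<^sup>2 \<partial>lin_law \<rho> I a) = (\<integral>x. (\<Sum>i\<in>I. a i * x i)\<^sup>2 \<partial>iid I \<rho>)"
    unfolding lin_law_def by (rule integral_distr) measurable
  also have "\<dots> = (\<integral>x. (\<Sum>i\<in>I. \<Sum>j\<in>I. (a i * a j) * (x i * x j)) \<partial>iid I \<rho>)"
    by (simp add: power2_eq_square sum_product ac_simps)
  also have "\<dots> = (\<Sum>i\<in>I. \<Sum>j\<in>I. (a i * a j) * (\<integral>x. x i * x j \<partial>iid I \<rho>))"
    using int by (subst Bochner_Integration.integral_sum)+ auto
  also have "\<dots> = (\<Sum>i\<in>I. \<Sum>j\<in>I. if i = j then a i * a j else 0)"
    by (intro sum.cong refl) (simp add: val)
  also have "\<dots> = (\<Sum>i\<in>I. (a i)\<^sup>2)" using I by (simp add: power2_eq_square)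
  finally show ?thesis .
qed

lemma measurable_component2:
  assumes "i \<in> I" "j \<in> J" and "sets M = sets N"
  shows "(\<lambda>X. X i j) \<in> measurable (iid I (iid J M)) N"
proof -
  have "(\<lambda>x. x j) \<in> measurable (iid J M) N"
    using measurable_component_singleton[OF assms(2), of "\<lambda>_. M"] assms(3) by (simp cong: measurable_cong_sets)
  from measurable_compose[OF measurable_component_singleton[OF assms(1)] this] show ?thesis .
qed

text \<open>
  The coordinates of \<open>\<Sum>i\<in>I. a i * X i\<close> are independent with common law \<open>lin_law \<rho> I a\<close>, so
  estimates for one vector with independent coordinates apply to all linear combinations.
\<close>

lemma nn_integral_lin_comb:
  fixes I :: "'i set" and J :: "'j set"
  assumes I: "finite I" and J: "finite J" and r: "prob_space \<rho>" and s[measurable_cong]: "sets \<rho> = sets borel"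
  shows "\<Phi> \<in> borel_measurable (Pi\<^sub>M J (\<lambda>_. borel)) \<Longrightarrow>
     (\<integral>\<^sup>+X. \<Phi> (\<lambda>j\<in>J. \<Sum>i\<in>I. a i * X i j) \<partial>iid I (iid J \<rho>))
     = (\<integral>\<^sup>+z. \<Phi> z \<partial>iid J (lin_law \<rho> I a))"
  using I
proof (induction I arbitrary: \<Phi> rule: finite_induct)
  case empty
  note [measurable] = empty(1)
  interpret E: prob_space "Pi\<^sub>M {} (\<lambda>_::'i. \<rho>)" by (rule prob_space_PiM) (rule r)
  have "(\<integral>\<^sup>+z. \<Phi> z \<partial>iid J (lin_law \<rho> {} a)) = (\<integral>\<^sup>+x. \<Phi> (\<lambda>j\<in>J. 0) \<partial>iid J (Pi\<^sub>M {} (\<lambda>_::'i. \<rho>)))"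
    unfolding lin_law_def sum.empty
    by (rule nn_integral_PiM_map[OF J E.prob_space_axioms, symmetric, where f="\<lambda>_. 0"]) measurable
  also have "\<dots> = \<Phi> (\<lambda>j\<in>J. 0)"
    by (simp add: prob_space.emeasure_space_1[OF prob_space_PiM[OF E.prob_space_axioms]])
  finally show ?case
    by (simp add: prob_space.emeasure_space_1[OF prob_space_PiM[OF prob_space_PiM[OF r]]] restrict_def)
next
  case (insert i I)
  note [measurable] = insert(4)
  interpret r: prob_space \<rho> by fact
  interpret PJ: prob_space "iid J \<rho>" by (rule prob_space_PiM) (rule r)
  interpret P: product_prob_space "\<lambda>_::'i. (iid J \<rho>)" "insert i I" by unfold_locales
  interpret R: product_prob_space "\<lambda>_::'i. \<rho>" "insert i I" by unfold_locales
  interpret Li: prob_space "lin_law \<rho> I a" by (rule prob_space_lin_law[OF r s])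
  interpret rl: pair_prob_space \<rho> "lin_law \<rho> I a" by unfold_locales
  have upd: "(\<Sum>i'\<in>I. a i' * (if i' = i then y else X i')) = (\<Sum>i'\<in>I. a i' * X i')" for y :: real and X
    using insert(2) by (intro sum.cong) auto
  have law: "distr (\<rho> \<Otimes>\<^sub>M lin_law \<rho> I a) borel (\<lambda>(y, s). a i * y + s) = lin_law \<rho> (insert i I) a"
    unfolding lin_law_def[of _ "insert i I"]
  proof (rule distr_eqI_nn_integral)
    fix f :: "real \<Rightarrow> ennreal" assume [measurable]: "f \<in> borel_measurable borel"
    have "(\<integral>\<^sup>+p. f (case p of (y, s) \<Rightarrow> a i * y + s) \<partial>(\<rho> \<Otimes>\<^sub>M lin_law \<rho> I a))
        = (\<integral>\<^sup>+y. \<integral>\<^sup>+s. f (a i * y + s) \<partial>lin_law \<rho> I a \<partial>\<rho>)"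
      by (subst Li.nn_integral_fst[symmetric]) auto
    also have "\<dots> = (\<integral>\<^sup>+y. \<integral>\<^sup>+x. f (a i * y + (\<Sum>i\<in>I. a i * x i)) \<partial>iid I \<rho> \<partial>\<rho>)"
      by (intro nn_integral_cong nn_integral_lin_law) (auto simp: s)
    also have "\<dots> = (\<integral>\<^sup>+x. f (\<Sum>i\<in>insert i I. a i * x i) \<partial>iid (insert i I) \<rho>)"
      by (subst R.product_nn_integral_insert_rev[OF insert(1,2)]) (use insert(1,2) in \<open>auto simp: upd\<close>)
    finally show "(\<integral>\<^sup>+p. f (case p of (y, s) \<Rightarrow> a i * y + s) \<partial>(\<rho> \<Otimes>\<^sub>M lin_law \<rho> I a))
       = (\<integral>\<^sup>+x. f (\<Sum>i\<in>insert i I. a i * x i) \<partial>iid (insert i I) \<rho>)" .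
  qed measurable
  have "(\<integral>\<^sup>+X. \<Phi> (\<lambda>j\<in>J. \<Sum>i\<in>insert i I. a i * X i j) \<partial>iid (insert i I) (iid J \<rho>))
     = (\<integral>\<^sup>+Y. \<integral>\<^sup>+X. \<Phi> (\<lambda>j\<in>J. \<Sum>i'\<in>insert i I. a i' * (X(i := Y)) i' j) \<partial>iid I (iid J \<rho>) \<partial>iid J \<rho>)"
    by (rule P.product_nn_integral_insert_rev[OF insert(1,2)])
       (auto intro!: measurable_compose[OF measurable_restrict insert(4)] borel_measurable_sum borel_measurable_times measurable_component2 simp: s)
  also have "\<dots> = (\<integral>\<^sup>+Y. \<integral>\<^sup>+X. (\<lambda>z. \<Phi> (\<lambda>j\<in>J. a i * Y j + z j)) (\<lambda>j\<in>J. \<Sum>i'\<in>I. a i' * X i' j) \<partial>iid I (iid J \<rho>) \<partial>iid J \<rho>)"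
  proof (intro nn_integral_cong arg_cong[where f=\<Phi>] restrict_ext)
    fix Y X j assume "j \<in> J"
    have "(\<Sum>i'\<in>I. a i' * (X(i := Y)) i' j) = (\<Sum>i'\<in>I. a i' * X i' j)"
      using insert(2) by (intro sum.cong) auto
    then show "(\<Sum>i'\<in>insert i I. a i' * (X(i := Y)) i' j) = a i * Y j + (\<lambda>j\<in>J. \<Sum>i'\<in>I. a i' * X i' j) j"
      using insert(1,2) \<open>j \<in> J\<close> by simp
  qed
  also have "\<dots> = (\<integral>\<^sup>+Y. \<integral>\<^sup>+z. \<Phi> (\<lambda>j\<in>J. a i * Y j + z j) \<partial>iid J (lin_law \<rho> I a) \<partial>iid J \<rho>)"
    by (intro nn_integral_cong insert.IH) measurable
  also have "\<dots> = (\<integral>\<^sup>+Y. \<integral>\<^sup>+z. \<Phi> (\<lambda>j\<in>J. (\<lambda>(y, s). a i * y + s) (Y j, z j)) \<partial>iid J (lin_law \<rho> I a) \<partial>iid J \<rho>)"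
    by simp
  also have "\<dots> = (\<integral>\<^sup>+z. \<Phi> z \<partial>iid J (distr (\<rho> \<Otimes>\<^sub>M lin_law \<rho> I a) borel (\<lambda>(y, s). a i * y + s)))"
    by (rule nn_integral_PiM_zip[OF J r Li.prob_space_axioms]) measurable
  finally show ?case unfolding law .
qed

section \<open>Domination in the convex order\<close>

text \<open>
  Values in \<open>ennreal\<close> allow integrating out coordinates without integrability conditions.
\<close>

definition convex_fun :: "(real \<Rightarrow> ennreal) \<Rightarrow> bool" where
  "convex_fun \<phi> \<longleftrightarrow> (\<forall>x y u v. 0 \<le> u \<longrightarrow> 0 \<le> v \<longrightarrow> u + v = 1 \<longrightarrow>
     \<phi> (u * x + v * y) \<le> ennreal u * \<phi> x + ennreal v * \<phi> y)"

definition convex_vec_fun :: "((nat \<Rightarrow> real) \<Rightarrow> ennreal) \<Rightarrow> bool" where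
  "convex_vec_fun \<Phi> \<longleftrightarrow> (\<forall>x y u v. 0 \<le> u \<longrightarrow> 0 \<le> v \<longrightarrow> u + v = 1 \<longrightarrow>
     \<Phi> (\<lambda>j. u * x j + v * y j) \<le> ennreal u * \<Phi> x + ennreal v * \<Phi> y)"

definition convex_le :: "real measure \<Rightarrow> real measure \<Rightarrow> bool" where
  "convex_le \<alpha> \<beta> \<longleftrightarrow> (\<forall>\<phi>\<in>borel_measurable borel. convex_fun \<phi> \<longrightarrow> (\<integral>\<^sup>+z. \<phi> z \<partial>\<alpha>) \<le> (\<integral>\<^sup>+z. \<phi> z \<partial>\<beta>))"

text \<open>
  The coordinates are replaced one at a time: integrating out the others keeps convexity.
\<close>

lemma convex_le_PiM:
  assumes J: "finite J" and a: "prob_space \<alpha>" and sa[measurable_cong]: "sets \<alpha> = sets borel"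
    and b: "prob_space \<beta>" and sb[measurable_cong]: "sets \<beta> = sets borel" and le: "convex_le \<alpha> \<beta>"
  shows "\<Phi> \<in> borel_measurable (Pi\<^sub>M J (\<lambda>_. borel)) \<Longrightarrow> convex_vec_fun \<Phi> \<Longrightarrow> (\<And>x. \<Phi> (restrict x J) = \<Phi> x) \<Longrightarrow>
    (\<integral>\<^sup>+x. \<Phi> x \<partial>iid J \<alpha>) \<le> (\<integral>\<^sup>+x. \<Phi> x \<partial>iid J \<beta>)"
  using J
proof (induction J arbitrary: \<Phi> rule: finite_induct)
  case (insert i J)
  note [measurable] = insert(4)
  interpret a: prob_space \<alpha> by fact
  interpret b: prob_space \<beta> by fact
  interpret A: product_prob_space "\<lambda>_. \<alpha>" "insert i J" by unfold_locales
  interpret B: product_prob_space "\<lambda>_. \<beta>" "insert i J" by unfold_locales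
  have cv: "\<Phi> (\<lambda>j. u * x j + v * y j) \<le> ennreal u * \<Phi> x + ennreal v * \<Phi> y"
    if "0 \<le> u" "0 \<le> v" "u + v = 1" for u v x y using insert(5) that by (auto simp: convex_vec_fun_def)
  have dep: "\<Phi> ((restrict x J)(i := y)) = \<Phi> (x(i := y))" for x y
  proof -
    have "restrict (x(i := y)) (insert i J) = restrict ((restrict x J)(i := y)) (insert i J)" by auto
    then show ?thesis using insert(6) by metis
  qed
  have m2: "(\<lambda>p. \<Phi> ((fst p)(i := snd p))) \<in> borel_measurable (Pi\<^sub>M J (\<lambda>_. borel) \<Otimes>\<^sub>M borel)"
    using measurable_compose[OF measurable_add_dim insert(4)] by (simp add: case_prod_beta)
  have "(\<integral>\<^sup>+x. \<Phi> x \<partial>iid (insert i J) \<alpha>) = (\<integral>\<^sup>+x. \<integral>\<^sup>+y. \<Phi> (x(i := y)) \<partial>\<alpha> \<partial>iid J \<alpha>)"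
    by (rule A.product_nn_integral_insert[OF insert(1,2)]) measurable
  also have "\<dots> \<le> (\<integral>\<^sup>+x. \<integral>\<^sup>+y. \<Phi> (x(i := y)) \<partial>\<beta> \<partial>iid J \<alpha>)"
  proof (rule nn_integral_mono)
    fix x assume "x \<in> space (iid J \<alpha>)"
    then have x: "x \<in> space (Pi\<^sub>M J (\<lambda>_. borel))" by (simp add: space_PiM sets_eq_imp_space_eq[OF sa])
    have "(\<lambda>y. \<Phi> (x(i := y))) \<in> borel_measurable borel"
      using measurable_compose[OF measurable_Pair1' m2, OF x] by simp
    moreover have "convex_fun (\<lambda>y. \<Phi> (x(i := y)))"
      unfolding convex_fun_def
    proof (intro allI impI)
      fix y y' u v :: real assume uv: "0 \<le> u" "0 \<le> v" "u + v = 1"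
      have "x(i := u * y + v * y') = (\<lambda>j. u * (x(i := y)) j + v * (x(i := y')) j)"
        using uv by (auto simp: distrib_right[symmetric])
      then show "\<Phi> (x(i := u * y + v * y')) \<le> ennreal u * \<Phi> (x(i := y)) + ennreal v * \<Phi> (x(i := y'))"
        using cv[OF uv] by metis
    qed
    ultimately show "(\<integral>\<^sup>+y. \<Phi> (x(i := y)) \<partial>\<alpha>) \<le> (\<integral>\<^sup>+y. \<Phi> (x(i := y)) \<partial>\<beta>)"
      using le by (auto simp: convex_le_def)
  qed
  also have "\<dots> \<le> (\<integral>\<^sup>+x. \<integral>\<^sup>+y. \<Phi> (x(i := y)) \<partial>\<beta> \<partial>iid J \<beta>)"
  proof (rule insert.IH)
    show "(\<lambda>x. \<integral>\<^sup>+y. \<Phi> (x(i := y)) \<partial>\<beta>) \<in> borel_measurable (Pi\<^sub>M J (\<lambda>_. borel))"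
      using b.borel_measurable_nn_integral_fst[of "\<lambda>p. \<Phi> ((fst p)(i := snd p))" "Pi\<^sub>M J (\<lambda>_. borel)"] m2
      by simp
    show "convex_vec_fun (\<lambda>x. \<integral>\<^sup>+y. \<Phi> (x(i := y)) \<partial>\<beta>)"
      unfolding convex_vec_fun_def
    proof (intro allI impI)
      fix x x' :: "nat \<Rightarrow> real" and u v :: real assume uv: "0 \<le> u" "0 \<le> v" "u + v = 1"
      have e: "(\<lambda>j. u * x j + v * x' j)(i := y) = (\<lambda>j. u * (x(i := y)) j + v * (x'(i := y)) j)" for y
        using uv by (auto simp: distrib_right[symmetric])
      have my[measurable]: "(\<lambda>y. \<Phi> (z(i := y))) \<in> borel_measurable borel" for z :: "nat \<Rightarrow> real"
      proof -
        have "(\<lambda>y. \<Phi> ((restrict z J)(i := y))) \<in> borel_measurable borel"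
          using measurable_compose[OF measurable_Pair1' m2, of "restrict z J"] by (simp add: space_PiM)
        then show ?thesis by (simp only: dep)
      qed
      show "(\<integral>\<^sup>+y. \<Phi> ((\<lambda>j. u * x j + v * x' j)(i := y)) \<partial>\<beta>)
        \<le> ennreal u * (\<integral>\<^sup>+y. \<Phi> (x(i := y)) \<partial>\<beta>) + ennreal v * (\<integral>\<^sup>+y. \<Phi> (x'(i := y)) \<partial>\<beta>)"
        unfolding e
        by (subst (1 2) nn_integral_cmult[symmetric], measurable, subst nn_integral_add[symmetric], measurable)
           (intro nn_integral_mono cv uv)
    qed
    show "(\<integral>\<^sup>+y. \<Phi> ((restrict x J)(i := y)) \<partial>\<beta>) = (\<integral>\<^sup>+y. \<Phi> (x(i := y)) \<partial>\<beta>)" for x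
      by (simp only: dep)
  qed
  also have "\<dots> = (\<integral>\<^sup>+x. \<Phi> x \<partial>iid (insert i J) \<beta>)"
    by (rule B.product_nn_integral_insert[OF insert(1,2), symmetric]) measurable
  finally show ?case .
qed (simp add: PiM_empty)

lemma nn_integral_layer: "(\<integral>\<^sup>+t. indicator {t. 0 \<le> t \<and> ennreal t < a} t \<partial>lborel) = a"
proof (cases a)
  case (real r)
  then have "{t. 0 \<le> t \<and> ennreal t < a} = {0..<r}" by (auto simp: ennreal_less_iff)
  then show ?thesis using real by simp
next
  case top
  then have e: "{t. 0 \<le> t \<and> ennreal t < a} = {0..}" by auto
  have "emeasure lborel {0::real..} = \<infinity>"
  proof (cases "emeasure lborel {0::real..}")
    case (real r)
    obtain n where n: "r < real n" using reals_Archimedean2 by blast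
    have "ennreal (real n) = emeasure lborel {0..real n}" by simp
    also have "\<dots> \<le> emeasure lborel {0::real..}" by (rule emeasure_mono) auto
    finally show ?thesis using n real by simp
  qed simp
  moreover have "(\<integral>\<^sup>+t. indicator {t. 0 \<le> t \<and> ennreal t < a} t \<partial>lborel) = emeasure lborel {0::real..}"
    unfolding e by (rule nn_integral_indicator) simp
  ultimately show ?thesis using top by simp
qed

text \<open>
  By the layer cake formula; the superlevel sets of \<open>\<psi>\<close> on the half line are up-sets, hence lie between an
  open and a closed half line.
\<close>

lemma stochastic_dominance:
  fixes X :: "'a \<Rightarrow> real" and Y :: "'b \<Rightarrow> real" and \<psi> :: "real \<Rightarrow> ennreal"
  assumes M: "prob_space M" and N: "prob_space N"
    and X[measurable]: "X \<in> borel_measurable M" and Y[measurable]: "Y \<in> borel_measurable N"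
    and X0: "\<And>x. 0 \<le> X x" and Y0: "\<And>y. 0 \<le> Y y"
    and tail: "\<And>s. 0 \<le> s \<Longrightarrow> emeasure M {x\<in>space M. s \<le> X x} \<le> emeasure N {y\<in>space N. s < Y y}"
    and psi[measurable]: "\<psi> \<in> borel_measurable borel"
    and incr: "\<And>r s. 0 \<le> r \<Longrightarrow> r \<le> s \<Longrightarrow> \<psi> r \<le> \<psi> s"
  shows "(\<integral>\<^sup>+x. \<psi> (X x) \<partial>M) \<le> (\<integral>\<^sup>+y. \<psi> (Y y) \<partial>N)"
proof -
  interpret M: prob_space M by fact
  interpret N: prob_space N by fact
  interpret pM: pair_sigma_finite M "lborel :: real measure" ..
  interpret pN: pair_sigma_finite N "lborel :: real measure" ..
  have "(\<integral>\<^sup>+x. \<psi> (X x) \<partial>M) = (\<integral>\<^sup>+x. \<integral>\<^sup>+t. indicator {t. 0 \<le> t \<and> ennreal t < \<psi> (X x)} t \<partial>lborel \<partial>M)"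
    by (simp only: nn_integral_layer)
  also have "\<dots> = (\<integral>\<^sup>+t. \<integral>\<^sup>+x. indicator {t. 0 \<le> t \<and> ennreal t < \<psi> (X x)} t \<partial>M \<partial>lborel)"
    by (rule pM.Fubini'[symmetric]) (simp add: indicator_def, measurable)
  also have "\<dots> \<le> (\<integral>\<^sup>+t. \<integral>\<^sup>+y. indicator {t. 0 \<le> t \<and> ennreal t < \<psi> (Y y)} t \<partial>N \<partial>lborel)"
  proof (rule nn_integral_mono)
    fix t :: real
    show "(\<integral>\<^sup>+x. indicator {t. 0 \<le> t \<and> ennreal t < \<psi> (X x)} t \<partial>M) \<le> (\<integral>\<^sup>+y. indicator {t. 0 \<le> t \<and> ennreal t < \<psi> (Y y)} t \<partial>N)"
    proof (cases "0 \<le> t")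
      case True
      define U where "U = {r. 0 \<le> r \<and> ennreal t < \<psi> r}"
      have eX: "(\<integral>\<^sup>+x. indicator {t. 0 \<le> t \<and> ennreal t < \<psi> (X x)} t \<partial>M) = emeasure M {x\<in>space M. X x \<in> U}"
      proof -
        have "(\<integral>\<^sup>+x. indicator {t. 0 \<le> t \<and> ennreal t < \<psi> (X x)} t \<partial>M) = (\<integral>\<^sup>+x. indicator {x\<in>space M. X x \<in> U} x \<partial>M)"
          using True X0 by (intro nn_integral_cong) (auto simp: U_def indicator_def)
        also have "\<dots> = emeasure M {x\<in>space M. X x \<in> U}"
          by (rule nn_integral_indicator) (use X0 in \<open>auto simp: U_def intro!: borel_measurable_less measurable_compose[OF _ psi]\<close>)
        finally show ?thesis .
      qed
      have eY: "(\<integral>\<^sup>+y. indicator {t. 0 \<le> t \<and> ennreal t < \<psi> (Y y)} t \<partial>N) = emeasure N {y\<in>space N. Y y \<in> U}"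
      proof -
        have "(\<integral>\<^sup>+y. indicator {t. 0 \<le> t \<and> ennreal t < \<psi> (Y y)} t \<partial>N) = (\<integral>\<^sup>+y. indicator {y\<in>space N. Y y \<in> U} y \<partial>N)"
          using True Y0 by (intro nn_integral_cong) (auto simp: U_def indicator_def)
        also have "\<dots> = emeasure N {y\<in>space N. Y y \<in> U}"
          by (rule nn_integral_indicator) (use Y0 in \<open>auto simp: U_def intro!: borel_measurable_less measurable_compose[OF _ psi]\<close>)
        finally show ?thesis .
      qed
      show ?thesis
      proof (cases "U = {}")
        case False
        have bb: "bdd_below U" by (rule bdd_belowI[of _ 0]) (auto simp: U_def)
        have i0: "0 \<le> Inf U" using False by (intro cInf_greatest) (auto simp: U_def)
        have "emeasure M {x\<in>space M. X x \<in> U} \<le> emeasure M {x\<in>space M. Inf U \<le> X x}"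
          by (intro emeasure_mono) (auto intro: cInf_lower bb)
        also have "\<dots> \<le> emeasure N {y\<in>space N. Inf U < Y y}" by (rule tail[OF i0])
        also have "\<dots> \<le> emeasure N {y\<in>space N. Y y \<in> U}"
        proof (intro emeasure_mono subsetI)
          fix y assume "y \<in> {y\<in>space N. Inf U < Y y}"
          then obtain u where "u \<in> U" "u < Y y" "y \<in> space N" using False bb by (auto simp: cInf_less_iff)
          then show "y \<in> {y\<in>space N. Y y \<in> U}" using incr[of u "Y y"] by (auto simp: U_def intro: less_le_trans)
        qed (simp add: U_def)
        finally show ?thesis unfolding eX eY .
      qed (simp add: eX eY)
    qed simp
  qed
  also have "\<dots> = (\<integral>\<^sup>+y. \<integral>\<^sup>+t. indicator {t. 0 \<le> t \<and> ennreal t < \<psi> (Y y)} t \<partial>lborel \<partial>N)"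
    by (rule pN.Fubini') (simp add: indicator_def, measurable)
  also have "\<dots> = (\<integral>\<^sup>+y. \<psi> (Y y) \<partial>N)" by (simp only: nn_integral_layer)
  finally show ?thesis .
qed

lemma symmetric_gaussian: "symmetric_law gaussian"
  unfolding symmetric_law_def
proof -
  have "distr gaussian borel uminus = distr gaussian borel (\<lambda>x. x)"
  proof (rule distr_eqI_nn_integral)
    fix \<Phi> :: "real \<Rightarrow> ennreal" assume [measurable]: "\<Phi> \<in> borel_measurable borel"
    have "(\<integral>\<^sup>+x. \<Phi> x \<partial>gaussian) = (\<integral>\<^sup>+x. ennreal (std_normal_density x) * \<Phi> x \<partial>lborel)"
      by (rule nn_integral_density) auto
    also have "\<dots> = (\<integral>\<^sup>+x. ennreal (std_normal_density x) * \<Phi> (- x) \<partial>lborel)"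
      by (subst nn_integral_real_affine[where c="-1" and t=0]) (auto simp: normal_density_def)
    also have "\<dots> = (\<integral>\<^sup>+x. \<Phi> (- x) \<partial>gaussian)"
      by (rule nn_integral_density[symmetric]) auto
    finally show "(\<integral>\<^sup>+x. \<Phi> (- x) \<partial>gaussian) = (\<integral>\<^sup>+x. \<Phi> x \<partial>gaussian)" ..
  qed auto
  also have "\<dots> = gaussian" by (rule distr_id2) simp
  finally show "distr gaussian borel uminus = gaussian" .
qed

lemma gaussian_tail_lower:
  assumes u: "u \<ge> 0"
  shows "ennreal (exp (- (u + 1)\<^sup>2 / 2) / 3) \<le> emeasure gaussian {g. u < \<bar>g\<bar>}"
proof -
  have pi: "sqrt (2 * pi) \<le> 3" using pi_less_4 by (intro real_le_lsqrt) auto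
  have "ennreal (exp (- (u + 1)\<^sup>2 / 2) / 3) = (\<integral>\<^sup>+x. ennreal (exp (- (u + 1)\<^sup>2 / 2) / 3) * indicator {u<..u+1} x \<partial>lborel)"
    by (simp add: nn_integral_cmult)
  also have "\<dots> \<le> (\<integral>\<^sup>+x. ennreal (std_normal_density x) * indicator {g. u < \<bar>g\<bar>} x \<partial>lborel)"
  proof (rule nn_integral_mono)
    fix x :: real
    show "ennreal (exp (- (u + 1)\<^sup>2 / 2) / 3) * indicator {u<..u+1} x \<le> ennreal (std_normal_density x) * indicator {g. u < \<bar>g\<bar>} x"
    proof (cases "x \<in> {u<..u+1}")
      case True
      then have "x\<^sup>2 \<le> (u + 1)\<^sup>2" using u by (intro power_mono) auto
      then have "exp (- (u + 1)\<^sup>2 / 2) / 3 \<le> exp (- x\<^sup>2 / 2) / sqrt (2 * pi)"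
        using pi by (intro frac_le) auto
      then show ?thesis using True u by (auto simp: normal_density_def intro!: ennreal_leI)
    qed simp
  qed
  also have "\<dots> = emeasure gaussian {g. u < \<bar>g\<bar>}" by (rule emeasure_density[symmetric]) auto
  finally show ?thesis .
qed

lemma gaussian_small_ball: "measure gaussian {g. \<bar>g\<bar> < 1/2} \<le> 1/2"
proof -
  have pi: "2 \<le> sqrt (2 * pi)" using pi_ge_two by (intro real_le_rsqrt) auto
  interpret prob_space gaussian by (rule prob_space_gaussian)
  have "emeasure gaussian {g. \<bar>g\<bar> < 1/2} = (\<integral>\<^sup>+x. ennreal (std_normal_density x) * indicator {g. \<bar>g\<bar> < 1/2} x \<partial>lborel)"
    by (rule emeasure_density) auto
  also have "\<dots> \<le> (\<integral>\<^sup>+x. ennreal (1/2) * indicator {-1/2<..<1/2::real} x \<partial>lborel)"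
  proof (rule nn_integral_mono)
    fix x :: real
    have "exp (- x\<^sup>2 / 2) / sqrt (2 * pi) \<le> 1 / 2" using pi by (intro frac_le) auto
    then have "ennreal (std_normal_density x) \<le> ennreal (1/2)" by (intro ennreal_leI) (simp add: normal_density_def)
    moreover have "{g::real. \<bar>g\<bar> < 1/2} = {-1/2<..<1/2}" by auto
    ultimately show "ennreal (std_normal_density x) * indicator {g. \<bar>g\<bar> < 1/2} x \<le> ennreal (1/2) * indicator {-1/2<..<1/2::real} x"
      by (simp only:) (rule mult_right_mono, auto)
  qed
  also have "\<dots> = ennreal (1/2)" by (subst nn_integral_cmult_indicator) auto
  finally have "ennreal (measure gaussian {g. \<bar>g\<bar> < 1/2}) \<le> ennreal (1/2)" by (simp only: emeasure_eq_measure)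
  then show ?thesis by (subst (asm) ennreal_le_iff) auto
qed

lemma subgauss_tail:
  assumes law: "subgauss_law c \<rho>" and c: "c > 0" and s: "s \<ge> 0"
  shows "emeasure \<rho> {z\<in>space \<rho>. s \<le> \<bar>z\<bar>} \<le> ennreal (2 * exp (- s\<^sup>2 / (4 * c)))"
proof -
  note [measurable_cong] = subgauss_lawD(2)[OF law]
  define \<theta> where "\<theta> = s / (2 * c)"
  have th: "\<theta> \<ge> 0" using c s by (simp add: \<theta>_def)
  have "emeasure \<rho> {z\<in>space \<rho>. s \<le> \<bar>z\<bar>} = (\<integral>\<^sup>+z. indicator {z\<in>space \<rho>. s \<le> \<bar>z\<bar>} z \<partial>\<rho>)" by simp
  also have "\<dots> \<le> (\<integral>\<^sup>+z. ennreal (exp (- \<theta> * s)) * (ennreal (exp (\<theta> * z)) + ennreal (exp (- \<theta> * z))) \<partial>\<rho>)"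
  proof (rule nn_integral_mono)
    fix z
    have "1 \<le> exp (- \<theta> * s) * (exp (\<theta> * z) + exp (- \<theta> * z))" if z: "s \<le> \<bar>z\<bar>"
    proof -
      have "1 \<le> exp (\<theta> * (\<bar>z\<bar> - s))" using th z by simp
      also have "\<dots> = exp (- \<theta> * s) * exp (\<theta> * \<bar>z\<bar>)" by (simp add: exp_add[symmetric] algebra_simps)
      also have "\<dots> \<le> exp (- \<theta> * s) * (exp (\<theta> * z) + exp (- \<theta> * z))"
        by (intro mult_left_mono) (auto simp: abs_if)
      finally show ?thesis .
    qed
    then have "(if s \<le> \<bar>z\<bar> then 1 else 0) \<le> exp (- \<theta> * s) * (exp (\<theta> * z) + exp (- \<theta> * z))" by auto
    then have "ennreal (if s \<le> \<bar>z\<bar> then 1 else 0) \<le> ennreal (exp (- \<theta> * s) * (exp (\<theta> * z) + exp (- \<theta> * z)))"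
      by (rule ennreal_leI)
    also have "\<dots> = ennreal (exp (- \<theta> * s)) * (ennreal (exp (\<theta> * z)) + ennreal (exp (- \<theta> * z)))"
      by (subst ennreal_plus[symmetric], simp, simp, subst ennreal_mult[symmetric]) auto
    finally show "indicator {z\<in>space \<rho>. s \<le> \<bar>z\<bar>} z \<le> ennreal (exp (- \<theta> * s)) * (ennreal (exp (\<theta> * z)) + ennreal (exp (- \<theta> * z)))"
      by (auto simp: indicator_def split: if_splits)
  qed
  also have "\<dots> = ennreal (exp (- \<theta> * s)) * ((\<integral>\<^sup>+z. ennreal (exp (\<theta> * z)) \<partial>\<rho>) + (\<integral>\<^sup>+z. ennreal (exp (- \<theta> * z)) \<partial>\<rho>))"
    by (subst nn_integral_cmult) (auto simp: nn_integral_add)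
  also have "\<dots> \<le> ennreal (exp (- \<theta> * s)) * (ennreal (exp (c * \<theta>\<^sup>2)) + ennreal (exp (c * (- \<theta>)\<^sup>2)))"
    by (intro mult_left_mono add_mono subgauss_lawD[OF law]) auto
  also have "\<dots> = ennreal (2 * exp (- \<theta> * s + c * \<theta>\<^sup>2))"
    by (subst ennreal_plus[symmetric], simp, simp, subst ennreal_mult[symmetric]) (auto simp: exp_add[symmetric] algebra_simps)
  also have "- \<theta> * s + c * \<theta>\<^sup>2 = - s\<^sup>2 / (4 * c)"
    using c by (simp add: \<theta>_def power2_eq_square field_simps)
  finally show ?thesis .
qed

lemma subgauss_tail_le_gaussian:
  assumes law: "subgauss_law c \<rho>" and c: "c > 0" and s: "s \<ge> 0" and K: "K > 0" "K\<^sup>2 = 10 * c"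
  shows "emeasure \<rho> {z\<in>space \<rho>. s \<le> \<bar>z\<bar>} \<le> emeasure gaussian {g\<in>space gaussian. s < K + K * \<bar>g\<bar>}"
proof (cases "s < K")
  case True
  interpret r: prob_space \<rho> by (rule subgauss_lawD[OF law])
  interpret g: prob_space gaussian by (rule prob_space_gaussian)
  have "s < K + K * \<bar>g\<bar>" for g :: real using True K mult_nonneg_nonneg[of K "\<bar>g\<bar>"] by linarith
  then have "{g\<in>space gaussian. s < K + K * \<bar>g\<bar>} = space gaussian" by auto
  then have "emeasure gaussian {g\<in>space gaussian. s < K + K * \<bar>g\<bar>} = 1" using g.emeasure_space_1 by simp
  then show ?thesis using r.measure_le_1 by simp
next
  case False
  define u where "u = s / K - 1"
  have u: "u \<ge> 0" using False K by (simp add: u_def)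
  have e2: "6 \<le> exp (2 :: real)"
  proof -
    have "(5/2)\<^sup>2 \<le> (exp (1::real))\<^sup>2" using exp_lower_Taylor_quadratic[of 1] by (intro power_mono) auto
    also have "\<dots> = exp 2" by (simp add: exp_double[symmetric])
    finally show ?thesis by (simp add: power2_eq_square)
  qed
  have "emeasure \<rho> {z\<in>space \<rho>. s \<le> \<bar>z\<bar>} \<le> ennreal (2 * exp (- s\<^sup>2 / (4 * c)))" by (rule subgauss_tail[OF law c s])
  also have "\<dots> \<le> ennreal (exp (- (u + 1)\<^sup>2 / 2) / 3)"
  proof (rule ennreal_leI)
    have "K\<^sup>2 \<le> s\<^sup>2" using False K by (intro power_mono) auto
    then have sK: "10 * c \<le> s\<^sup>2" using K by simp
    have "(u + 1)\<^sup>2 / 2 = s\<^sup>2 / (20 * c)" using K by (simp add: u_def power_divide)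
    moreover have "s\<^sup>2 / (4 * c) = s\<^sup>2 / (20 * c) + s\<^sup>2 / (5 * c)" using c by (simp add: field_simps)
    ultimately have e: "exp (- (u + 1)\<^sup>2 / 2) = exp (- s\<^sup>2 / (4 * c)) * exp (s\<^sup>2 / (5 * c))"
      by (simp add: exp_add[symmetric])
    have "2 \<le> s\<^sup>2 / (5 * c)" using sK c by (simp add: field_simps)
    then have "exp 2 \<le> exp (s\<^sup>2 / (5 * c))" by simp
    with e2 have "6 \<le> exp (s\<^sup>2 / (5 * c))" by linarith
    then have "exp (- s\<^sup>2 / (4 * c)) * 6 \<le> exp (- (u + 1)\<^sup>2 / 2)" unfolding e by (intro mult_left_mono) auto
    then show "2 * exp (- s\<^sup>2 / (4 * c)) \<le> exp (- (u + 1)\<^sup>2 / 2) / 3" by simp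
  qed
  also have "\<dots> \<le> emeasure gaussian {g. u < \<bar>g\<bar>}" by (rule gaussian_tail_lower[OF u])
  also have "{g. u < \<bar>g\<bar>} = {g\<in>space gaussian. s < K + K * \<bar>g\<bar>}" using K by (auto simp: u_def field_simps)
  finally show ?thesis .
qed

text \<open>
  After symmetrising the test function it is even and increasing on the half line, and \<open>\<bar>z\<bar>\<close> is
  stochastically dominated by \<open>K + K * \<bar>g\<bar>\<close>. Convexity separates the summands, and the constant one
  is absorbed because \<open>\<bar>g\<bar> \<ge> 1 / 2\<close> with probability at least \<open>1 / 2\<close>, so that the value at \<open>2 * K\<close> is at
  most the mean of the values at \<open>8 * K * g\<close>.
\<close>

lemma subgauss_convex_le_gaussian:
  assumes law: "subgauss_law c \<rho>" and sy: "symmetric_law \<rho>" and c: "c > 0" and K: "K > 0" "K\<^sup>2 = 10 * c"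
  shows "convex_le \<rho> (distr gaussian borel (\<lambda>g. 8 * K * g))"
  unfolding convex_le_def
proof (intro ballI impI)
  note sb[measurable_cong] = subgauss_lawD(2)[OF law]
  interpret g: prob_space gaussian by (rule prob_space_gaussian)
  fix \<phi> :: "real \<Rightarrow> ennreal" assume m[measurable]: "\<phi> \<in> borel_measurable borel" and cv: "convex_fun \<phi>"
  let ?h = "ennreal (1/2)"
  define \<psi> where "\<psi> r = ?h * (\<phi> r + \<phi> (- r))" for r
  have [measurable]: "\<psi> \<in> borel_measurable borel" unfolding \<psi>_def by measurable
  have ev: "\<psi> (- r) = \<psi> r" "\<psi> \<bar>r\<bar> = \<psi> r" for r by (auto simp: \<psi>_def add.commute abs_if)
  have cv\<psi>: "\<psi> (u * x + v * y) \<le> ennreal u * \<psi> x + ennreal v * \<psi> y"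
    if uv: "0 \<le> u" "0 \<le> v" "u + v = 1" for u v x y
  proof -
    have 1: "\<phi> (u * x + v * y) \<le> ennreal u * \<phi> x + ennreal v * \<phi> y"
      and 2: "\<phi> (- (u * x + v * y)) \<le> ennreal u * \<phi> (- x) + ennreal v * \<phi> (- y)"
      using cv[unfolded convex_fun_def, rule_format, OF uv, of x y] cv[unfolded convex_fun_def, rule_format, OF uv, of "- x" "- y"]
      by (auto simp: algebra_simps)
    have "\<psi> (u * x + v * y) \<le> ?h * ((ennreal u * \<phi> x + ennreal v * \<phi> y) + (ennreal u * \<phi> (- x) + ennreal v * \<phi> (- y)))"
      unfolding \<psi>_def by (intro mult_left_mono add_mono 1 2) auto
    also have "\<dots> = ennreal u * \<psi> x + ennreal v * \<psi> y" unfolding \<psi>_def by (simp only: distrib_left ac_simps)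
    finally show ?thesis .
  qed
  have one: "ennreal u * x + ennreal v * x = x" if "0 \<le> u" "0 \<le> v" "u + v = 1" for u v x
    using that by (subst distrib_right[symmetric], subst ennreal_plus[symmetric]) auto
  have incr: "\<psi> r \<le> \<psi> s" if rs: "0 \<le> r" "r \<le> s" for r s
  proof (cases "s = 0")
    case False
    then have s: "s > 0" using rs by auto
    define u where "u = (1 + r / s) / 2"
    have uv: "0 \<le> u" "0 \<le> 1 - u" "u + (1 - u) = 1" using rs s by (auto simp: u_def field_simps)
    have e: "u * s + (1 - u) * (- s) = r" using s by (simp add: u_def field_simps)
    show ?thesis using cv\<psi>[OF uv, of s "- s"] unfolding e ev(1) one[OF uv] .
  qed (use rs in auto)
  have int_\<psi>: "(\<integral>\<^sup>+z. \<psi> (f z) \<partial>M) = (\<integral>\<^sup>+z. \<phi> (f z) \<partial>M)"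
    if e: "(\<integral>\<^sup>+z. \<phi> (- f z) \<partial>M) = (\<integral>\<^sup>+z. \<phi> (f z) \<partial>M)" and [measurable]: "f \<in> borel_measurable M" for f :: "real \<Rightarrow> real" and M
  proof -
    have "(\<integral>\<^sup>+z. \<psi> (f z) \<partial>M) = ?h * ((\<integral>\<^sup>+z. \<phi> (f z) \<partial>M) + (\<integral>\<^sup>+z. \<phi> (- f z) \<partial>M))"
      unfolding \<psi>_def by (subst nn_integral_cmult) (auto simp: nn_integral_add)
    then show ?thesis by (simp only: e distrib_left ennreal_half)
  qed
  have "(\<integral>\<^sup>+z. \<phi> z \<partial>\<rho>) = (\<integral>\<^sup>+z. \<psi> z \<partial>\<rho>)"
    by (rule int_\<psi>[symmetric]) (auto intro!: symmetric_law_nn_integral sy sb)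
  also have "\<dots> = (\<integral>\<^sup>+z. \<psi> \<bar>z\<bar> \<partial>\<rho>)" by (simp add: ev)
  also have "\<dots> \<le> (\<integral>\<^sup>+g. \<psi> (K + K * \<bar>g\<bar>) \<partial>gaussian)"
    by (rule stochastic_dominance[OF subgauss_lawD(1)[OF law] prob_space_gaussian])
       (use K incr in \<open>auto intro!: add_nonneg_nonneg subgauss_tail_le_gaussian[OF law c _ K, simplified]\<close>)
  also have "\<dots> \<le> (\<integral>\<^sup>+g. ?h * \<psi> (2 * K) + ?h * \<psi> (8 * K * \<bar>g\<bar>) \<partial>gaussian)"
  proof (rule nn_integral_mono)
    fix g :: real
    have "\<psi> (K + K * \<bar>g\<bar>) = \<psi> (1/2 * (2 * K) + 1/2 * (2 * K * \<bar>g\<bar>))" by simp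
    also have "\<dots> \<le> ?h * \<psi> (2 * K) + ?h * \<psi> (2 * K * \<bar>g\<bar>)" by (rule cv\<psi>) auto
    also have "\<dots> \<le> ?h * \<psi> (2 * K) + ?h * \<psi> (8 * K * \<bar>g\<bar>)"
      using K by (intro add_left_mono mult_left_mono incr) (auto intro!: mult_right_mono)
    finally show "\<psi> (K + K * \<bar>g\<bar>) \<le> ?h * \<psi> (2 * K) + ?h * \<psi> (8 * K * \<bar>g\<bar>)" .
  qed
  also have "\<dots> = ?h * \<psi> (2 * K) + ?h * (\<integral>\<^sup>+g. \<psi> (8 * K * \<bar>g\<bar>) \<partial>gaussian)"
    by (subst nn_integral_add) (auto simp: nn_integral_cmult g.emeasure_space_1[simplified])
  also have "\<psi> (2 * K) \<le> (\<integral>\<^sup>+g. \<psi> (8 * K * \<bar>g\<bar>) \<partial>gaussian)"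
  proof -
    define p where "p = measure gaussian {g. \<bar>g\<bar> < 1/2}"
    have p: "0 \<le> p" "p \<le> 1/2" using gaussian_small_ball by (auto simp: p_def)
    let ?A = "{g::real. \<bar>g\<bar> < 1/2}"
    have A: "?A \<in> sets gaussian" "- ?A \<in> sets gaussian" by auto
    have "measure gaussian (space gaussian - ?A) = 1 - p" unfolding p_def by (rule g.prob_compl[OF A(1)])
    moreover have "space gaussian - ?A = - ?A" by auto
    ultimately have pc: "emeasure gaussian (- ?A) = ennreal (1 - p)" by (simp only: g.emeasure_eq_measure)
    have pe: "emeasure gaussian ?A = ennreal p" by (simp only: g.emeasure_eq_measure p_def)
    have "\<psi> (2 * K) \<le> \<psi> (p * 0 + (1 - p) * (4 * K))" using p K by (intro incr) (auto simp: field_simps)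
    also have "\<dots> \<le> ennreal p * \<psi> 0 + ennreal (1 - p) * \<psi> (4 * K)" by (rule cv\<psi>) (use p in auto)
    also have "\<dots> = \<psi> 0 * emeasure gaussian ?A + \<psi> (4 * K) * emeasure gaussian (- ?A)"
      by (simp only: pc pe mult.commute)
    also have "\<dots> = (\<integral>\<^sup>+g. \<psi> 0 * indicator ?A g \<partial>gaussian) + (\<integral>\<^sup>+g. \<psi> (4 * K) * indicator (- ?A) g \<partial>gaussian)"
      by (simp only: nn_integral_cmult_indicator[OF A(1)] nn_integral_cmult_indicator[OF A(2)])
    also have "\<dots> = (\<integral>\<^sup>+g. \<psi> 0 * indicator ?A g + \<psi> (4 * K) * indicator (- ?A) g \<partial>gaussian)"
      by (rule nn_integral_add[symmetric]) (use A in auto)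
    also have "\<dots> \<le> (\<integral>\<^sup>+g. \<psi> (8 * K * \<bar>g\<bar>) \<partial>gaussian)"
    proof (rule nn_integral_mono)
      fix g :: real
      show "\<psi> 0 * indicator ?A g + \<psi> (4 * K) * indicator (- ?A) g \<le> \<psi> (8 * K * \<bar>g\<bar>)"
      proof (cases "\<bar>g\<bar> < 1/2")
        case True then show ?thesis using K by (auto intro!: incr)
      next
        case False
        then have "8 * K * (1/2) \<le> 8 * K * \<bar>g\<bar>" using K by (intro mult_left_mono) auto
        then show ?thesis using False K by (auto intro!: incr)
      qed
    qed
    finally show ?thesis .
  qed
  then have "?h * \<psi> (2 * K) + ?h * (\<integral>\<^sup>+g. \<psi> (8 * K * \<bar>g\<bar>) \<partial>gaussian)
     \<le> ?h * (\<integral>\<^sup>+g. \<psi> (8 * K * \<bar>g\<bar>) \<partial>gaussian) + ?h * (\<integral>\<^sup>+g. \<psi> (8 * K * \<bar>g\<bar>) \<partial>gaussian)"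
    by (intro add_right_mono mult_left_mono) auto
  also have "\<dots> = (\<integral>\<^sup>+g. \<psi> (8 * K * \<bar>g\<bar>) \<partial>gaussian)" by (rule ennreal_half)
  also have "\<dots> = (\<integral>\<^sup>+g. \<psi> (8 * K * g) \<partial>gaussian)"
  proof (intro nn_integral_cong)
    fix g :: real show "\<psi> (8 * K * \<bar>g\<bar>) = \<psi> (8 * K * g)" using ev(2)[of "8 * K * g"] K by (simp add: abs_mult)
  qed
  also have "\<dots> = (\<integral>\<^sup>+g. \<phi> (8 * K * g) \<partial>gaussian)"
    by (rule int_\<psi>) (use symmetric_law_nn_integral[OF symmetric_gaussian, of "\<lambda>g. \<phi> (8 * K * g)"] in auto)
  also have "\<dots> = (\<integral>\<^sup>+z. \<phi> z \<partial>distr gaussian borel (\<lambda>g. 8 * K * g))"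
    by (rule nn_integral_distr[symmetric]) auto
  finally show "(\<integral>\<^sup>+z. \<phi> z \<partial>\<rho>) \<le> (\<integral>\<^sup>+z. \<phi> z \<partial>distr gaussian borel (\<lambda>g. 8 * K * g))" .
qed

section \<open>Tails of the support functional\<close>

text \<open>
  Jensen's inequality bounds the second factor of the product from below. Integrability of \<open>f\<close> is
  part of the conclusion: the second factor is positive, so the first is finite.
\<close>

lemma mgf_from_product_bound:
  assumes P: "prob_space P" and f[measurable]: "f \<in> borel_measurable P" and f0: "\<And>x. 0 \<le> f x"
    and la: "la > 0"
    and ch: "(\<integral>\<^sup>+x. ennreal (exp (la * f x)) \<partial>P) * (\<integral>\<^sup>+x. ennreal (exp (- q * f x)) \<partial>P) \<le> ennreal c"
  shows "integrable P f" "(\<integral>\<^sup>+x. ennreal (exp (la * f x)) \<partial>P) \<le> ennreal (c * exp (q * (\<integral>x. f x \<partial>P)))"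
proof -
  interpret prob_space P by fact
  let ?A = "\<integral>\<^sup>+x. ennreal (exp (la * f x)) \<partial>P" and ?B = "\<integral>\<^sup>+x. ennreal (exp (- q * f x)) \<partial>P"
  have B0: "?B \<noteq> 0" by (subst nn_integral_0_iff_AE) (auto simp: not_le eventually_False ae_filter_eq_bot_iff emeasure_space_1)
  have A: "?A < \<infinity>"
  proof (rule ccontr)
    assume "\<not> ?A < \<infinity>"
    then have "?A = \<infinity>" by (simp add: less_top[symmetric])
    with ch B0 show False by (simp add: ennreal_top_mult top_unique)
  qed
  show int: "integrable P f"
  proof (rule integrableI_nonneg)
    have "(\<integral>\<^sup>+x. ennreal (f x) \<partial>P) \<le> (\<integral>\<^sup>+x. ennreal (1 / la) * ennreal (exp (la * f x)) \<partial>P)"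
    proof (rule nn_integral_mono)
      fix x
      have "la * f x \<le> exp (la * f x)" using exp_ge_add_one_self[of "la * f x"] by linarith
      then have "f x \<le> 1 / la * exp (la * f x)" using la by (simp add: field_simps)
      then show "ennreal (f x) \<le> ennreal (1 / la) * ennreal (exp (la * f x))"
        using la by (subst ennreal_mult[symmetric]) (auto intro: ennreal_leI)
    qed
    also have "\<dots> = ennreal (1 / la) * ?A" by (rule nn_integral_cmult) auto
    also have "\<dots> < \<infinity>" using A by (simp add: ennreal_mult_less_top)
    finally show "(\<integral>\<^sup>+x. ennreal (f x) \<partial>P) < \<infinity>" .
  qed (use f0 in auto)
  have "ennreal (exp (\<integral>x. - q * f x \<partial>P)) \<le> ?B"
    by (rule exp_jensen[OF P]) (use int in auto)
  then have B: "ennreal (exp (- q * (\<integral>x. f x \<partial>P))) \<le> ?B" by simp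
  have "?A = ?A * ennreal (exp (- q * (\<integral>x. f x \<partial>P))) * ennreal (exp (q * (\<integral>x. f x \<partial>P)))"
    by (simp add: mult.assoc ennreal_mult[symmetric] exp_add[symmetric])
  also have "\<dots> \<le> ?A * ?B * ennreal (exp (q * (\<integral>x. f x \<partial>P)))"
    by (intro mult_right_mono mult_left_mono B) auto
  also have "\<dots> \<le> ennreal c * ennreal (exp (q * (\<integral>x. f x \<partial>P)))" by (intro mult_right_mono ch) auto
  also have "\<dots> = ennreal (c * exp (q * (\<integral>x. f x \<partial>P)))" by (simp add: ennreal_mult'')
  finally show "?A \<le> ennreal (c * exp (q * (\<integral>x. f x \<partial>P)))" .
qed

lemma emeasure_exp_bound:
  assumes [measurable]: "f \<in> borel_measurable P"
  shows "emeasure P {x\<in>space P. s \<le> f x} \<le> ennreal (exp (- s)) * (\<integral>\<^sup>+x. ennreal (exp (f x)) \<partial>P)"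
proof -
  have "emeasure P {x\<in>space P. s \<le> f x} = (\<integral>\<^sup>+x. indicator {x\<in>space P. s \<le> f x} x \<partial>P)" by simp
  also have "\<dots> \<le> (\<integral>\<^sup>+x. ennreal (exp (- s)) * ennreal (exp (f x)) \<partial>P)"
  proof (rule nn_integral_mono)
    fix x
    show "indicator {x\<in>space P. s \<le> f x} x \<le> ennreal (exp (- s)) * ennreal (exp (f x))"
      by (auto simp: indicator_def ennreal_mult[symmetric] exp_add[symmetric])
  qed
  also have "\<dots> = ennreal (exp (- s)) * (\<integral>\<^sup>+x. ennreal (exp (f x)) \<partial>P)" by (rule nn_integral_cmult) auto
  finally show ?thesis .
qed

lemma AE_rademacher: "AE x in rademacher. x = 1 \<or> x = -1"
proof -
  have "AE x in measure_pmf (pmf_of_set {1, -1 :: real}). x = 1 \<or> x = -1"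
    by (auto simp: AE_measure_pmf_iff)
  then show ?thesis unfolding rademacher_def by (subst AE_distr_iff) auto
qed

lemma rademacher_facts:
  "subgauss_law 1 rademacher" "symmetric_law rademacher" "integrable rademacher (\<lambda>z. z)" "(\<integral>z. \<bar>z\<bar> \<partial>rademacher) = 1"
proof -
  interpret prob_space rademacher by (rule prob_space_rademacher)
  show "subgauss_law 1 rademacher" using rademacher_mgf by (simp add: subgauss_law_def prob_space_rademacher)
  have "distr rademacher borel uminus = distr rademacher borel (\<lambda>x. x)"
    by (rule distr_eqI_nn_integral) (auto simp: nn_integral_rademacher add.commute)
  also have "\<dots> = rademacher" by (rule distr_id2) simp
  finally show "symmetric_law rademacher" by (simp add: symmetric_law_def)
  show "integrable rademacher (\<lambda>z. z)"
    by (rule integrable_const_bound[where B=1]) (use AE_rademacher in auto)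
  have "(\<integral>z. \<bar>z\<bar> \<partial>rademacher) = (\<integral>z. 1 \<partial>rademacher)"
    by (rule integral_cong_AE) (use AE_rademacher in auto)
  then show "(\<integral>z. \<bar>z\<bar> \<partial>rademacher) = 1" by (simp add: prob_space)
qed

context support_functional begin

definition gauss_mean :: real where "gauss_mean = (\<integral>x. h x \<partial>iid J gaussian)"
definition rad_mean :: real where "rad_mean = (\<integral>x. h x \<partial>iid J rademacher)"

lemma gauss_mgf:
  shows "integrable (iid J gaussian) h"
    and "la > 0 \<Longrightarrow> (\<integral>\<^sup>+x. ennreal (exp (la * h x)) \<partial>iid J gaussian) \<le> ennreal (exp (4 * la\<^sup>2 * d\<^sup>2 + 2 * la * gauss_mean))"
proof -
  have P: "prob_space (iid J gaussian)" by (rule prob_space_PiM) (rule prob_space_gaussian)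
  have m: "h \<in> borel_measurable (iid J gaussian)" by measurable
  note M = mgf_from_product_bound[OF P m h_nonneg _ gaussian_mgf_product]
  show "integrable (iid J gaussian) h" using M(1)[of 1] by simp
  show "la > 0 \<Longrightarrow> (\<integral>\<^sup>+x. ennreal (exp (la * h x)) \<partial>iid J gaussian) \<le> ennreal (exp (4 * la\<^sup>2 * d\<^sup>2 + 2 * la * gauss_mean))"
    using M(2)[of la] by (simp add: gauss_mean_def exp_add)
qed

lemma rad_mgf:
  shows "integrable (iid J rademacher) h"
    and "la > 0 \<Longrightarrow> (\<integral>\<^sup>+x. ennreal (exp (la * h x)) \<partial>iid J rademacher) \<le> ennreal (exp (32 * la\<^sup>2 * d\<^sup>2 + 2 * la * rad_mean))"
proof -
  have P: "prob_space (iid J rademacher)" by (rule prob_space_PiM) (rule prob_space_rademacher)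
  have m: "h \<in> borel_measurable (iid J rademacher)" by measurable
  have ch: "(\<integral>\<^sup>+x. ennreal (exp (la * h x)) \<partial>iid J rademacher)
       * (\<integral>\<^sup>+x. ennreal (exp (- (2 * la) * h x)) \<partial>iid J rademacher) \<le> ennreal (exp (32 * la\<^sup>2 * d\<^sup>2))"
    if "la > 0" for la
    using rademacher_mgf_product[OF rademacher_facts(1,2,3), of 1 la 32] that by (simp add: rademacher_facts)
  note M = mgf_from_product_bound[OF P m h_nonneg _ ch]
  show "integrable (iid J rademacher) h" using M(1)[of 1] by simp
  show "la > 0 \<Longrightarrow> (\<integral>\<^sup>+x. ennreal (exp (la * h x)) \<partial>iid J rademacher) \<le> ennreal (exp (32 * la\<^sup>2 * d\<^sup>2 + 2 * la * rad_mean))"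
    using M(2)[of la] by (simp add: rad_mean_def exp_add)
qed

text \<open>
  The mean of \<open>h\<close> at a vector of signs is the right quantity here: for it the coupling has bounded
  noise on the side of the signs, whatever the law \<open>\<rho>\<close>.
\<close>

lemma lower_tail:
  assumes law: "subgauss_law c \<rho>" and sy: "symmetric_law \<rho>" and z2: "(\<integral>z. z\<^sup>2 \<partial>\<rho>) = 1" and c: "c \<ge> 0"
    and m0: "m0 = exp (- c / 2) / 32" and C: "C = max 4 (32 * c / m0\<^sup>2)" and la: "la \<ge> 0" and s: "s \<ge> 0"
  shows "emeasure (iid J \<rho>) {x\<in>space (iid J \<rho>). h x \<le> s}
     \<le> ennreal (exp (2 * la * s / m0 + C * la\<^sup>2 * d\<^sup>2 - la * rad_mean))"
proof -
  note sb[measurable_cong] = subgauss_lawD(2)[OF law]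
  note i = integrable_if_second_moment[OF subgauss_lawD(1,2)[OF law] z2]
  define m where "m = (\<integral>z. \<bar>z\<bar> \<partial>\<rho>)"
  have m: "m0 \<le> m" "m0 > 0" using subgauss_abs_moment[OF law z2] by (auto simp: m_def m0)
  then have mp: "m > 0" by linarith
  let ?P = "iid J \<rho>" and ?R = "iid J rademacher"
  let ?B = "\<integral>\<^sup>+x. ennreal (exp (- (2 * la / m) * h x)) \<partial>?P"
  have "m0\<^sup>2 \<le> m\<^sup>2" using m by (intro power_mono) auto
  then have "32 * c / m\<^sup>2 \<le> 32 * c / m0\<^sup>2" using c m by (intro divide_left_mono) auto
  then have CC: "4 \<le> C" "32 * c / m\<^sup>2 \<le> C" by (auto simp: C)
  have ch: "(\<integral>\<^sup>+x. ennreal (exp (la * h x)) \<partial>?R) * ?B \<le> ennreal (exp (C * la\<^sup>2 * d\<^sup>2))"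
    by (rule rademacher_mgf_product[OF law sy i(2) m_def mp c la CC])
  have "ennreal (exp (\<integral>x. la * h x \<partial>?R)) \<le> (\<integral>\<^sup>+x. ennreal (exp (la * h x)) \<partial>?R)"
    by (rule exp_jensen) (use rad_mgf(1) in \<open>auto intro: prob_space_PiM prob_space_rademacher\<close>)
  then have A: "ennreal (exp (la * rad_mean)) \<le> (\<integral>\<^sup>+x. ennreal (exp (la * h x)) \<partial>?R)" by (simp add: rad_mean_def)
  have "?B = ennreal (exp (- la * rad_mean)) * (ennreal (exp (la * rad_mean)) * ?B)"
    by (simp add: mult.assoc[symmetric] ennreal_mult[symmetric] exp_add[symmetric])
  also have "\<dots> \<le> ennreal (exp (- la * rad_mean)) * ((\<integral>\<^sup>+x. ennreal (exp (la * h x)) \<partial>?R) * ?B)"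
    by (intro mult_left_mono mult_right_mono A) auto
  also have "\<dots> \<le> ennreal (exp (- la * rad_mean)) * ennreal (exp (C * la\<^sup>2 * d\<^sup>2))"
    by (intro mult_left_mono ch) auto
  finally have B: "?B \<le> ennreal (exp (- la * rad_mean)) * ennreal (exp (C * la\<^sup>2 * d\<^sup>2))" .
  have "emeasure ?P {x\<in>space ?P. h x \<le> s} \<le> emeasure ?P {x\<in>space ?P. - (2 * la / m) * s \<le> - (2 * la / m) * h x}"
    using la mp by (intro emeasure_mono) (auto intro!: divide_right_mono mult_left_mono)
  also have "\<dots> \<le> ennreal (exp (- (- (2 * la / m) * s))) * ?B"
    by (rule emeasure_exp_bound) measurable
  also have "\<dots> \<le> ennreal (exp (- (- (2 * la / m) * s))) * (ennreal (exp (- la * rad_mean)) * ennreal (exp (C * la\<^sup>2 * d\<^sup>2)))"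
    by (rule mult_left_mono[OF B]) simp
  also have "\<dots> = ennreal (exp (2 * la * s / m + C * la\<^sup>2 * d\<^sup>2 - la * rad_mean))"
    by (simp add: ennreal_mult[symmetric] exp_add[symmetric] algebra_simps)
  also have "\<dots> \<le> ennreal (exp (2 * la * s / m0 + C * la\<^sup>2 * d\<^sup>2 - la * rad_mean))"
  proof -
    have "2 * la * s / m \<le> 2 * la * s / m0" using m mp la s by (intro divide_left_mono) auto
    then show ?thesis by (intro ennreal_leI) simp
  qed
  finally show ?thesis .
qed

lemma upper_tail:
  assumes law: "subgauss_law c \<rho>" and sy: "symmetric_law \<rho>" and c: "c > 0" and K: "K > 0" "K\<^sup>2 = 10 * c" and la: "la > 0"
  shows "emeasure (iid J \<rho>) {x\<in>space (iid J \<rho>). 8 * K * s \<le> h x}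
     \<le> ennreal (exp (- la * s + 4 * la\<^sup>2 * d\<^sup>2 + 2 * la * gauss_mean))"
proof -
  note sb[measurable_cong] = subgauss_lawD(2)[OF law]
  let ?P = "iid J \<rho>"
  let ?\<beta> = "distr gaussian borel (\<lambda>g. 8 * K * g)"
  define l where "l = la / (8 * K)"
  have l: "l > 0" "l * (8 * K) = la" using la K by (auto simp: l_def)
  interpret g: prob_space gaussian by (rule prob_space_gaussian)
  have pb: "prob_space ?\<beta>" by (rule g.prob_space_distr) auto
  have "(\<integral>\<^sup>+x. ennreal (exp (l * h x)) \<partial>?P) \<le> (\<integral>\<^sup>+x. ennreal (exp (l * h x)) \<partial>iid J ?\<beta>)"
  proof (rule convex_le_PiM[OF finite_J subgauss_lawD(1,2)[OF law] pb])
    show "convex_le \<rho> ?\<beta>" by (rule subgauss_convex_le_gaussian[OF law sy c K])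
    show "convex_vec_fun (\<lambda>x. ennreal (exp (l * h x)))"
      unfolding convex_vec_fun_def
    proof (intro allI impI)
      fix x y and u v :: real assume uv: "0 \<le> u" "0 \<le> v" "u + v = 1"
      have "exp (l * h (\<lambda>j. u * x j + v * y j)) \<le> exp (u * (l * h x) + v * (l * h y))"
        using mult_left_mono[OF h_convex[OF uv(1,2), of x y], of l] l by (simp add: algebra_simps)
      also have "\<dots> \<le> u * exp (l * h x) + v * exp (l * h y)"
      proof -
        have u: "u = 1 - v" using uv by simp
        show ?thesis using convex_onD[OF exp_convex, of v "l * h x" "l * h y"] uv unfolding u by simp
      qed
      finally have "ennreal (exp (l * h (\<lambda>j. u * x j + v * y j))) \<le> ennreal (u * exp (l * h x) + v * exp (l * h y))"
        by (rule ennreal_leI)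
      also have "\<dots> = ennreal u * ennreal (exp (l * h x)) + ennreal v * ennreal (exp (l * h y))"
        using uv by (subst ennreal_plus) (auto simp: ennreal_mult)
      finally show "ennreal (exp (l * h (\<lambda>j. u * x j + v * y j)))
        \<le> ennreal u * ennreal (exp (l * h x)) + ennreal v * ennreal (exp (l * h y))" .
    qed
  qed auto
  also have "(\<integral>\<^sup>+x. ennreal (exp (l * h x)) \<partial>iid J ?\<beta>) = (\<integral>\<^sup>+x. ennreal (exp (l * h (\<lambda>j\<in>J. 8 * K * x j))) \<partial>iid J gaussian)"
    by (rule nn_integral_PiM_map[OF finite_J prob_space_gaussian, symmetric]) auto
  also have "\<dots> = (\<integral>\<^sup>+x. ennreal (exp (la * h x)) \<partial>iid J gaussian)"
    using K l by (simp add: h_scale mult.assoc[symmetric])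
  also have "\<dots> \<le> ennreal (exp (4 * la\<^sup>2 * d\<^sup>2 + 2 * la * gauss_mean))" by (rule gauss_mgf(2)[OF la])
  finally have M: "(\<integral>\<^sup>+x. ennreal (exp (l * h x)) \<partial>?P) \<le> ennreal (exp (4 * la\<^sup>2 * d\<^sup>2 + 2 * la * gauss_mean))" .
  have "emeasure ?P {x\<in>space ?P. 8 * K * s \<le> h x} = emeasure ?P {x\<in>space ?P. la * s \<le> l * h x}"
    using K la by (intro arg_cong[where f="emeasure ?P"] Collect_cong conj_cong refl) (auto simp: l_def field_simps)
  also have "\<dots> \<le> ennreal (exp (- (la * s))) * (\<integral>\<^sup>+x. ennreal (exp (l * h x)) \<partial>?P)"
    by (rule emeasure_exp_bound) measurable
  also have "\<dots> \<le> ennreal (exp (- (la * s))) * ennreal (exp (4 * la\<^sup>2 * d\<^sup>2 + 2 * la * gauss_mean))"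
    by (rule mult_left_mono[OF M]) simp
  also have "\<dots> = ennreal (exp (- la * s + 4 * la\<^sup>2 * d\<^sup>2 + 2 * la * gauss_mean))"
    by (simp add: ennreal_mult[symmetric] exp_add[symmetric] algebra_simps)
  finally show ?thesis .
qed

end

section \<open>Cotype 2: gaussian against Rademacher averages\<close>

definition sparse_rademacher :: "'a measure \<Rightarrow> 'a set \<Rightarrow> real measure" where
  "sparse_rademacher M A = distr (rademacher \<Otimes>\<^sub>M M) borel (\<lambda>(e, x). e * indicator A x)"

lemma sets_sparse_rademacher[simp, measurable_cong]: "sets (sparse_rademacher M A) = sets borel"
  by (simp add: sparse_rademacher_def)

lemma prob_space_pair_rademacher: "prob_space M \<Longrightarrow> prob_space (rademacher \<Otimes>\<^sub>M M)"
  using prob_space_rademacher by (intro prob_space_pair) auto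

lemma prob_space_sparse_rademacher:
  assumes "prob_space M" and [measurable]: "A \<in> sets M"
  shows "prob_space (sparse_rademacher M A)"
  unfolding sparse_rademacher_def
  by (rule prob_space.prob_space_distr[OF prob_space_pair_rademacher]) (use assms in auto)

lemma nn_integral_sparse_rademacher:
  assumes M: "prob_space M" and A[measurable]: "A \<in> sets M" and [measurable]: "\<Phi> \<in> borel_measurable borel"
  shows "(\<integral>\<^sup>+z. \<Phi> z \<partial>sparse_rademacher M A)
    = ennreal (1 - measure M A) * \<Phi> 0 + ennreal (measure M A) * (ennreal (1/2) * (\<Phi> 1 + \<Phi> (- 1)))"
proof -
  interpret prob_space M by fact
  have I: "(\<integral>\<^sup>+x. \<Phi> (e * indicator A x) \<partial>M) = \<Phi> 0 * ennreal (1 - measure M A) + \<Phi> e * ennreal (measure M A)" for e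
  proof -
    have "(\<integral>\<^sup>+x. \<Phi> (e * indicator A x) \<partial>M) = (\<integral>\<^sup>+x. \<Phi> 0 * indicator (space M - A) x + \<Phi> e * indicator A x \<partial>M)"
      by (intro nn_integral_cong) (auto simp: indicator_def)
    also have "\<dots> = (\<integral>\<^sup>+x. \<Phi> 0 * indicator (space M - A) x \<partial>M) + (\<integral>\<^sup>+x. \<Phi> e * indicator A x \<partial>M)"
      by (rule nn_integral_add) auto
    also have "\<dots> = \<Phi> 0 * emeasure M (space M - A) + \<Phi> e * emeasure M A"
      by (subst (1 2) nn_integral_cmult_indicator) auto
    finally show ?thesis by (simp only: emeasure_eq_measure prob_compl[OF A])
  qed
  have "(\<integral>\<^sup>+z. \<Phi> z \<partial>sparse_rademacher M A) = (\<integral>\<^sup>+p. \<Phi> (case p of (e, x) \<Rightarrow> e * indicator A x) \<partial>(rademacher \<Otimes>\<^sub>M M))"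
    unfolding sparse_rademacher_def by (rule nn_integral_distr) measurable
  also have "\<dots> = ennreal (1/2) * ((\<integral>\<^sup>+x. \<Phi> (indicator A x) \<partial>M) + (\<integral>\<^sup>+x. \<Phi> (- indicator A x) \<partial>M))"
    by (subst nn_integral_rademacher_pair[OF M], measurable)
  also have "\<dots> = ennreal (1/2) * ((\<integral>\<^sup>+x. \<Phi> (1 * indicator A x) \<partial>M) + (\<integral>\<^sup>+x. \<Phi> (-1 * indicator A x) \<partial>M))"
    by simp
  also have "\<dots> = ennreal (1/2) * ((\<Phi> 0 * ennreal (1 - measure M A) + \<Phi> 1 * ennreal (measure M A)) + (\<Phi> 0 * ennreal (1 - measure M A) + \<Phi> (-1) * ennreal (measure M A)))"
    by (simp only: I)
  also have "\<dots> = (ennreal (1/2) * (\<Phi> 0 * ennreal (1 - measure M A)) + ennreal (1/2) * (\<Phi> 0 * ennreal (1 - measure M A))) + ennreal (measure M A) * (ennreal (1/2) * (\<Phi> 1 + \<Phi> (- 1)))"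
    by (simp only: distrib_left ac_simps)
  also have "\<dots> = ennreal (1 - measure M A) * \<Phi> 0 + ennreal (measure M A) * (ennreal (1/2) * (\<Phi> 1 + \<Phi> (- 1)))"
    by (simp only: ennreal_half mult.commute)
  finally show ?thesis .
qed

lemma convex_fun_sym_mono:
  assumes cv: "convex_fun \<phi>" and w: "\<bar>w\<bar> \<le> b"
  shows "\<phi> w + \<phi> (- w) \<le> \<phi> b + \<phi> (- b)"
proof (cases "b = 0")
  case False
  then have b: "b > 0" using w by auto
  define u where "u = (1 + w / b) / 2"
  have uv: "0 \<le> u" "0 \<le> 1 - u" "u + (1 - u) = 1" using w b by (auto simp: u_def field_simps abs_le_iff)
  have 1: "\<phi> (u * b + (1 - u) * (- b)) \<le> ennreal u * \<phi> b + ennreal (1 - u) * \<phi> (- b)"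
    using cv[unfolded convex_fun_def] uv by blast
  have 2: "\<phi> (u * (- b) + (1 - u) * b) \<le> ennreal u * \<phi> (- b) + ennreal (1 - u) * \<phi> b"
    using cv[unfolded convex_fun_def] uv by blast
  have e: "u * b + (1 - u) * (- b) = w" "u * (- b) + (1 - u) * b = - w" using b by (auto simp: u_def field_simps)
  have "\<phi> w + \<phi> (- w) \<le> (ennreal u * \<phi> b + ennreal (1 - u) * \<phi> (- b)) + (ennreal u * \<phi> (- b) + ennreal (1 - u) * \<phi> b)"
    using 1 2 unfolding e by (rule add_mono)
  also have "\<dots> = (ennreal u + ennreal (1 - u)) * (\<phi> b + \<phi> (- b))" by (simp only: distrib_left distrib_right ac_simps)
  also have "ennreal u + ennreal (1 - u) = 1" using uv by (subst ennreal_plus[symmetric]) auto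
  finally show ?thesis by simp
qed (use w in auto)

text \<open>
  Erasing fewer signs increases the law in the convex order, since a convex function at \<open>0\<close> is at
  most its mean at \<open>1\<close> and \<open>- 1\<close>.
\<close>

lemma convex_le_sparse_rademacher:
  assumes M: "prob_space M" and A[measurable]: "A \<in> sets M" and N: "prob_space N" and B[measurable]: "B \<in> sets N"
    and le: "measure M A \<le> measure N B"
  shows "convex_le (sparse_rademacher M A) (sparse_rademacher N B)"
  unfolding convex_le_def
proof (intro ballI impI)
  interpret M: prob_space M by fact
  interpret N: prob_space N by fact
  fix \<phi> :: "real \<Rightarrow> ennreal" assume m[measurable]: "\<phi> \<in> borel_measurable borel" and cv: "convex_fun \<phi>"
  define p q R where "p = measure M A" and "q = measure N B" and "R = ennreal (1/2) * (\<phi> 1 + \<phi> (-1))"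
  have pq: "0 \<le> p" "p \<le> q" "q \<le> 1" using le by (auto simp: p_def q_def)
  have "ennreal (1/2) * (\<phi> 0 + \<phi> 0) \<le> R" unfolding R_def
    using convex_fun_sym_mono[OF cv, of 0 1] by (intro mult_left_mono) auto
  then have 0: "\<phi> 0 \<le> R" by (simp only: distrib_left ennreal_half)
  have "ennreal (1 - p) * \<phi> 0 + ennreal p * R = ennreal (1 - q) * \<phi> 0 + ennreal (q - p) * \<phi> 0 + ennreal p * R"
    using pq by (simp add: distrib_right[symmetric] ennreal_plus[symmetric] del: ennreal_plus)
  also have "\<dots> \<le> ennreal (1 - q) * \<phi> 0 + ennreal (q - p) * R + ennreal p * R"
    by (intro add_right_mono add_left_mono mult_left_mono 0) auto
  also have "\<dots> = ennreal (1 - q) * \<phi> 0 + ennreal q * R"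
    using pq by (simp add: add.assoc distrib_right[symmetric] ennreal_plus[symmetric] del: ennreal_plus)
  finally show "(\<integral>\<^sup>+z. \<phi> z \<partial>sparse_rademacher M A) \<le> (\<integral>\<^sup>+z. \<phi> z \<partial>sparse_rademacher N B)"
    by (simp only: nn_integral_sparse_rademacher[OF M A m] nn_integral_sparse_rademacher[OF N B m] p_def q_def R_def)
qed

lemma convex_le_rademacher_scaled:
  assumes M: "prob_space M" and w[measurable]: "w \<in> borel_measurable M" "b \<in> borel_measurable M" and le: "\<And>x. \<bar>w x\<bar> \<le> b x"
  shows "convex_le (distr (rademacher \<Otimes>\<^sub>M M) borel (\<lambda>(e, x). e * w x)) (distr (rademacher \<Otimes>\<^sub>M M) borel (\<lambda>(e, x). e * b x))"
  unfolding convex_le_def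
proof (intro ballI impI)
  fix \<phi> :: "real \<Rightarrow> ennreal" assume m[measurable]: "\<phi> \<in> borel_measurable borel" and cv: "convex_fun \<phi>"
  have I: "(\<integral>\<^sup>+z. \<phi> z \<partial>distr (rademacher \<Otimes>\<^sub>M M) borel (\<lambda>(e, x). e * v x)) = ennreal (1/2) * (\<integral>\<^sup>+x. (\<phi> (v x) + \<phi> (- v x)) \<partial>M)"
    if [measurable]: "v \<in> borel_measurable M" for v
  proof -
    have "(\<integral>\<^sup>+z. \<phi> z \<partial>distr (rademacher \<Otimes>\<^sub>M M) borel (\<lambda>(e, x). e * v x)) = (\<integral>\<^sup>+p. \<phi> (case p of (e, x) \<Rightarrow> e * v x) \<partial>(rademacher \<Otimes>\<^sub>M M))"
      by (rule nn_integral_distr) measurable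
    also have "\<dots> = ennreal (1/2) * ((\<integral>\<^sup>+x. \<phi> (v x) \<partial>M) + (\<integral>\<^sup>+x. \<phi> (- v x) \<partial>M))"
      by (subst nn_integral_rademacher_pair[OF M], measurable)
    finally show ?thesis by (subst nn_integral_add) auto
  qed
  show "(\<integral>\<^sup>+z. \<phi> z \<partial>distr (rademacher \<Otimes>\<^sub>M M) borel (\<lambda>(e, x). e * w x)) \<le> (\<integral>\<^sup>+z. \<phi> z \<partial>distr (rademacher \<Otimes>\<^sub>M M) borel (\<lambda>(e, x). e * b x))"
    unfolding I[OF w(1)] I[OF w(2)] by (intro mult_left_mono nn_integral_mono convex_fun_sym_mono cv le) auto
qed

lemma gaussian_subgauss: "subgauss_law (1/2) gaussian"
  by (simp add: subgauss_law_def prob_space_gaussian gaussian_mgf)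

lemma gaussian_tail_geometric: "measure gaussian {g. 3 * real l < \<bar>g\<bar>} \<le> 1 / 16 ^ l"
proof (cases "l = 0")
  case True
  interpret prob_space gaussian by (rule prob_space_gaussian)
  show ?thesis using True by simp
next
  case False
  interpret prob_space gaussian by (rule prob_space_gaussian)
  have "emeasure gaussian {g. 3 * real l < \<bar>g\<bar>} \<le> emeasure gaussian {g\<in>space gaussian. 3 * real l \<le> \<bar>g\<bar>}"
    by (rule emeasure_mono) auto
  also have "\<dots> \<le> ennreal (2 * exp (- (3 * real l)\<^sup>2 / (4 * (1/2))))"
    by (rule subgauss_tail[OF gaussian_subgauss]) auto
  also have "\<dots> \<le> ennreal (1 / 16 ^ l)"
  proof (rule ennreal_leI)
    have e: "32 \<le> exp (9/2 :: real)"
    proof -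
      have "(5/2::real) ^ 4 \<le> exp 1 ^ 4" using exp_lower_Taylor_quadratic[of 1] by (intro power_mono) auto
      also have "\<dots> = exp (4::real)" by (simp add: exp_of_nat_mult[symmetric])
      also have "\<dots> \<le> exp (9/2)" by simp
      finally show ?thesis by (simp add: eval_nat_numeral)
    qed
    have l1: "1 \<le> real l" using False by simp
    then have "real l \<le> (real l)\<^sup>2" by (simp add: power2_eq_square)
    then have "real l * (9/2) \<le> (3 * real l)\<^sup>2 / 2" by (simp add: power_mult_distrib)
    then have "exp (real l * (9/2)) \<le> exp ((3 * real l)\<^sup>2 / 2)" by simp
    moreover have "2 * 16 ^ l \<le> (32 :: real) ^ l"
    proof -
      have "(2::real) ^ 1 \<le> 2 ^ l" using False by (intro power_increasing) auto
      then have "2 * 16 ^ l \<le> (2::real) ^ l * 16 ^ l" by (intro mult_right_mono) auto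
      then show ?thesis by (simp add: power_mult_distrib[symmetric])
    qed
    moreover have "(32 :: real) ^ l \<le> exp (9/2) ^ l" by (rule power_mono[OF e]) auto
    moreover have "exp (9/2 :: real) ^ l = exp (real l * (9/2))" by (rule exp_of_nat_mult[symmetric])
    ultimately have "2 * 16 ^ l \<le> exp ((3 * real l)\<^sup>2 / 2)" by linarith
    then show "2 * exp (- (3 * real l)\<^sup>2 / (4 * (1/2))) \<le> 1 / 16 ^ l" by (simp add: exp_minus field_simps)
  qed
  finally show ?thesis by (simp add: emeasure_eq_measure)
qed

context support_functional begin

lemma h_sq_le_exp: assumes "la > 0" shows "(h x)\<^sup>2 \<le> 2 / la\<^sup>2 * exp (la * h x)"
proof -
  have "1 + la * h x + (la * h x)\<^sup>2 / 2 \<le> exp (la * h x)"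
    using assms h_nonneg by (intro exp_lower_Taylor_quadratic) auto
  moreover have "0 \<le> la * h x" using assms h_nonneg by auto
  ultimately have "la\<^sup>2 * (h x)\<^sup>2 / 2 \<le> exp (la * h x)" by (simp add: power_mult_distrib)
  then show ?thesis using assms by (simp add: field_simps)
qed

text \<open>
  A Kahane type inequality, from the exponential moment at \<open>1 / (rad_mean + d)\<close>.
\<close>

lemma rad_second_moment:
  assumes A: "A = rad_mean + d" "A > 0"
  shows "(\<integral>\<^sup>+x. ennreal ((h x)\<^sup>2) \<partial>iid J rademacher) \<le> ennreal (2 * exp 34 * A\<^sup>2)"
proof -
  define la where "la = 1 / A"
  have la: "la > 0" using A by (simp add: la_def)
  have rm: "0 \<le> rad_mean" unfolding rad_mean_def by (rule Bochner_Integration.integral_nonneg) (rule h_nonneg)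
  have "(\<integral>\<^sup>+x. ennreal ((h x)\<^sup>2) \<partial>iid J rademacher) \<le> (\<integral>\<^sup>+x. ennreal (2 / la\<^sup>2) * ennreal (exp (la * h x)) \<partial>iid J rademacher)"
    by (intro nn_integral_mono, subst ennreal_mult'[symmetric], simp) (rule ennreal_leI[OF h_sq_le_exp[OF la]])
  also have "\<dots> = ennreal (2 / la\<^sup>2) * (\<integral>\<^sup>+x. ennreal (exp (la * h x)) \<partial>iid J rademacher)"
    by (rule nn_integral_cmult) measurable
  also have "\<dots> \<le> ennreal (2 / la\<^sup>2) * ennreal (exp (32 * la\<^sup>2 * d\<^sup>2 + 2 * la * rad_mean))"
    by (intro mult_left_mono rad_mgf(2)[OF la]) auto
  also have "\<dots> \<le> ennreal (2 / la\<^sup>2) * ennreal (exp 34)"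
  proof (intro mult_left_mono ennreal_leI, subst exp_le_cancel_iff)
    have "la * d \<le> 1" "la * rad_mean \<le> 1" using A rm d_nonneg by (auto simp: la_def field_simps)
    moreover have "(la * d)\<^sup>2 \<le> 1\<^sup>2" using calculation(1) la d_nonneg by (intro power_mono) auto
    ultimately show "32 * la\<^sup>2 * d\<^sup>2 + 2 * la * rad_mean \<le> 34" by (simp add: power_mult_distrib)
  qed auto
  also have "\<dots> = ennreal (2 * exp 34 * A\<^sup>2)"
    using A by (simp add: ennreal_mult'[symmetric] la_def power_divide field_simps)
  finally show ?thesis .
qed

lemma convex_vec_fun_h: "convex_vec_fun (\<lambda>x. ennreal (h x))"
  unfolding convex_vec_fun_def
proof (intro allI impI)
  fix x y and u v :: real assume uv: "0 \<le> u" "0 \<le> v" "u + v = 1"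
  have "ennreal (h (\<lambda>j. u * x j + v * y j)) \<le> ennreal (u * h x + v * h y)" by (intro ennreal_leI h_convex uv)
  also have "\<dots> = ennreal u * ennreal (h x) + ennreal v * ennreal (h y)"
    using uv h_nonneg by (subst ennreal_plus) (auto simp: ennreal_mult)
  finally show "ennreal (h (\<lambda>j. u * x j + v * y j)) \<le> ennreal u * ennreal (h x) + ennreal v * ennreal (h y)" .
qed

lemma convex_vec_fun_h_sq: "convex_vec_fun (\<lambda>x. ennreal ((h x)\<^sup>2))"
  unfolding convex_vec_fun_def
proof (intro allI impI)
  fix x y and u v :: real assume uv: "0 \<le> u" "0 \<le> v" "u + v = 1"
  have "(h (\<lambda>j. u * x j + v * y j))\<^sup>2 \<le> (u * h x + v * h y)\<^sup>2" by (intro power_mono h_convex uv h_nonneg)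
  also have "\<dots> \<le> u * (h x)\<^sup>2 + v * (h y)\<^sup>2"
  proof -
    have v: "v = 1 - u" using uv by simp
    have "u * (h x)\<^sup>2 + v * (h y)\<^sup>2 - (u * h x + v * h y)\<^sup>2 = u * v * (h x - h y)\<^sup>2"
      unfolding v by (simp add: power2_eq_square algebra_simps)
    moreover have "0 \<le> u * v * (h x - h y)\<^sup>2" using uv by simp
    ultimately show ?thesis by linarith
  qed
  finally have "ennreal ((h (\<lambda>j. u * x j + v * y j))\<^sup>2) \<le> ennreal (u * (h x)\<^sup>2 + v * (h y)\<^sup>2)" by (rule ennreal_leI)
  also have "\<dots> = ennreal u * ennreal ((h x)\<^sup>2) + ennreal v * ennreal ((h y)\<^sup>2)"
    using uv by (subst ennreal_plus) (auto simp: ennreal_mult)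
  finally show "ennreal ((h (\<lambda>j. u * x j + v * y j))\<^sup>2) \<le> ennreal u * ennreal ((h x)\<^sup>2) + ennreal v * ennreal ((h y)\<^sup>2)" .
qed

end

lemma gaussian_fourth_moment: "(\<integral>\<^sup>+z. ennreal (z ^ 4) \<partial>gaussian) = 3"
proof -
  have "(\<integral>\<^sup>+z. ennreal (z ^ 4) \<partial>gaussian) = ennreal (\<integral>z. z ^ 4 \<partial>gaussian)"
    using std_normal_distribution_even_moments(2)[of 2] by (intro nn_integral_eq_integral) auto
  also have "(\<integral>z. z ^ 4 \<partial>gaussian) = 3"
    using std_normal_distribution_even_moments(1)[of 2] by (simp add: fact_numeral)
  finally show ?thesis by simp
qed

text \<open>
  The 4-norm stands in for the largest of \<open>m\<close> gaussians; what matters below is that the mean of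
  its square grows like a power of \<open>m\<close> with exponent less than 1.
\<close>

lemma gaussian_vector_l4:
  assumes m: "m \<ge> 1"
  shows "(\<integral>\<^sup>+g. ennreal (sqrt (\<Sum>i\<in>{1..m}. (g i) ^ 4)) \<partial>iid {1..m} gaussian) \<le> ennreal (2 * sqrt (real m))"
proof -
  interpret g: prob_space gaussian by (rule prob_space_gaussian)
  interpret G: product_prob_space "\<lambda>_. gaussian" "{1..m}" by unfold_locales
  let ?s = "sqrt (real m)"
  have s: "?s > 0" "?s * ?s = real m" using m by auto
  have c: "(\<integral>\<^sup>+g. ennreal ((g i) ^ 4) \<partial>iid {1..m} gaussian) = 3" if "i \<in> {1..m}" for i
  proof -
    have "(\<integral>\<^sup>+g. ennreal ((g i) ^ 4) \<partial>iid {1..m} gaussian) = (\<integral>\<^sup>+z. ennreal (z ^ 4) \<partial>distr (iid {1..m} gaussian) gaussian (\<lambda>g. g i))"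
      using that by (intro nn_integral_distr[symmetric]) auto
    also have "\<dots> = 3" using that by (subst G.PiM_component) (auto simp: gaussian_fourth_moment)
    finally show ?thesis .
  qed
  have "(\<integral>\<^sup>+g. ennreal (sqrt (\<Sum>i\<in>{1..m}. (g i) ^ 4)) \<partial>iid {1..m} gaussian)
      \<le> (\<integral>\<^sup>+g. ennreal (1 / (2 * ?s)) * (\<Sum>i\<in>{1..m}. ennreal ((g i) ^ 4)) + ennreal (?s / 2) \<partial>iid {1..m} gaussian)"
  proof (rule nn_integral_mono)
    fix g :: "nat \<Rightarrow> real"
    define Y where "Y = (\<Sum>i\<in>{1..m}. (g i) ^ 4)"
    have Y: "Y \<ge> 0" by (auto simp: Y_def intro: sum_nonneg)
    have "2 * sqrt Y * ?s \<le> (sqrt Y)\<^sup>2 + ?s\<^sup>2" by (rule sum_squares_bound)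
    also have "\<dots> = Y + ?s * ?s" using Y by (simp add: power2_eq_square)
    finally have "sqrt Y \<le> 1 / (2 * ?s) * Y + ?s / 2" using s(1) by (simp add: field_simps)
    then have "ennreal (sqrt Y) \<le> ennreal (1 / (2 * ?s) * Y + ?s / 2)" by (rule ennreal_leI)
    also have "\<dots> = ennreal (1 / (2 * ?s)) * ennreal Y + ennreal (?s / 2)"
    proof -
      have "ennreal (1 / (2 * ?s) * Y) = ennreal (1 / (2 * ?s)) * ennreal Y" by (rule ennreal_mult) (use Y in auto)
      moreover have "ennreal (1 / (2 * ?s) * Y + ?s / 2) = ennreal (1 / (2 * ?s) * Y) + ennreal (?s / 2)"
        by (rule ennreal_plus) (use Y in auto)
      ultimately show ?thesis by (simp only:)
    qed
    also have "ennreal Y = (\<Sum>i\<in>{1..m}. ennreal ((g i) ^ 4))" unfolding Y_def by (rule sum_ennreal[symmetric]) auto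
    finally show "ennreal (sqrt (\<Sum>i\<in>{1..m}. (g i) ^ 4)) \<le> ennreal (1 / (2 * ?s)) * (\<Sum>i\<in>{1..m}. ennreal ((g i) ^ 4)) + ennreal (?s / 2)"
      unfolding Y_def .
  qed
  also have "\<dots> = ennreal (1 / (2 * ?s)) * (\<Sum>i\<in>{1..m}. \<integral>\<^sup>+g. ennreal ((g i) ^ 4) \<partial>iid {1..m} gaussian) + ennreal (?s / 2)"
  proof -
    have "(\<integral>\<^sup>+g. ennreal (1 / (2 * ?s)) * (\<Sum>i\<in>{1..m}. ennreal ((g i) ^ 4)) + ennreal (?s / 2) \<partial>iid {1..m} gaussian)
      = (\<integral>\<^sup>+g. ennreal (1 / (2 * ?s)) * (\<Sum>i\<in>{1..m}. ennreal ((g i) ^ 4)) \<partial>iid {1..m} gaussian) + (\<integral>\<^sup>+g. ennreal (?s / 2) \<partial>iid {1..m} gaussian)"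
      by (rule nn_integral_add) measurable
    also have "(\<integral>\<^sup>+g. ennreal (?s / 2) \<partial>iid {1..m} gaussian) = ennreal (?s / 2)"
      by (simp only: nn_integral_const G.P.emeasure_space_1 mult_1_right)
    also have "(\<integral>\<^sup>+g. ennreal (1 / (2 * ?s)) * (\<Sum>i\<in>{1..m}. ennreal ((g i) ^ 4)) \<partial>iid {1..m} gaussian)
       = ennreal (1 / (2 * ?s)) * (\<integral>\<^sup>+g. (\<Sum>i\<in>{1..m}. ennreal ((g i) ^ 4)) \<partial>iid {1..m} gaussian)"
      by (rule nn_integral_cmult) measurable
    also have "(\<integral>\<^sup>+g. (\<Sum>i\<in>{1..m}. ennreal ((g i) ^ 4)) \<partial>iid {1..m} gaussian)
       = (\<Sum>i\<in>{1..m}. \<integral>\<^sup>+g. ennreal ((g i) ^ 4) \<partial>iid {1..m} gaussian)"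
      by (rule nn_integral_sum) measurable
    finally show ?thesis .
  qed
  also have "\<dots> = ennreal (1 / (2 * ?s)) * ennreal (3 * real m) + ennreal (?s / 2)"
    using c by (simp add: ennreal_mult' ennreal_of_nat_eq_real_of_nat mult.commute)
  also have "\<dots> = ennreal (1 / (2 * ?s) * (3 * real m) + ?s / 2)"
  proof -
    have "ennreal (1 / (2 * ?s) * (3 * real m)) = ennreal (1 / (2 * ?s)) * ennreal (3 * real m)"
      by (rule ennreal_mult) auto
    moreover have "ennreal (1 / (2 * ?s) * (3 * real m) + ?s / 2) = ennreal (1 / (2 * ?s) * (3 * real m)) + ennreal (?s / 2)"
      by (rule ennreal_plus) auto
    ultimately show ?thesis by (simp only:)
  qed
  also have "1 / (2 * ?s) * (3 * real m) + ?s / 2 = 2 * ?s"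
    using s by (simp add: field_simps)
  finally show ?thesis .
qed

text \<open>
  Assign to every coordinate \<open>j\<close> a uniform label \<open>u j\<close> in \<open>{1..m}\<close> and a sign, and let \<open>x i\<close> be the vector
  of the signs with label \<open>i\<close>, which has the law of sparse signs for each \<open>i\<close>. The cotype inequality
  bounds the sum over \<open>i\<close> of the squared norms of the \<open>x i\<close> by the gaussian average of the squared norm of
  \<open>\<Sum>i. g i * x i\<close>, a vector of signs with the multipliers \<open>g (u j)\<close>. Replacing all of them by their maximum costs
  order \<open>sqrt m\<close>, while there are \<open>m\<close> terms on the left; so the second moment decreases like
  \<open>1 / sqrt m\<close>.
\<close>

lemma (in support_functional) sparse_second_moment:
  assumes cot: "\<And>x :: nat \<Rightarrow> nat \<Rightarrow> real. ennreal (\<Sum>i\<in>{1..m}. (h (x i))\<^sup>2)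
      \<le> ennreal (\<kappa>\<^sup>2) * (\<integral>\<^sup>+g. ennreal ((h (\<lambda>j. \<Sum>i\<in>{1..m}. g i * x i j))\<^sup>2) \<partial>iid {1..m} gaussian)"
    and m: "m \<ge> 1" and U: "U = measure_pmf (pmf_of_set {1..m})"
  shows "(\<integral>\<^sup>+x. ennreal ((h x)\<^sup>2) \<partial>iid J (sparse_rademacher U {1}))
     \<le> ennreal (2 * \<kappa>\<^sup>2 / sqrt (real m)) * (\<integral>\<^sup>+x. ennreal ((h x)\<^sup>2) \<partial>iid J rademacher)"
proof -
  have pU: "prob_space U" unfolding U by (rule measure_pmf.prob_space_axioms)
  have sU[measurable_cong]: "sets U = sets (count_space UNIV)" unfolding U by simp
  interpret U: prob_space U by (rule pU)
  have [measurable]: "indicat_real {i} \<in> borel_measurable (count_space (UNIV :: nat set))" for i by simp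
  let ?b = "rademacher \<Otimes>\<^sub>M U" and ?G = "iid {1..m} gaussian"
  have pb: "prob_space ?b" by (rule prob_space_pair_rademacher[OF pU])
  have pB: "prob_space (iid J ?b)" by (rule prob_space_PiM) (rule pb)
  have pG: "prob_space ?G" by (rule prob_space_PiM) (rule prob_space_gaussian)
  interpret B: prob_space "iid J ?b" by (rule pB)
  interpret G: prob_space ?G by (rule pG)
  interpret BG: pair_prob_space "iid J ?b" ?G by unfold_locales
  let ?F = "\<lambda>\<rho>. \<integral>\<^sup>+x. ennreal ((h x)\<^sup>2) \<partial>iid J \<rho>"
  have dom: "?F \<alpha> \<le> ?F \<beta>" if "prob_space \<alpha>" "sets \<alpha> = sets borel" "prob_space \<beta>" "sets \<beta> = sets borel" "convex_le \<alpha> \<beta>" for \<alpha> \<beta>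
    by (rule convex_le_PiM[OF finite_J that _ convex_vec_fun_h_sq]) auto
  have mp: "measure U {i} = 1 / real m" if "i \<in> {1..m}" for i
    using that m unfolding U by (simp add: measure_pmf_single)
  have "of_nat m * ?F (sparse_rademacher U {1}) = (\<Sum>i\<in>{1..m}. ?F (sparse_rademacher U {1}))" by simp
  also have "\<dots> \<le> (\<Sum>i\<in>{1..m}. ?F (sparse_rademacher U {i}))"
    by (intro sum_mono dom convex_le_sparse_rademacher prob_space_sparse_rademacher pU) (auto simp: sU mp m)
  also have "\<dots> = (\<Sum>i\<in>{1..m}. \<integral>\<^sup>+y. ennreal ((h (\<lambda>j. fst (y j) * indicator {i} (snd (y j))))\<^sup>2) \<partial>iid J ?b)"
  proof (intro sum.cong refl)
    fix i
    have "(\<integral>\<^sup>+y. ennreal ((h (\<lambda>j\<in>J. (\<lambda>(e, x). e * indicator {i} x) (y j)))\<^sup>2) \<partial>iid J ?b) = ?F (sparse_rademacher U {i})"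
      unfolding sparse_rademacher_def
    proof (rule nn_integral_PiM_map[OF finite_J pb])
      have "(\<lambda>p. fst p * indicator {i} (snd p) :: real) \<in> borel_measurable ?b"
        by (intro borel_measurable_times measurable_compose[OF measurable_snd]) (auto simp: sU)
      then show "(\<lambda>(e, x). e * indicator {i} x :: real) \<in> borel_measurable ?b" by (simp add: case_prod_beta)
      show "(\<lambda>x. ennreal ((h x)\<^sup>2)) \<in> borel_measurable (Pi\<^sub>M J (\<lambda>_. borel))" by measurable
    qed
    then show "?F (sparse_rademacher U {i}) = (\<integral>\<^sup>+y. ennreal ((h (\<lambda>j. fst (y j) * indicator {i} (snd (y j))))\<^sup>2) \<partial>iid J ?b)"
      by (simp add: case_prod_beta)
  qed
  also have "\<dots> = (\<integral>\<^sup>+y. ennreal (\<Sum>i\<in>{1..m}. (h (\<lambda>j. fst (y j) * indicator {i} (snd (y j))))\<^sup>2) \<partial>iid J ?b)"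
  proof -
    have "(\<integral>\<^sup>+y. (\<Sum>i\<in>{1..m}. ennreal ((h (\<lambda>j. fst (y j) * indicator {i} (snd (y j))))\<^sup>2)) \<partial>iid J ?b)
       = (\<Sum>i\<in>{1..m}. \<integral>\<^sup>+y. ennreal ((h (\<lambda>j. fst (y j) * indicator {i} (snd (y j))))\<^sup>2) \<partial>iid J ?b)"
      by (rule nn_integral_sum) measurable
    then show ?thesis by (simp add: sum_ennreal)
  qed
  also have "\<dots> \<le> (\<integral>\<^sup>+y. ennreal (\<kappa>\<^sup>2) * (\<integral>\<^sup>+g. ennreal ((h (\<lambda>j. \<Sum>i\<in>{1..m}. g i * (fst (y j) * indicator {i} (snd (y j)))))\<^sup>2) \<partial>?G) \<partial>iid J ?b)"
    by (intro nn_integral_mono cot)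
  also have "\<dots> = ennreal (\<kappa>\<^sup>2) * (\<integral>\<^sup>+y. (\<integral>\<^sup>+g. ennreal ((h (\<lambda>j. \<Sum>i\<in>{1..m}. g i * (fst (y j) * indicator {i} (snd (y j)))))\<^sup>2) \<partial>?G) \<partial>iid J ?b)"
    by (rule nn_integral_cmult) measurable
  also have "(\<integral>\<^sup>+y. (\<integral>\<^sup>+g. ennreal ((h (\<lambda>j. \<Sum>i\<in>{1..m}. g i * (fst (y j) * indicator {i} (snd (y j)))))\<^sup>2) \<partial>?G) \<partial>iid J ?b)
     = (\<integral>\<^sup>+g. (\<integral>\<^sup>+y. ennreal ((h (\<lambda>j. \<Sum>i\<in>{1..m}. g i * (fst (y j) * indicator {i} (snd (y j)))))\<^sup>2) \<partial>iid J ?b) \<partial>?G)"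
    by (rule BG.Fubini'[symmetric]) measurable
  also have "\<dots> \<le> (\<integral>\<^sup>+g. ennreal (sqrt (\<Sum>i\<in>{1..m}. (g i) ^ 4)) * ?F rademacher \<partial>?G)"
  proof (rule nn_integral_mono)
    fix g :: "nat \<Rightarrow> real"
    define w where "w = (\<lambda>u. \<Sum>i\<in>{1..m}. g i * indicator {i} u)"
    define b where "b = sqrt (sqrt (\<Sum>i\<in>{1..m}. (g i) ^ 4))"
    have b0: "b \<ge> 0" "b\<^sup>2 = sqrt (\<Sum>i\<in>{1..m}. (g i) ^ 4)" by (auto simp: b_def intro!: sum_nonneg)
    have wb: "\<bar>w u\<bar> \<le> b" for u
    proof (cases "u \<in> {1..m}")
      case True
      have "w u = g u" unfolding w_def using True by (simp add: indicator_def if_distrib[where f="\<lambda>x. _ * x"] cong: if_cong)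
      moreover have "\<bar>g u\<bar> = sqrt (sqrt ((g u) ^ 4))"
      proof -
        have "sqrt ((g u) ^ 4) = (g u)\<^sup>2" by (rule real_sqrt_unique) auto
        then show ?thesis by simp
      qed
      moreover have "(g u) ^ 4 \<le> (\<Sum>i\<in>{1..m}. (g i) ^ 4)" using True by (intro member_le_sum) auto
      ultimately show ?thesis by (simp add: b_def)
    next
      case False
      then have "w u = 0" unfolding w_def by (intro sum.neutral) (auto simp: indicator_def)
      then show ?thesis using b0 by simp
    qed
    have [measurable]: "w \<in> borel_measurable U" unfolding w_def by measurable
    have "(\<integral>\<^sup>+y. ennreal ((h (\<lambda>j. \<Sum>i\<in>{1..m}. g i * (fst (y j) * indicator {i} (snd (y j)))))\<^sup>2) \<partial>iid J ?b)
        = (\<integral>\<^sup>+y. ennreal ((h (\<lambda>j\<in>J. (\<lambda>(e, u). e * w u) (y j)))\<^sup>2) \<partial>iid J ?b)"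
    proof -
      have "(\<Sum>i\<in>{1..m}. g i * (a * indicator {i} u)) = a * w u" for a u
        unfolding w_def sum_distrib_left by (intro sum.cong refl) simp
      then show ?thesis by (simp only: case_prod_beta h_restrict)
    qed
    also have "\<dots> = ?F (distr ?b borel (\<lambda>(e, u). e * w u))"
      by (rule nn_integral_PiM_map[OF finite_J pb]) measurable
    also have "\<dots> \<le> ?F (distr ?b borel (\<lambda>(e, u). e * b))"
      by (intro dom convex_le_rademacher_scaled[OF pU] wb prob_space.prob_space_distr[OF pb]) auto
    also have "distr ?b borel (\<lambda>(e, u). e * b) = distr rademacher borel (\<lambda>e. e * b)"
    proof (rule distr_eqI_nn_integral)
      fix \<Phi> :: "real \<Rightarrow> ennreal" assume [measurable]: "\<Phi> \<in> borel_measurable borel"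
      show "(\<integral>\<^sup>+p. \<Phi> (case p of (e, u) \<Rightarrow> e * b) \<partial>?b) = (\<integral>\<^sup>+e. \<Phi> (e * b) \<partial>rademacher)"
        by (subst nn_integral_rademacher_pair[OF pU], measurable) (simp add: nn_integral_rademacher U.emeasure_space_1)
    qed auto
    also have "?F (distr rademacher borel (\<lambda>e. e * b)) = (\<integral>\<^sup>+x. ennreal ((h (\<lambda>j\<in>J. x j * b))\<^sup>2) \<partial>iid J rademacher)"
      by (rule nn_integral_PiM_map[OF finite_J prob_space_rademacher, symmetric]) measurable
    also have "\<dots> = (\<integral>\<^sup>+x. ennreal (b\<^sup>2) * ennreal ((h x)\<^sup>2) \<partial>iid J rademacher)"
      by (intro nn_integral_cong) (simp add: mult.commute[of _ b] h_scale power_mult_distrib ennreal_mult)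
    also have "\<dots> = ennreal (b\<^sup>2) * ?F rademacher" by (rule nn_integral_cmult) measurable
    finally show "(\<integral>\<^sup>+y. ennreal ((h (\<lambda>j. \<Sum>i\<in>{1..m}. g i * (fst (y j) * indicator {i} (snd (y j)))))\<^sup>2) \<partial>iid J ?b)
       \<le> ennreal (sqrt (\<Sum>i\<in>{1..m}. (g i) ^ 4)) * ?F rademacher" unfolding b0 .
  qed
  also have "\<dots> = (\<integral>\<^sup>+g. ennreal (sqrt (\<Sum>i\<in>{1..m}. (g i) ^ 4)) \<partial>?G) * ?F rademacher"
    by (rule nn_integral_multc) measurable
  also have "\<dots> \<le> ennreal (2 * sqrt (real m)) * ?F rademacher"
    by (intro mult_right_mono gaussian_vector_l4 m) auto
  finally have main: "of_nat m * ?F (sparse_rademacher U {1}) \<le> ennreal (\<kappa>\<^sup>2) * (ennreal (2 * sqrt (real m)) * ?F rademacher)"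
    by (simp add: mult_left_mono)
  have "?F (sparse_rademacher U {1}) = ennreal (1 / real m) * (of_nat m * ?F (sparse_rademacher U {1}))"
    using m by (simp add: mult.assoc[symmetric] ennreal_of_nat_eq_real_of_nat ennreal_mult'[symmetric])
  also have "\<dots> \<le> ennreal (1 / real m) * (ennreal (\<kappa>\<^sup>2) * (ennreal (2 * sqrt (real m)) * ?F rademacher))"
    by (intro mult_left_mono main) auto
  also have "\<dots> = ennreal (1 / real m * \<kappa>\<^sup>2 * (2 * sqrt (real m))) * ?F rademacher"
  proof -
    have "ennreal (1 / real m * \<kappa>\<^sup>2 * (2 * sqrt (real m))) = ennreal (1 / real m * \<kappa>\<^sup>2) * ennreal (2 * sqrt (real m))"
      by (rule ennreal_mult) auto
    moreover have "ennreal (1 / real m * \<kappa>\<^sup>2) = ennreal (1 / real m) * ennreal (\<kappa>\<^sup>2)"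
      by (rule ennreal_mult) auto
    ultimately show ?thesis by (simp only: mult.assoc)
  qed
  also have "1 / real m * \<kappa>\<^sup>2 * (2 * sqrt (real m)) = 2 * \<kappa>\<^sup>2 / sqrt (real m)"
  proof -
    have "real m = sqrt (real m) * sqrt (real m)" by simp
    then show ?thesis using m by (simp add: field_simps)
  qed
  finally show ?thesis .
qed

context support_functional begin

text \<open>
  The number of labels \<open>16 ^ l\<close> matches the gaussian tail at level \<open>3 * l\<close>, and the bounds are summable
  in \<open>l\<close>.
\<close>

lemma sparse_first_moment:
  assumes cot: "\<And>m (x :: nat \<Rightarrow> nat \<Rightarrow> real). ennreal (\<Sum>i\<in>{1..m}. (h (x i))\<^sup>2)
      \<le> ennreal (\<kappa>\<^sup>2) * (\<integral>\<^sup>+g. ennreal ((h (\<lambda>j. \<Sum>i\<in>{1..m}. g i * x i j))\<^sup>2) \<partial>iid {1..m} gaussian)"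
    and k: "\<kappa> > 0" and A: "A = rad_mean + d" "A > 0"
  shows "(\<integral>\<^sup>+x. ennreal (h x) \<partial>iid J (sparse_rademacher (measure_pmf (pmf_of_set {1..16 ^ l :: nat})) {1}))
     \<le> ennreal (2 * \<kappa> * exp 17 * A * (1/2) ^ l)"
proof -
  define m :: nat where "m = 16 ^ l"
  define U where "U = measure_pmf (pmf_of_set {1..m})"
  define a where "a = 2 * \<kappa> * exp 17 * A * (1/2) ^ l"
  have a: "a > 0" using k A by (simp add: a_def)
  have pU: "prob_space U" unfolding U_def by (rule measure_pmf.prob_space_axioms)
  have pt: "prob_space (sparse_rademacher U {1})" by (rule prob_space_sparse_rademacher[OF pU]) (simp add: U_def)
  let ?P = "iid J (sparse_rademacher U {1})"
  interpret P: prob_space ?P by (rule prob_space_PiM) (rule pt)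
  have "(\<integral>\<^sup>+x. ennreal ((h x)\<^sup>2) \<partial>?P) \<le> ennreal (2 * \<kappa>\<^sup>2 / sqrt (real m)) * (\<integral>\<^sup>+x. ennreal ((h x)\<^sup>2) \<partial>iid J rademacher)"
    by (rule sparse_second_moment[OF cot _ U_def]) (simp add: m_def)
  also have "\<dots> \<le> ennreal (2 * \<kappa>\<^sup>2 / sqrt (real m)) * ennreal (2 * exp 34 * A\<^sup>2)"
    by (intro mult_left_mono rad_second_moment[OF A]) auto
  also have "\<dots> = ennreal (2 * \<kappa>\<^sup>2 / sqrt (real m) * (2 * exp 34 * A\<^sup>2))"
    by (rule ennreal_mult[symmetric]) auto
  also have "2 * \<kappa>\<^sup>2 / sqrt (real m) * (2 * exp 34 * A\<^sup>2) = a\<^sup>2"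
  proof -
    have "sqrt (real m) = 4 ^ l"
    proof (rule real_sqrt_unique)
      have "((4::real) ^ l)\<^sup>2 = (4\<^sup>2) ^ l" by (simp only: power_mult[symmetric] mult.commute)
      then show "((4::real) ^ l)\<^sup>2 = real m" by (simp add: m_def)
    qed simp
    moreover have "((1/2 :: real) ^ l)\<^sup>2 = 1 / 4 ^ l"
    proof -
      have "((1/2 :: real) ^ l)\<^sup>2 = ((1/2)\<^sup>2) ^ l" by (simp only: power_mult[symmetric] mult.commute)
      then show ?thesis by (simp add: power_divide)
    qed
    moreover have "(exp 17 :: real)\<^sup>2 = exp 34" by (simp add: exp_double[symmetric])
    ultimately show ?thesis by (simp add: a_def power_mult_distrib)
  qed
  finally have F2: "(\<integral>\<^sup>+x. ennreal ((h x)\<^sup>2) \<partial>?P) \<le> ennreal (a\<^sup>2)" .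
  have "(\<integral>\<^sup>+x. ennreal (h x) \<partial>?P) \<le> (\<integral>\<^sup>+x. ennreal (1 / (2 * a)) * ennreal ((h x)\<^sup>2) + ennreal (a / 2) \<partial>?P)"
  proof (rule nn_integral_mono)
    fix x
    have "2 * h x * a \<le> (h x)\<^sup>2 + a\<^sup>2" by (rule sum_squares_bound)
    then have "h x \<le> 1 / (2 * a) * (h x)\<^sup>2 + a / 2" using a by (simp add: field_simps power2_eq_square)
    then have "ennreal (h x) \<le> ennreal (1 / (2 * a) * (h x)\<^sup>2 + a / 2)" by (rule ennreal_leI)
    also have "\<dots> = ennreal (1 / (2 * a) * (h x)\<^sup>2) + ennreal (a / 2)" using a by (intro ennreal_plus) auto
    also have "ennreal (1 / (2 * a) * (h x)\<^sup>2) = ennreal (1 / (2 * a)) * ennreal ((h x)\<^sup>2)" using a by (intro ennreal_mult) auto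
    finally show "ennreal (h x) \<le> ennreal (1 / (2 * a)) * ennreal ((h x)\<^sup>2) + ennreal (a / 2)" .
  qed
  also have "\<dots> = (\<integral>\<^sup>+x. ennreal (1 / (2 * a)) * ennreal ((h x)\<^sup>2) \<partial>?P) + (\<integral>\<^sup>+x. ennreal (a / 2) \<partial>?P)"
    by (rule nn_integral_add) measurable
  also have "(\<integral>\<^sup>+x. ennreal (a / 2) \<partial>?P) = ennreal (a / 2)" by (simp only: nn_integral_const P.emeasure_space_1 mult_1_right)
  also have "(\<integral>\<^sup>+x. ennreal (1 / (2 * a)) * ennreal ((h x)\<^sup>2) \<partial>?P) = ennreal (1 / (2 * a)) * (\<integral>\<^sup>+x. ennreal ((h x)\<^sup>2) \<partial>?P)"
    by (rule nn_integral_cmult) measurable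
  also have "\<dots> + ennreal (a / 2) \<le> ennreal (1 / (2 * a)) * ennreal (a\<^sup>2) + ennreal (a / 2)"
    by (intro add_right_mono mult_left_mono F2) auto
  also have "\<dots> = ennreal (1 / (2 * a) * a\<^sup>2) + ennreal (a / 2)"
    using a by (intro arg_cong2[where f="(+)"] refl ennreal_mult[symmetric]) auto
  also have "\<dots> = ennreal (1 / (2 * a) * a\<^sup>2 + a / 2)"
    using a by (intro ennreal_plus[symmetric]) auto
  also have "1 / (2 * a) * a\<^sup>2 + a / 2 = a" using a by (simp add: power2_eq_square)
  finally show ?thesis unfolding a_def U_def m_def .
qed

text \<open>
  The level \<open>\<bar>g\<bar>\<close>, rounded up to a multiple of \<open>3\<close>, is \<open>3\<close> times the number of \<open>l\<close> with \<open>3 * l < \<bar>g\<bar>\<close>.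
\<close>

lemma h_le_sum_levels:
  "ennreal (h (\<lambda>j. e j * (3 * real (nat \<lceil>\<bar>g j\<bar> / 3\<rceil>)))) \<le> (\<Sum>l. ennreal 3 * ennreal (h (\<lambda>j. e j * indicator {g. 3 * real l < \<bar>g\<bar>} (g j))))"
proof -
  define N where "N j = nat \<lceil>\<bar>g j\<bar> / 3\<rceil>" for j
  define K where "K = (\<Sum>j\<in>J. N j)"
  have lN: "l < N j \<longleftrightarrow> 3 * real l < \<bar>g j\<bar>" for l j
  proof -
    have "l < N j \<longleftrightarrow> int l < \<lceil>\<bar>g j\<bar> / 3\<rceil>" unfolding N_def by linarith
    also have "\<dots> \<longleftrightarrow> 3 * real l < \<bar>g j\<bar>" by (simp add: less_ceiling_iff field_simps)
    finally show ?thesis .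
  qed
  have NK: "N j \<le> K" if "j \<in> J" for j unfolding K_def by (rule member_le_sum) (use that finite_J in auto)
  have "h (\<lambda>j. e j * (3 * real (N j))) = h (\<lambda>j. \<Sum>l<K. 3 * (e j * indicator {g. 3 * real l < \<bar>g\<bar>} (g j)))"
  proof (rule h_cong)
    fix j assume j: "j \<in> J"
    have "(\<Sum>l<K. 3 * (e j * indicator {g. 3 * real l < \<bar>g\<bar>} (g j))) = (\<Sum>l<K. 3 * e j * (if l < N j then 1 else 0))"
      by (intro sum.cong refl) (auto simp: lN indicator_def)
    also have "\<dots> = 3 * e j * real (card ({..<K} \<inter> {l. l < N j}))" by (simp add: sum_distrib_left[symmetric] sum.If_cases)
    also have "{..<K} \<inter> {l. l < N j} = {..<N j}" using NK[OF j] by auto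
    finally show "e j * (3 * real (N j)) = (\<Sum>l<K. 3 * (e j * indicator {g. 3 * real l < \<bar>g\<bar>} (g j)))" by simp
  qed
  also have "\<dots> \<le> (\<Sum>l<K. h (\<lambda>j. 3 * (e j * indicator {g. 3 * real l < \<bar>g\<bar>} (g j))))" by (rule h_sum) simp
  also have "\<dots> = (\<Sum>l<K. 3 * h (\<lambda>j. e j * indicator {g. 3 * real l < \<bar>g\<bar>} (g j)))" by (simp only: h_scale abs_numeral)
  finally have "ennreal (h (\<lambda>j. e j * (3 * real (N j)))) \<le> ennreal (\<Sum>l<K. 3 * h (\<lambda>j. e j * indicator {g. 3 * real l < \<bar>g\<bar>} (g j)))"
    by (rule ennreal_leI)
  also have "\<dots> = (\<Sum>l<K. ennreal (3 * h (\<lambda>j. e j * indicator {g. 3 * real l < \<bar>g\<bar>} (g j))))"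
    using h_nonneg by (intro sum_ennreal[symmetric]) auto
  also have "\<dots> = (\<Sum>l<K. ennreal 3 * ennreal (h (\<lambda>j. e j * indicator {g. 3 * real l < \<bar>g\<bar>} (g j))))"
    using h_nonneg by (intro sum.cong refl ennreal_mult) auto
  also have "\<dots> \<le> (\<Sum>l. ennreal 3 * ennreal (h (\<lambda>j. e j * indicator {g. 3 * real l < \<bar>g\<bar>} (g j))))"
    by (rule sum_le_suminf) auto
  finally show ?thesis unfolding N_def .
qed

text \<open>
  A gaussian vector is a sum over levels of vectors of sparse signs, and cotype 2 makes the
  contribution of the rare high levels summable. The rounding of \<open>\<bar>g\<bar>\<close> takes place in the convex order,
  because \<open>h\<close> itself is not monotone in the moduli of the coordinates.
\<close>

lemma gauss_mean_le:
  assumes cot: "\<And>m (x :: nat \<Rightarrow> nat \<Rightarrow> real). ennreal (\<Sum>i\<in>{1..m}. (h (x i))\<^sup>2)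
      \<le> ennreal (\<kappa>\<^sup>2) * (\<integral>\<^sup>+g. ennreal ((h (\<lambda>j. \<Sum>i\<in>{1..m}. g i * x i j))\<^sup>2) \<partial>iid {1..m} gaussian)"
    and k: "\<kappa> > 0"
  shows "gauss_mean \<le> 12 * \<kappa> * exp 17 * (rad_mean + d)"
proof (cases "rad_mean + d = 0")
  case True
  have "0 \<le> rad_mean" unfolding rad_mean_def by (rule Bochner_Integration.integral_nonneg) (rule h_nonneg)
  then have "d = 0" using True d_nonneg by linarith
  then have "h x = 0" for x using h_le_L2[of x] h_nonneg[of x] by simp
  then show ?thesis using True by (simp add: gauss_mean_def)
next
  case False
  define A where "A = rad_mean + d"
  have "0 \<le> rad_mean" unfolding rad_mean_def by (rule Bochner_Integration.integral_nonneg) (rule h_nonneg)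
  then have A: "A = rad_mean + d" "A > 0" using False d_nonneg by (auto simp: A_def)
  let ?b = "rademacher \<Otimes>\<^sub>M gaussian"
  let ?S = "\<lambda>g::real. 3 * real (nat \<lceil>\<bar>g\<bar> / 3\<rceil>)"
  let ?A = "\<lambda>l. {g::real. 3 * real l < \<bar>g\<bar>}"
  have pb: "prob_space ?b" by (rule prob_space_pair_rademacher[OF prob_space_gaussian])
  have Sg: "\<bar>\<bar>g\<bar>\<bar> \<le> ?S g" for g
  proof -
    have "\<bar>g\<bar> / 3 \<le> real (nat \<lceil>\<bar>g\<bar> / 3\<rceil>)" by (rule real_nat_ceiling_ge)
    then show ?thesis by linarith
  qed
  have [measurable]: "?S \<in> borel_measurable borel" by measurable
  have [measurable]: "?A l \<in> sets borel" for l by measurable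
  have "ennreal gauss_mean = (\<integral>\<^sup>+x. ennreal (h x) \<partial>iid J gaussian)"
    unfolding gauss_mean_def by (rule nn_integral_eq_integral[OF gauss_mgf(1), symmetric]) (auto intro: h_nonneg)
  also have "\<dots> = (\<integral>\<^sup>+x. ennreal (h x) \<partial>iid J (distr ?b borel (\<lambda>(e, g). e * \<bar>g\<bar>)))"
    by (simp only: symmetric_sign_law[OF prob_space_gaussian _ symmetric_gaussian] sets_density sets_lborel)
  also have "\<dots> \<le> (\<integral>\<^sup>+x. ennreal (h x) \<partial>iid J (distr ?b borel (\<lambda>(e, g). e * ?S g)))"
    by (rule convex_le_PiM[OF finite_J _ _ _ _ convex_le_rademacher_scaled[OF prob_space_gaussian _ _ Sg] _ convex_vec_fun_h])
       (auto intro!: prob_space.prob_space_distr[OF pb])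
  also have "\<dots> = (\<integral>\<^sup>+y. ennreal (h (\<lambda>j\<in>J. (\<lambda>(e, g). e * ?S g) (y j))) \<partial>iid J ?b)"
    by (rule nn_integral_PiM_map[OF finite_J pb, symmetric]) measurable
  also have "\<dots> = (\<integral>\<^sup>+y. ennreal (h (\<lambda>j. fst (y j) * ?S (snd (y j)))) \<partial>iid J ?b)"
    by (simp only: h_restrict case_prod_beta)
  also have "\<dots> \<le> (\<integral>\<^sup>+y. (\<Sum>l. ennreal 3 * ennreal (h (\<lambda>j. fst (y j) * indicator (?A l) (snd (y j))))) \<partial>iid J ?b)"
    by (intro nn_integral_mono h_le_sum_levels)
  also have "\<dots> = (\<Sum>l. \<integral>\<^sup>+y. ennreal 3 * ennreal (h (\<lambda>j. fst (y j) * indicator (?A l) (snd (y j)))) \<partial>iid J ?b)"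
    by (rule nn_integral_suminf) measurable
  also have "\<dots> \<le> (\<Sum>l. ennreal (6 * \<kappa> * exp 17 * A * (1/2) ^ l))"
  proof (intro suminf_le summableI)
    fix l
    define U where "U = measure_pmf (pmf_of_set {1..16 ^ l :: nat})"
    have pU: "prob_space U" unfolding U_def by (rule measure_pmf.prob_space_axioms)
    have U1: "measure U {1} = 1 / 16 ^ l" unfolding U_def by (simp add: measure_pmf_single)
    have "(\<integral>\<^sup>+y. ennreal 3 * ennreal (h (\<lambda>j. fst (y j) * indicator (?A l) (snd (y j)))) \<partial>iid J ?b)
       = ennreal 3 * (\<integral>\<^sup>+y. ennreal (h (\<lambda>j. fst (y j) * indicator (?A l) (snd (y j)))) \<partial>iid J ?b)"
      by (rule nn_integral_cmult) measurable
    also have "(\<integral>\<^sup>+y. ennreal (h (\<lambda>j. fst (y j) * indicator (?A l) (snd (y j)))) \<partial>iid J ?b)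
       = (\<integral>\<^sup>+y. ennreal (h (\<lambda>j\<in>J. (\<lambda>(e, g). e * indicator (?A l) g) (y j))) \<partial>iid J ?b)"
      by (simp only: h_restrict case_prod_beta)
    also have "\<dots> = (\<integral>\<^sup>+x. ennreal (h x) \<partial>iid J (sparse_rademacher gaussian (?A l)))"
      unfolding sparse_rademacher_def by (rule nn_integral_PiM_map[OF finite_J pb]) measurable
    also have "ennreal 3 * \<dots> \<le> ennreal 3 * (\<integral>\<^sup>+x. ennreal (h x) \<partial>iid J (sparse_rademacher U {1}))"
    proof (rule mult_left_mono[OF convex_le_PiM[OF finite_J _ _ _ _ _ _ convex_vec_fun_h]])
      show "convex_le (sparse_rademacher gaussian (?A l)) (sparse_rademacher U {1})"
        by (rule convex_le_sparse_rademacher[OF prob_space_gaussian _ pU]) (use gaussian_tail_geometric[of l] U1 in \<open>auto simp: U_def\<close>)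
      show "prob_space (sparse_rademacher gaussian (?A l))" by (rule prob_space_sparse_rademacher[OF prob_space_gaussian]) auto
      show "prob_space (sparse_rademacher U {1})" by (rule prob_space_sparse_rademacher[OF pU]) (auto simp: U_def)
    qed auto
    also have "\<dots> \<le> ennreal 3 * ennreal (2 * \<kappa> * exp 17 * A * (1/2) ^ l)"
      unfolding U_def by (rule mult_left_mono[OF sparse_first_moment[OF cot k A]]) simp
    also have "\<dots> = ennreal (3 * (2 * \<kappa> * exp 17 * A * (1/2) ^ l))"
      using k A by (intro ennreal_mult[symmetric]) auto
    also have "3 * (2 * \<kappa> * exp 17 * A * (1/2) ^ l) = 6 * \<kappa> * exp 17 * A * (1/2) ^ l" by simp
    finally show "(\<integral>\<^sup>+y. ennreal 3 * ennreal (h (\<lambda>j. fst (y j) * indicator (?A l) (snd (y j)))) \<partial>iid J ?b)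
      \<le> ennreal (6 * \<kappa> * exp 17 * A * (1/2) ^ l)" .
  qed
  also have "\<dots> = ennreal (\<Sum>l. 6 * \<kappa> * exp 17 * A * (1/2) ^ l)"
    using k A by (intro suminf_ennreal2 summable_mult summable_geometric) auto
  also have "(\<Sum>l. 6 * \<kappa> * exp 17 * A * (1/2) ^ l) = 12 * \<kappa> * exp 17 * A"
    by (subst suminf_mult) (auto intro!: summable_geometric simp: suminf_geometric)
  finally have "ennreal gauss_mean \<le> ennreal (12 * \<kappa> * exp 17 * A)" .
  then show ?thesis using k A by (subst (asm) ennreal_le_iff) (auto simp: A_def)
qed

end

section \<open>Nets and random seminorms\<close>

lemma L2_set_scale: "L2_set (\<lambda>i. c * f i) I = \<bar>c\<bar> * L2_set f I"
proof (cases "finite I")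
  case True
  have "L2_set (\<lambda>i. c * f i) I = sqrt (c\<^sup>2 * (\<Sum>i\<in>I. (f i)\<^sup>2))"
    by (simp add: L2_set_def power_mult_distrib sum_distrib_left)
  then show ?thesis by (simp add: L2_set_def real_sqrt_mult)
qed simp

lemma L2_set_sq: "(L2_set f I)\<^sup>2 = (\<Sum>i\<in>I. (f i)\<^sup>2)"
  by (simp add: L2_set_def sum_nonneg)

lemma sum_half_power_int: "(\<Sum>x\<in>{- int k..int k}. (1/2 :: real) ^ nat \<bar>x\<bar>) = 3 - 2 * (1/2) ^ k"
proof (induction k)
  case (Suc k)
  have "{- int (Suc k)..int (Suc k)} = insert (int (Suc k)) (insert (- int (Suc k)) {- int k..int k})" by auto
  then have "(\<Sum>x\<in>{- int (Suc k)..int (Suc k)}. (1/2 :: real) ^ nat \<bar>x\<bar>)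
    = (1/2) ^ Suc k + ((1/2) ^ Suc k + (\<Sum>x\<in>{- int k..int k}. (1/2 :: real) ^ nat \<bar>x\<bar>))"
    by (simp add: nat_add_distrib del: of_nat_Suc)
  then show ?case using Suc by simp
qed simp

lemma sum_gauss_int_le: "(\<Sum>x\<in>{- int k..int k}. exp (- (real_of_int x)\<^sup>2)) \<le> 3"
proof -
  have "exp (- (real_of_int x)\<^sup>2) \<le> (1/2) ^ nat \<bar>x\<bar>" for x
  proof -
    have "\<bar>x\<bar> \<le> x\<^sup>2"
    proof (cases "x = 0")
      case False
      then have "\<bar>x\<bar> * 1 \<le> \<bar>x\<bar> * \<bar>x\<bar>" by (intro mult_left_mono) auto
      then show ?thesis by (simp add: power2_eq_square)
    qed simp
    then have "real_of_int \<bar>x\<bar> \<le> real_of_int (x\<^sup>2)" by (rule of_int_le_iff[THEN iffD2])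
    then have "real (nat \<bar>x\<bar>) \<le> (real_of_int x)\<^sup>2" by simp
    then have "exp (- (real_of_int x)\<^sup>2) \<le> exp (real (nat \<bar>x\<bar>) * (-1))" by simp
    also have "\<dots> = exp (- 1) ^ nat \<bar>x\<bar>" by (rule exp_of_nat_mult)
    also have "\<dots> \<le> (1/2) ^ nat \<bar>x\<bar>"
    proof (rule power_mono)
      have "2 \<le> exp (1 :: real)" using exp_ge_add_one_self[of 1] by simp
      then show "exp (- 1 :: real) \<le> 1/2" by (simp add: exp_minus field_simps)
    qed simp
    finally show ?thesis .
  qed
  then have "(\<Sum>x\<in>{- int k..int k}. exp (- (real_of_int x)\<^sup>2)) \<le> (\<Sum>x\<in>{- int k..int k}. (1/2 :: real) ^ nat \<bar>x\<bar>)"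
    by (rule sum_mono)
  also have "\<dots> \<le> 3" unfolding sum_half_power_int by simp
  finally show ?thesis .
qed

text \<open>
  Each lattice point is counted with the weight \<open>exp (S - \<Sum>i\<in>I. (z i)\<^sup>2) \<ge> 1\<close>, and the sum of the
  weights factorises.
\<close>

lemma card_lattice_points:
  fixes I :: "'i set" and S :: real
  assumes I: "finite I"
  defines "Z \<equiv> {z \<in> PiE I (\<lambda>_. UNIV :: int set). (\<Sum>i\<in>I. (real_of_int (z i))\<^sup>2) \<le> S}"
  shows "finite Z" "real (card Z) \<le> exp S * 3 ^ card I"
proof -
  obtain k :: nat where k: "S \<le> real k" using real_arch_simple by blast
  have sub: "Z \<subseteq> PiE I (\<lambda>_. {- int k..int k})"
  proof (intro subsetI PiE_I)
    fix z i assume z: "z \<in> Z" and i: "i \<in> I"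
    have "(real_of_int (z i))\<^sup>2 \<le> (\<Sum>i\<in>I. (real_of_int (z i))\<^sup>2)" using i I by (intro member_le_sum) auto
    also have "\<dots> \<le> real k" using z k by (auto simp: Z_def)
    also have "\<dots> \<le> (real k)\<^sup>2" by (cases k) (auto simp: power2_eq_square)
    finally have "\<bar>real_of_int (z i)\<bar> \<le> real k" by (simp add: abs_le_square_iff[symmetric])
    then show "z i \<in> {- int k..int k}" by (auto simp: abs_le_iff)
  qed (auto simp: Z_def PiE_def extensional_def)
  have fin: "finite (PiE I (\<lambda>_. {- int k..int k}))" by (rule finite_PiE[OF I]) auto
  show fZ: "finite Z" by (rule finite_subset[OF sub fin])
  have "real (card Z) = (\<Sum>z\<in>Z. 1)" by simp
  also have "\<dots> \<le> (\<Sum>z\<in>Z. exp S * (\<Prod>i\<in>I. exp (- (real_of_int (z i))\<^sup>2)))"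
  proof (rule sum_mono)
    fix z assume "z \<in> Z"
    then have "1 \<le> exp (S - (\<Sum>i\<in>I. (real_of_int (z i))\<^sup>2))" by (simp add: Z_def)
    also have "\<dots> = exp S * exp (\<Sum>i\<in>I. - (real_of_int (z i))\<^sup>2)"
      by (simp add: exp_add[symmetric] sum_negf)
    also have "\<dots> = exp S * (\<Prod>i\<in>I. exp (- (real_of_int (z i))\<^sup>2))"
      by (simp only: exp_sum[OF I])
    finally show "1 \<le> exp S * (\<Prod>i\<in>I. exp (- (real_of_int (z i))\<^sup>2))" .
  qed
  also have "\<dots> \<le> (\<Sum>z\<in>PiE I (\<lambda>_. {- int k..int k}). exp S * (\<Prod>i\<in>I. exp (- (real_of_int (z i))\<^sup>2)))"
    by (rule sum_mono2[OF fin sub]) (auto intro!: mult_nonneg_nonneg prod_nonneg)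
  also have "\<dots> = exp S * (\<Prod>i\<in>I. \<Sum>x\<in>{- int k..int k}. exp (- (real_of_int x)\<^sup>2))"
    by (subst prod_sum_PiE[OF I]) (auto simp: sum_distrib_left)
  also have "\<dots> \<le> exp S * (\<Prod>i\<in>I. 3)"
    by (intro mult_left_mono prod_mono conjI sum_nonneg sum_gauss_int_le) auto
  finally show "real (card Z) \<le> exp S * 3 ^ card I" by simp
qed

text \<open>
  Rounding to the grid of mesh \<open>\<epsilon> / sqrt (card I)\<close> moves a vector by at most \<open>\<epsilon>\<close>, and counting
  grid points in a ball is counting lattice points in a ball of squared radius \<open>4 * card I / \<epsilon>\<^sup>2\<close>.
\<close>

lemma ball_net:
  fixes I :: "'i set"
  assumes I: "finite I" and e: "0 < \<epsilon>" "\<epsilon> \<le> 1"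
  shows "\<exists>Q. finite Q \<and> real (card Q) \<le> (3 * exp (4 / \<epsilon>\<^sup>2)) ^ card I \<and>
     (\<forall>a. L2_set a I \<le> 1 \<longrightarrow> (\<exists>q\<in>Q. L2_set (\<lambda>i. a i - q i) I \<le> \<epsilon>))"
proof (cases "I = {}")
  case True
  then show ?thesis using e by (intro exI[of _ "{\<lambda>_. 0}"]) auto
next
  case False
  define N where "N = card I"
  have N: "N > 0" using False I by (simp add: N_def card_gt_0_iff)
  define \<delta> where "\<delta> = \<epsilon> / sqrt N"
  have d: "\<delta> > 0" "\<delta>\<^sup>2 * N = \<epsilon>\<^sup>2" using N e by (auto simp: \<delta>_def power_divide)
  define S where "S = 4 * real N / \<epsilon>\<^sup>2"
  let ?Z = "{z \<in> PiE I (\<lambda>_. UNIV :: int set). (\<Sum>i\<in>I. (real_of_int (z i))\<^sup>2) \<le> S}"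
  define Q where "Q = (\<lambda>z i. \<delta> * real_of_int (z i)) ` ?Z"
  note Z = card_lattice_points[OF I, of S]
  have "finite Q" unfolding Q_def using Z(1) by (rule finite_imageI)
  moreover have "real (card Q) \<le> (3 * exp (4 / \<epsilon>\<^sup>2)) ^ card I"
  proof -
    have "real (card Q) \<le> real (card ?Z)" unfolding Q_def by (simp add: card_image_le[OF Z(1)])
    also have "\<dots> \<le> exp S * 3 ^ N" unfolding N_def by (rule Z(2))
    also have "exp S = exp (4 / \<epsilon>\<^sup>2) ^ N" by (simp add: S_def exp_of_nat_mult[symmetric] mult.commute)
    finally show ?thesis by (simp add: power_mult_distrib N_def mult.commute)
  qed
  moreover have "\<exists>q\<in>Q. L2_set (\<lambda>i. a i - q i) I \<le> \<epsilon>" if a: "L2_set a I \<le> 1" for a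
  proof -
    define z where "z = (\<lambda>i\<in>I. \<lfloor>a i / \<delta>\<rfloor>)"
    have err: "\<bar>a i - \<delta> * real_of_int (z i)\<bar> \<le> \<delta>" if "i \<in> I" for i
    proof -
      have "\<bar>a i / \<delta> - real_of_int (z i)\<bar> \<le> 1" unfolding z_def using that by (simp add: abs_le_iff) linarith
      then have "\<delta> * \<bar>a i / \<delta> - real_of_int (z i)\<bar> \<le> \<delta> * 1" using d by (intro mult_left_mono) auto
      also have "\<delta> * \<bar>a i / \<delta> - real_of_int (z i)\<bar> = \<bar>\<delta> * (a i / \<delta> - real_of_int (z i))\<bar>" using d by (simp add: abs_mult)
      finally show ?thesis using d by (simp add: right_diff_distrib)
    qed
    have 1: "L2_set (\<lambda>i. a i - \<delta> * real_of_int (z i)) I \<le> \<epsilon>"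
    proof -
      have "(\<Sum>i\<in>I. (a i - \<delta> * real_of_int (z i))\<^sup>2) \<le> (\<Sum>i\<in>I. \<delta>\<^sup>2)"
        using err d by (intro sum_mono) (metis abs_ge_zero power2_abs power_mono)
      also have "\<dots> = \<epsilon>\<^sup>2" using d by (simp add: N_def mult.commute)
      finally show ?thesis unfolding L2_set_def using e by (intro real_le_lsqrt) (auto intro: sum_nonneg)
    qed
    have "L2_set (\<lambda>i. \<delta> * real_of_int (z i)) I \<le> L2_set a I + L2_set (\<lambda>i. - (a i - \<delta> * real_of_int (z i))) I"
      using L2_set_triangle_ineq[of a "\<lambda>i. - (a i - \<delta> * real_of_int (z i))" I] by simp
    also have "L2_set (\<lambda>i. - (a i - \<delta> * real_of_int (z i))) I = L2_set (\<lambda>i. a i - \<delta> * real_of_int (z i)) I"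
      using L2_set_scale[of "-1" "\<lambda>i. a i - \<delta> * real_of_int (z i)" I] by simp
    finally have "L2_set (\<lambda>i. \<delta> * real_of_int (z i)) I \<le> 2" using a 1 e by linarith
    then have "(L2_set (\<lambda>i. \<delta> * real_of_int (z i)) I)\<^sup>2 \<le> 2\<^sup>2" by (intro power_mono) auto
    then have "\<delta>\<^sup>2 * (\<Sum>i\<in>I. (real_of_int (z i))\<^sup>2) \<le> 4"
      unfolding L2_set_sq by (simp add: power_mult_distrib sum_distrib_left)
    then have "(\<Sum>i\<in>I. (real_of_int (z i))\<^sup>2) \<le> 4 / \<delta>\<^sup>2" using d by (simp add: field_simps)
    also have "\<dots> = S" unfolding S_def d(2)[symmetric] using N d(1) by (simp add: field_simps)
    finally have "z \<in> ?Z" by (auto simp: z_def)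
    then have "(\<lambda>i. \<delta> * real_of_int (z i)) \<in> Q" unfolding Q_def by (rule imageI)
    with 1 show ?thesis by (rule bexI)
  qed
  ultimately show ?thesis by blast
qed

definition seminorm_on :: "'i set \<Rightarrow> (('i \<Rightarrow> real) \<Rightarrow> real) \<Rightarrow> bool" where
  "seminorm_on I H \<longleftrightarrow> (\<forall>a b. H (\<lambda>i. a i + b i) \<le> H a + H b) \<and> (\<forall>c a. H (\<lambda>i. c * a i) = \<bar>c\<bar> * H a)
     \<and> (\<forall>a b. (\<forall>i\<in>I. a i = b i) \<longrightarrow> H a = H b)"

text \<open>
  The upper bound for the supremum \<open>S\<close> over the ball is self-improving, \<open>S \<le> C * (1 + \<epsilon>) + S * \<epsilon>\<close>; with it, the
  net error \<open>S * \<epsilon>\<close> is small compared with \<open>c\<close> and the lower bound follows.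
\<close>

lemma seminorm_bounds_from_net:
  assumes I: "finite I" and H: "seminorm_on I H" and c: "0 < c" "c \<le> C" and e: "\<epsilon> = c / (8 * C)"
    and net: "\<And>a. L2_set a I \<le> 1 \<Longrightarrow> \<exists>q\<in>Q. L2_set (\<lambda>i. a i - q i) I \<le> \<epsilon>"
    and Q: "\<And>q. q \<in> Q \<Longrightarrow> c * L2_set q I \<le> H q \<and> H q \<le> C * L2_set q I"
  shows "c / 2 * L2_set a I \<le> H a" "H a \<le> 3 * C * L2_set a I"
proof -
  have add: "H (\<lambda>i. a i + b i) \<le> H a + H b" and sc: "H (\<lambda>i. r * a i) = \<bar>r\<bar> * H a"
    and cong: "(\<And>i. i \<in> I \<Longrightarrow> a i = b i) \<Longrightarrow> H a = H b" for a b r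
    using H by (auto simp: seminorm_on_def)
  have zero: "H (\<lambda>_. 0) = 0" using sc[of 0 "\<lambda>_. 0"] by simp
  have nonneg: "0 \<le> H a" for a using add[of a "\<lambda>i. (-1) * a i"] sc[of "-1" a] zero by simp
  have e0: "0 < \<epsilon>" "\<epsilon> \<le> 1/8" using c by (auto simp: e field_simps)
  define B where "B = (\<Sum>i\<in>I. H (\<lambda>j. if j = i then 1 else 0))"
  have sumb: "finite K \<Longrightarrow> H (\<lambda>j. \<Sum>i\<in>K. f i j) \<le> (\<Sum>i\<in>K. H (f i))" for K :: "'a set" and f
  proof (induction K rule: finite_induct)
    case (insert x F) then show ?case using add[of "f x" "\<lambda>j. \<Sum>i\<in>F. f i j"] by simp
  qed (simp add: zero)
  have bound: "H a \<le> B" if "L2_set a I \<le> 1" for a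
  proof -
    have "H a = H (\<lambda>j. \<Sum>i\<in>I. a i * (if j = i then 1 else 0))"
      by (rule cong) (simp add: I if_distrib[where f="\<lambda>x. _ * x"] cong: if_cong)
    also have "\<dots> \<le> (\<Sum>i\<in>I. H (\<lambda>j. a i * (if j = i then 1 else 0)))" by (rule sumb[OF I])
    also have "\<dots> = (\<Sum>i\<in>I. \<bar>a i\<bar> * H (\<lambda>j. if j = i then 1 else 0))" by (simp only: sc)
    also have "\<dots> \<le> (\<Sum>i\<in>I. 1 * H (\<lambda>j. if j = i then 1 else 0))"
    proof (intro sum_mono mult_right_mono nonneg)
      fix i assume "i \<in> I"
      then have "\<bar>a i\<bar> \<le> L2_set (\<lambda>i. \<bar>a i\<bar>) I" by (rule member_le_L2_set[OF I])
      also have "L2_set (\<lambda>i. \<bar>a i\<bar>) I = L2_set a I" by (simp add: L2_set_def)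
      finally show "\<bar>a i\<bar> \<le> 1" using that by linarith
    qed
    finally show ?thesis by (simp add: B_def)
  qed
  define S where "S = (SUP a\<in>{a. L2_set a I \<le> 1}. H a)"
  have bdd: "bdd_above (H ` {a. L2_set a I \<le> 1})" by (rule bdd_aboveI[of _ B]) (auto intro: bound)
  have S: "H a \<le> S" if "L2_set a I \<le> 1" for a unfolding S_def by (rule cSUP_upper[OF _ bdd]) (use that in simp)
  have S': "H a \<le> S * L2_set a I" for a
  proof (cases "L2_set a I = 0")
    case True
    then have "H a = H (\<lambda>_. 0)" by (intro cong) (simp add: L2_set_eq_0_iff[OF I])
    then show ?thesis using True zero by simp
  next
    case False
    let ?l = "L2_set a I"
    have l: "?l > 0" using False by (simp add: less_le)
    have "H (\<lambda>i. (1 / ?l) * a i) \<le> S" by (rule S) (simp only: L2_set_scale, use l in simp)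
    then show ?thesis using l by (simp only: sc) (simp add: field_simps)
  qed
  have near: "\<exists>q\<in>Q. L2_set (\<lambda>i. a i - q i) I \<le> \<epsilon> \<and> \<bar>L2_set q I - L2_set a I\<bar> \<le> \<epsilon> \<and> \<bar>H a - H q\<bar> \<le> H (\<lambda>i. a i - q i)"
    if a1: "L2_set a I \<le> 1" for a
  proof -
    obtain q where q: "q \<in> Q" "L2_set (\<lambda>i. a i - q i) I \<le> \<epsilon>" using net[OF a1] by blast
    have m: "L2_set (\<lambda>i. q i - a i) I = L2_set (\<lambda>i. a i - q i) I" "H (\<lambda>i. q i - a i) = H (\<lambda>i. a i - q i)"
      using L2_set_scale[of "-1" "\<lambda>i. a i - q i" I] sc[of "-1" "\<lambda>i. a i - q i"] by auto
    have "L2_set a I \<le> L2_set q I + L2_set (\<lambda>i. a i - q i) I" "L2_set q I \<le> L2_set a I + L2_set (\<lambda>i. q i - a i) I"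
      using L2_set_triangle_ineq[of q "\<lambda>i. a i - q i" I] L2_set_triangle_ineq[of a "\<lambda>i. q i - a i" I] by auto
    moreover have "H a \<le> H q + H (\<lambda>i. a i - q i)" "H q \<le> H a + H (\<lambda>i. q i - a i)"
      using add[of q "\<lambda>i. a i - q i"] add[of a "\<lambda>i. q i - a i"] by auto
    ultimately show ?thesis using q m by (intro bexI[of _ q]) auto
  qed
  have "(SUP a\<in>{a. L2_set a I \<le> 1}. H a) \<le> C * (1 + \<epsilon>) + S * \<epsilon>"
  proof (rule cSUP_least)
    show "{a. L2_set a I \<le> 1} \<noteq> {}" by (auto simp: L2_set_def intro!: exI[of _ "\<lambda>_. 0"])
    fix a assume "a \<in> {a. L2_set a I \<le> 1}"
    then have a: "L2_set a I \<le> 1" by simp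
    obtain q where q: "q \<in> Q" "L2_set (\<lambda>i. a i - q i) I \<le> \<epsilon>" "L2_set q I \<le> L2_set a I + \<epsilon>" "H a \<le> H q + H (\<lambda>i. a i - q i)"
      using near[OF a] by (auto simp: abs_le_iff)
    have "H q \<le> C * L2_set q I" using Q[OF q(1)] by simp
    also have "\<dots> \<le> C * (1 + \<epsilon>)" using q(3) a c by (intro mult_left_mono) auto
    finally have 1: "H q \<le> C * (1 + \<epsilon>)" .
    have "0 \<le> S" using S[of "\<lambda>_. 0"] zero by (simp add: L2_set_def)
    then have "S * L2_set (\<lambda>i. a i - q i) I \<le> S * \<epsilon>" using q(2) by (rule mult_left_mono[rotated])
    then have "H (\<lambda>i. a i - q i) \<le> S * \<epsilon>" using S'[of "\<lambda>i. a i - q i"] by linarith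
    then show "H a \<le> C * (1 + \<epsilon>) + S * \<epsilon>" using q(4) 1 by linarith
  qed
  then have up: "S \<le> C * (1 + \<epsilon>) + S * \<epsilon>" unfolding S_def[symmetric] .
  have S3: "S \<le> 3 * C"
  proof -
    have "0 \<le> S" using S[of "\<lambda>_. 0"] zero by (simp add: L2_set_def)
    then have "S * \<epsilon> \<le> S * (1/8)" using e0 by (intro mult_left_mono) auto
    moreover have "C * (1 + \<epsilon>) \<le> C * (9/8)" using e0 c by (intro mult_left_mono) auto
    ultimately show ?thesis using up c by linarith
  qed
  show "H a \<le> 3 * C * L2_set a I" using S'[of a] mult_right_mono[OF S3, of "L2_set a I"] by simp
  have low: "c / 2 \<le> H a" if a: "L2_set a I = 1" for a
  proof -
    obtain q where q: "q \<in> Q" "L2_set (\<lambda>i. a i - q i) I \<le> \<epsilon>" "1 - \<epsilon> \<le> L2_set q I" "H q \<le> H a + H (\<lambda>i. a i - q i)"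
      using near[of a] a by (auto simp: abs_le_iff)
    have "c * (1 - \<epsilon>) \<le> c * L2_set q I" using q(3) c by (intro mult_left_mono) auto
    also have "\<dots> \<le> H q" using Q[OF q(1)] by simp
    finally have 1: "c * (1 - \<epsilon>) \<le> H q" .
    have "H (\<lambda>i. a i - q i) \<le> S * L2_set (\<lambda>i. a i - q i) I" by (rule S')
    also have "\<dots> \<le> 3 * C * \<epsilon>" using S3 q(2) c e0 by (intro mult_mono) auto
    also have "\<dots> = 3 * c / 8" using c by (simp add: e)
    finally have "H (\<lambda>i. a i - q i) \<le> 3 * c / 8" .
    moreover have "c * \<epsilon> \<le> c * (1/8)" using e0 c by (intro mult_left_mono) auto
    ultimately show ?thesis using 1 q(4) by (simp add: right_diff_distrib)
  qed
  show "c / 2 * L2_set a I \<le> H a"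
  proof (cases "L2_set a I = 0")
    case False
    let ?l = "L2_set a I"
    have l: "?l > 0" using False by (simp add: less_le)
    have "c / 2 \<le> H (\<lambda>i. (1 / ?l) * a i)" by (rule low) (simp only: L2_set_scale, use l in simp)
    then show ?thesis using l by (simp only: sc) (simp add: field_simps)
  qed (simp add: nonneg)
qed

lemma random_seminorm_bounds:
  fixes I :: "'i set" and H :: "'w \<Rightarrow> ('i \<Rightarrow> real) \<Rightarrow> real"
  assumes P: "prob_space P" and I: "finite I" and H: "\<And>w. seminorm_on I (H w)"
    and m[measurable]: "\<And>a. (\<lambda>w. H w a) \<in> borel_measurable P" and c: "0 < c" "c \<le> C" and p: "0 \<le> p"
    and lo: "\<And>a. L2_set a I = 1 \<Longrightarrow> emeasure P {w\<in>space P. H w a \<le> c} \<le> ennreal p"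
    and hi: "\<And>a. L2_set a I = 1 \<Longrightarrow> emeasure P {w\<in>space P. C \<le> H w a} \<le> ennreal p"
  shows "\<exists>A\<in>sets P. 1 - 2 * p * (3 * exp (256 * C\<^sup>2 / c\<^sup>2)) ^ card I \<le> measure P A \<and>
     (\<forall>w\<in>A. \<forall>a. c / 2 * L2_set a I \<le> H w a \<and> H w a \<le> 3 * C * L2_set a I)"
proof -
  interpret prob_space P by fact
  have sc: "H w (\<lambda>i. r * a i) = \<bar>r\<bar> * H w a" for w r a
    using H[of w] unfolding seminorm_on_def by blast
  have cong: "(\<And>i. i \<in> I \<Longrightarrow> a i = b i) \<Longrightarrow> H w a = H w b" for w a b
    using H[of w] unfolding seminorm_on_def by blast
  define \<epsilon> where "\<epsilon> = c / (8 * C)"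
  have e: "0 < \<epsilon>" "\<epsilon> \<le> 1" using c by (auto simp: \<epsilon>_def field_simps)
  have e2: "4 / \<epsilon>\<^sup>2 = 256 * C\<^sup>2 / c\<^sup>2" using c by (simp add: \<epsilon>_def power_divide power_mult_distrib)
  obtain Q :: "('i \<Rightarrow> real) set" where Q: "finite Q" "real (card Q) \<le> (3 * exp (4 / \<epsilon>\<^sup>2)) ^ card I"
    "\<And>a. L2_set a I \<le> 1 \<Longrightarrow> \<exists>q\<in>Q. L2_set (\<lambda>i. a i - q i) I \<le> \<epsilon>"
    using ball_net[OF I e] by blast
  define Bad where "Bad q = {w\<in>space P. \<not> (c * L2_set q I \<le> H w q \<and> H w q \<le> C * L2_set q I)}" for q
  have Bm: "Bad q \<in> sets P" for q unfolding Bad_def by measurable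
  have Bp: "measure P (Bad q) \<le> 2 * p" for q
  proof (cases "L2_set q I = 0")
    case True
    have "H w q = 0" for w
    proof -
      have "H w q = H w (\<lambda>i. 0 * q i)" using True by (intro cong) (simp add: L2_set_eq_0_iff[OF I])
      also have "\<dots> = 0" using sc[of w 0 q] by simp
      finally show ?thesis .
    qed
    then have "Bad q = {}" using True by (auto simp: Bad_def)
    then show ?thesis using p by simp
  next
    case False
    let ?l = "L2_set q I"
    have l: "?l > 0" using False by (simp add: less_le)
    let ?a = "\<lambda>i. (1 / ?l) * q i"
    have a1: "L2_set ?a I = 1" by (simp only: L2_set_scale) (use l in simp)
    have Ha: "H w ?a = H w q / ?l" for w using l by (simp only: sc) simp
    have "Bad q \<subseteq> {w\<in>space P. H w ?a \<le> c} \<union> {w\<in>space P. C \<le> H w ?a}"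
      unfolding Bad_def Ha using l by (auto simp: field_simps)
    then have "emeasure P (Bad q) \<le> emeasure P ({w\<in>space P. H w ?a \<le> c} \<union> {w\<in>space P. C \<le> H w ?a})"
      by (rule emeasure_mono) measurable
    also have "\<dots> \<le> emeasure P {w\<in>space P. H w ?a \<le> c} + emeasure P {w\<in>space P. C \<le> H w ?a}"
      by (rule emeasure_subadditive) measurable
    also have "\<dots> \<le> ennreal p + ennreal p" by (intro add_mono lo hi a1)
    also have "\<dots> = ennreal (2 * p)" using p by (simp add: ennreal_plus[symmetric] del: ennreal_plus)
    finally show ?thesis using p by (simp add: emeasure_eq_measure)
  qed
  define A where "A = space P - (\<Union>q\<in>Q. Bad q)"
  have Am: "A \<in> sets P" unfolding A_def using Bm Q(1) by auto
  have "measure P (\<Union>q\<in>Q. Bad q) \<le> (\<Sum>q\<in>Q. measure P (Bad q))"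
    by (rule finite_measure_subadditive_finite[OF Q(1)]) (use Bm in auto)
  also have "\<dots> \<le> (\<Sum>q\<in>Q. 2 * p)" by (intro sum_mono Bp)
  also have "\<dots> = 2 * p * real (card Q)" by simp
  also have "\<dots> \<le> 2 * p * (3 * exp (256 * C\<^sup>2 / c\<^sup>2)) ^ card I"
    using Q(2) p unfolding e2 by (intro mult_left_mono) auto
  finally have "1 - 2 * p * (3 * exp (256 * C\<^sup>2 / c\<^sup>2)) ^ card I \<le> measure P A"
    unfolding A_def using Bm Q(1) by (subst prob_compl) auto
  moreover have "\<forall>w\<in>A. \<forall>a. c / 2 * L2_set a I \<le> H w a \<and> H w a \<le> 3 * C * L2_set a I"
  proof (intro ballI allI)
    fix w a assume w: "w \<in> A"
    have good: "q \<in> Q \<Longrightarrow> c * L2_set q I \<le> H w q \<and> H w q \<le> C * L2_set q I" for q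
      using w by (auto simp: A_def Bad_def)
    show "c / 2 * L2_set a I \<le> H w a \<and> H w a \<le> 3 * C * L2_set a I"
      using seminorm_bounds_from_net[OF I H c \<epsilon>_def Q(3) good] by blast
  qed
  ultimately show ?thesis using Am by blast
qed

section \<open>Random operators\<close>

lemma emeasure_lin_comb:
  fixes I :: "'i set" and J :: "'j set"
  assumes I: "finite I" and J: "finite J" and r: "prob_space \<rho>" and s[measurable_cong]: "sets \<rho> = sets borel"
    and F[measurable]: "F \<in> borel_measurable (Pi\<^sub>M J (\<lambda>_. borel))" and S[measurable]: "S \<in> sets (borel :: real measure)"
    and dep: "\<And>z. F (restrict z J) = F z"
  shows "emeasure (iid I (iid J \<rho>)) {X\<in>space (iid I (iid J \<rho>)). F (\<lambda>j. \<Sum>i\<in>I. a i * X i j) \<in> S}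
    = emeasure (iid J (lin_law \<rho> I a)) {z\<in>space (iid J (lin_law \<rho> I a)). F z \<in> S}"
proof -
  let ?P = "iid I (iid J \<rho>)" and ?L = "iid J (lin_law \<rho> I a)"
  have m: "(\<lambda>X. F (\<lambda>j. \<Sum>i\<in>I. a i * X i j)) \<in> borel_measurable ?P"
  proof -
    have "(\<lambda>X. F (\<lambda>j\<in>J. \<Sum>i\<in>I. a i * X i j)) \<in> borel_measurable ?P"
      by (rule measurable_compose[OF measurable_restrict F])
         (auto intro!: borel_measurable_sum borel_measurable_times measurable_component2 simp: s)
    then show ?thesis by (simp only: dep)
  qed
  have "emeasure ?P {X\<in>space ?P. F (\<lambda>j. \<Sum>i\<in>I. a i * X i j) \<in> S} = (\<integral>\<^sup>+X. indicator {X\<in>space ?P. F (\<lambda>j. \<Sum>i\<in>I. a i * X i j) \<in> S} X \<partial>?P)"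
    using measurable_sets[OF m S] by (intro nn_integral_indicator[symmetric]) (simp add: vimage_def Int_def conj_commute)
  also have "\<dots> = (\<integral>\<^sup>+X. indicator S (F (\<lambda>j\<in>J. \<Sum>i\<in>I. a i * X i j)) \<partial>?P)"
    by (intro nn_integral_cong) (simp only: dep, simp add: indicator_def)
  also have "\<dots> = (\<integral>\<^sup>+z. indicator S (F z) \<partial>?L)"
    by (rule nn_integral_lin_comb[OF I J r s]) measurable
  also have "\<dots> = (\<integral>\<^sup>+z. indicator {z\<in>space ?L. F z \<in> S} z \<partial>?L)"
    by (intro nn_integral_cong) (simp add: indicator_def)
  also have "\<dots> = emeasure ?L {z\<in>space ?L. F z \<in> S}"
    by (rule nn_integral_indicator) measurable
  finally show ?thesis .
qed

lemma lin_comb_measurable: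
  fixes \<rho> :: "real measure" and F :: "('j \<Rightarrow> real) \<Rightarrow> real"
  assumes s: "sets \<rho> = sets borel" and F: "F \<in> borel_measurable (Pi\<^sub>M J (\<lambda>_. borel))" and dep: "\<And>z. F (restrict z J) = F z"
  shows "(\<lambda>X. F (\<lambda>j. \<Sum>i\<in>I. a i * X i j)) \<in> borel_measurable (iid I (iid J \<rho>))"
proof -
  have "(\<lambda>X. F (\<lambda>j\<in>J. \<Sum>i\<in>I. a i * X i j)) \<in> borel_measurable (iid I (iid J \<rho>))"
    by (rule measurable_compose[OF measurable_restrict F])
       (intro borel_measurable_sum borel_measurable_times borel_measurable_const measurable_component2 s)
  then show ?thesis by (simp only: dep)
qed

lemma seminorm_lin_comb:
  fixes I :: "'i set" and J :: "'j set" and X :: "'i \<Rightarrow> 'j \<Rightarrow> real"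
  assumes F: "seminorm_on J F"
  shows "seminorm_on I (\<lambda>a. F (\<lambda>j. \<Sum>i\<in>I. a i * X i j))"
proof -
  have F1: "F (\<lambda>j. a j + b j) \<le> F a + F b" and F2: "F (\<lambda>j. c * a j) = \<bar>c\<bar> * F a" for a b c
    using F unfolding seminorm_on_def by blast+
  show ?thesis unfolding seminorm_on_def
  proof (intro conjI allI impI)
    fix a b :: "'i \<Rightarrow> real"
    show "F (\<lambda>j. \<Sum>i\<in>I. (a i + b i) * X i j) \<le> F (\<lambda>j. \<Sum>i\<in>I. a i * X i j) + F (\<lambda>j. \<Sum>i\<in>I. b i * X i j)"
      using F1[of "\<lambda>j. \<Sum>i\<in>I. a i * X i j" "\<lambda>j. \<Sum>i\<in>I. b i * X i j"] by (simp add: distrib_right sum.distrib)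
    show "F (\<lambda>j. \<Sum>i\<in>I. (c * a i) * X i j) = \<bar>c\<bar> * F (\<lambda>j. \<Sum>i\<in>I. a i * X i j)" for c
      using F2[of c "\<lambda>j. \<Sum>i\<in>I. a i * X i j"] by (simp add: sum_distrib_left mult.assoc)
    assume "\<forall>i\<in>I. a i = b i"
    then show "F (\<lambda>j. \<Sum>i\<in>I. a i * X i j) = F (\<lambda>j. \<Sum>i\<in>I. b i * X i j)" by simp
  qed
qed

lemma L2_sq_le_iff: "t \<ge> 0 \<Longrightarrow> L2_set z I \<le> t \<longleftrightarrow> (\<Sum>i\<in>I. (z i)\<^sup>2) \<le> t\<^sup>2"
  by (simp add: L2_set_sq[symmetric] power_mono_iff)

lemma chi_square_lower:
  assumes I: "finite I" and law: "subgauss_law c \<rho>" and z2: "(\<integral>z. z\<^sup>2 \<partial>\<rho>) = 1" and s: "s = exp (- c) / 128"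
  shows "emeasure (iid I \<rho>) {z\<in>space (iid I \<rho>). (\<Sum>i\<in>I. (z i)\<^sup>2) \<le> real (card I) / 4} \<le> ennreal (exp (- (s / 4) * card I))"
proof -
  note [measurable_cong] = subgauss_lawD(2)[OF law]
  let ?P = "iid I \<rho>"
  have s0: "s > 0" by (simp add: s)
  have eq: "(- s * (real (card I) / 4) \<le> (\<Sum>i\<in>I. 1 * (- s * (z i)\<^sup>2))) \<longleftrightarrow> (\<Sum>i\<in>I. (z i)\<^sup>2) \<le> real (card I) / 4" for z
    using s0 by (simp add: sum_negf sum_distrib_left[symmetric])
  have "emeasure ?P {z\<in>space ?P. - s * (real (card I) / 4) \<le> (\<Sum>i\<in>I. 1 * (- s * (z i)\<^sup>2))}
     \<le> ennreal (exp (- (- s * (real (card I) / 4)))) * (\<integral>\<^sup>+z. ennreal (exp (\<Sum>i\<in>I. 1 * (- s * (z i)\<^sup>2))) \<partial>?P)"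
    by (rule emeasure_exp_bound) measurable
  also have "\<dots> \<le> ennreal (exp (- (- s * (real (card I) / 4)))) * ennreal (exp ((- s / 2) * (\<Sum>i\<in>I. 1\<^sup>2)))"
    by (intro mult_left_mono nn_integral_exp_sum_PiM[OF I subgauss_lawD(1)[OF law], where \<phi>="\<lambda>_ z. - s * z\<^sup>2"])
       (use subgauss_exp_minus_square[OF law z2 s] in auto)
  also have "\<dots> = ennreal (exp (- (s / 4) * card I))"
    by (simp add: ennreal_mult[symmetric] exp_add[symmetric] field_simps)
  finally show ?thesis unfolding eq .
qed

lemma chi_square_upper:
  assumes I: "finite I" and law: "subgauss_law c \<rho>" and c: "c > 0"
  shows "emeasure (iid I \<rho>) {z\<in>space (iid I \<rho>). 16 * c * real (card I) \<le> (\<Sum>i\<in>I. (z i)\<^sup>2)} \<le> ennreal (exp (- 1 * real (card I)))"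
proof -
  note [measurable_cong] = subgauss_lawD(2)[OF law]
  let ?P = "iid I \<rho>"
  have eq: "(2 * real (card I) \<le> (\<Sum>i\<in>I. 1 * ((z i)\<^sup>2 / (8 * c)))) \<longleftrightarrow> 16 * c * real (card I) \<le> (\<Sum>i\<in>I. (z i)\<^sup>2)" for z
    using c by (simp add: sum_divide_distrib[symmetric] field_simps)
  have e1: "(\<integral>\<^sup>+z. ennreal (exp (z\<^sup>2 / (8 * c))) \<partial>\<rho>) \<le> ennreal (exp 1)"
  proof -
    have "ennreal 2 \<le> ennreal (exp 1)" using exp_ge_add_one_self[of 1] by (intro ennreal_leI) simp
    then show ?thesis using subgauss_exp_square[OF law c] by (simp add: order_trans)
  qed
  have "emeasure ?P {z\<in>space ?P. 2 * real (card I) \<le> (\<Sum>i\<in>I. 1 * ((z i)\<^sup>2 / (8 * c)))}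
     \<le> ennreal (exp (- (2 * real (card I)))) * (\<integral>\<^sup>+z. ennreal (exp (\<Sum>i\<in>I. 1 * ((z i)\<^sup>2 / (8 * c)))) \<partial>?P)"
    by (rule emeasure_exp_bound) measurable
  also have "\<dots> \<le> ennreal (exp (- (2 * real (card I)))) * ennreal (exp (1 * (\<Sum>i\<in>I. 1\<^sup>2)))"
    by (intro mult_left_mono nn_integral_exp_sum_PiM[OF I subgauss_lawD(1)[OF law], where \<phi>="\<lambda>_ z. z\<^sup>2 / (8 * c)"])
       (use e1 in auto)
  also have "\<dots> = ennreal (exp (- 1 * real (card I)))"
    by (simp add: ennreal_mult[symmetric] exp_add[symmetric])
  finally show ?thesis unfolding eq .
qed

lemma random_matrix_bounds:
  fixes I :: "'i set" and K :: "'k set"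
  assumes I: "finite I" "I \<noteq> {}" and K: "finite K" and law: "subgauss_law c \<nu>" and c: "c \<ge> 1"
    and z1: "(\<integral>z. z \<partial>\<nu>) = 0" and z2: "(\<integral>z. z\<^sup>2 \<partial>\<nu>) = 1" and s: "s = exp (- c) / 512"
  shows "\<exists>A\<in>sets (iid K (iid I \<nu>)).
     1 - 2 * exp (- s * card I) * (3 * exp (16384 * c)) ^ card K \<le> measure (iid K (iid I \<nu>)) A \<and>
     (\<forall>Y\<in>A. \<forall>b. sqrt (card I) / 4 * L2_set b K \<le> L2_set (\<lambda>i. \<Sum>m\<in>K. b m * Y m i) I \<and>
        L2_set (\<lambda>i. \<Sum>m\<in>K. b m * Y m i) I \<le> 12 * sqrt c * sqrt (card I) * L2_set b K)"
proof -
  note pn = subgauss_lawD(1)[OF law]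
  note sn = subgauss_lawD(2)[OF law]
  let ?P = "iid K (iid I \<nu>)"
  let ?N = "real (card I)"
  have N: "?N > 0" using I by (simp add: card_gt_0_iff)
  define l u where "l = sqrt ?N / 2" and "u = sqrt (16 * c * ?N)"
  have l2: "l\<^sup>2 = ?N / 4" and u2: "u\<^sup>2 = 16 * c * ?N" using c N by (auto simp: l_def u_def power_divide)
  have l0: "l > 0" and u0: "u \<ge> 0" using c N by (auto simp: l_def u_def)
  have lu: "l \<le> u"
  proof (rule power2_le_imp_le)
    have "?N * 1 \<le> ?N * c" using c by (intro mult_left_mono) auto
    then show "l\<^sup>2 \<le> u\<^sup>2" unfolding l2 u2 using c N by simp
  qed (rule u0)
  have "exp (- c) \<le> 1" using c by simp
  then have s1: "s \<le> 1" unfolding s by linarith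
  have s2: "s > 0" unfolding s by simp
  have semi: "seminorm_on I (\<lambda>z. L2_set z I)"
    unfolding seminorm_on_def by (auto simp: L2_set_triangle_ineq L2_set_scale intro: L2_set_cong)
  have Lm: "(\<lambda>z. L2_set z I) \<in> borel_measurable (Pi\<^sub>M I (\<lambda>_. borel))"
    unfolding L2_set_def by measurable
  have dep: "L2_set (restrict z I) I = L2_set z I" for z :: "'i \<Rightarrow> real" by (rule L2_set_cong) auto
  have law1: "subgauss_law c (lin_law \<nu> K b)" "(\<integral>z. z\<^sup>2 \<partial>lin_law \<nu> K b) = 1" if "L2_set b K = 1" for b
  proof -
    have b: "(\<Sum>i\<in>K. (b i)\<^sup>2) = 1" using that by (metis L2_set_sq one_power2)
    show "subgauss_law c (lin_law \<nu> K b)" using subgauss_lin_law[OF K law, of b] b by simp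
    show "(\<integral>z. z\<^sup>2 \<partial>lin_law \<nu> K b) = 1" using second_moment_lin_law[OF K pn sn z1 z2, of b] b by simp
  qed
  have "\<exists>A\<in>sets ?P. 1 - 2 * exp (- s * ?N) * (3 * exp (256 * u\<^sup>2 / l\<^sup>2)) ^ card K \<le> measure ?P A \<and>
     (\<forall>Y\<in>A. \<forall>b. l / 2 * L2_set b K \<le> L2_set (\<lambda>i. \<Sum>m\<in>K. b m * Y m i) I \<and> L2_set (\<lambda>i. \<Sum>m\<in>K. b m * Y m i) I \<le> 3 * u * L2_set b K)"
  proof (rule random_seminorm_bounds[OF _ K])
    show "prob_space ?P" by (intro prob_space_PiM pn)
    show "seminorm_on K (\<lambda>b. L2_set (\<lambda>i. \<Sum>m\<in>K. b m * Y m i) I)" for Y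
      by (rule seminorm_lin_comb[OF semi])
    show "(\<lambda>Y. L2_set (\<lambda>i. \<Sum>m\<in>K. b m * Y m i) I) \<in> borel_measurable ?P" for b
      by (rule lin_comb_measurable[OF sn Lm dep])
    fix b assume b: "L2_set b K = 1"
    let ?L = "iid I (lin_law \<nu> K b)"
    have "emeasure ?P {Y\<in>space ?P. L2_set (\<lambda>i. \<Sum>m\<in>K. b m * Y m i) I \<in> {..l}} = emeasure ?L {z\<in>space ?L. L2_set z I \<in> {..l}}"
      by (rule emeasure_lin_comb[OF K I(1) pn sn Lm _ dep]) auto
    also have "{z\<in>space ?L. L2_set z I \<in> {..l}} = {z\<in>space ?L. (\<Sum>i\<in>I. (z i)\<^sup>2) \<le> ?N / 4}"
      using l0 by (simp add: L2_sq_le_iff l2)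
    also have "emeasure ?L \<dots> \<le> ennreal (exp (- (4 * s / 4) * ?N))"
      by (rule chi_square_lower[OF I(1) law1[OF b]]) (simp add: s)
    finally show "emeasure ?P {Y\<in>space ?P. L2_set (\<lambda>i. \<Sum>m\<in>K. b m * Y m i) I \<le> l} \<le> ennreal (exp (- s * ?N))" by simp
    have "emeasure ?P {Y\<in>space ?P. L2_set (\<lambda>i. \<Sum>m\<in>K. b m * Y m i) I \<in> {u..}} = emeasure ?L {z\<in>space ?L. L2_set z I \<in> {u..}}"
      by (rule emeasure_lin_comb[OF K I(1) pn sn Lm _ dep]) auto
    also have "{z\<in>space ?L. L2_set z I \<in> {u..}} = {z\<in>space ?L. 16 * c * ?N \<le> (\<Sum>i\<in>I. (z i)\<^sup>2)}"
      unfolding u2[symmetric] L2_set_sq[symmetric] using u0 by (auto simp: power_mono_iff intro: power2_le_imp_le)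
    also have "emeasure ?L \<dots> \<le> ennreal (exp (- 1 * ?N))"
      by (rule chi_square_upper[OF I(1) law1(1)[OF b]]) (use c in simp)
    also have "\<dots> \<le> ennreal (exp (- s * ?N))" using s1 N by (intro ennreal_leI) simp
    finally show "emeasure ?P {Y\<in>space ?P. u \<le> L2_set (\<lambda>i. \<Sum>m\<in>K. b m * Y m i) I} \<le> ennreal (exp (- s * ?N))" by simp
  qed (use l0 lu in auto)
  moreover have "256 * u\<^sup>2 / l\<^sup>2 = 16384 * c" unfolding u2 l2 using N by simp
  moreover have "l / 2 = sqrt ?N / 4" "3 * u = 12 * sqrt c * sqrt ?N"
    by (simp_all add: l_def u_def real_sqrt_mult)
  ultimately show ?thesis by simp
qed

context support_functional begin

lemma seminorm_h: "seminorm_on J h"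
  unfolding seminorm_on_def using h_add h_scale h_cong by blast

text \<open>
  The exponential parameter is of order \<open>gauss_mean / d\<^sup>2\<close> in both tails, which makes the exponents
  multiples of \<open>(gauss_mean / d)\<^sup>2\<close>. The hypothesis \<open>k\<close> lets \<open>rad_mean\<close> absorb
  \<open>d\<close>.
\<close>

lemma random_operator_bounds:
  fixes I :: "'i set"
  assumes I: "finite I" and law: "subgauss_law c \<rho>" and sy: "symmetric_law \<rho>" and c: "c \<ge> 1"
    and z1: "(\<integral>z. z \<partial>\<rho>) = 0" and z2: "(\<integral>z. z\<^sup>2 \<partial>\<rho>) = 1"
    and C1: "C1 \<ge> 1" "gauss_mean \<le> C1 * (rad_mean + d)" and d0: "d > 0" and k: "2 * C1 * d \<le> gauss_mean"
    and m0: "m0 = exp (- c / 2) / 32" and C: "C = max 4 (32 * c / m0\<^sup>2)" and r: "r = 1 / (64 * C1\<^sup>2 * C)"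
    and K: "K = sqrt (10 * c)"
  shows "\<exists>A\<in>sets (iid I (iid J \<rho>)).
     1 - 2 * exp (- r * (gauss_mean / d)\<^sup>2) * (3 * exp (256 * (56 * K)\<^sup>2 / (m0 / (8 * C1))\<^sup>2)) ^ card I
       \<le> measure (iid I (iid J \<rho>)) A \<and>
     (\<forall>X\<in>A. \<forall>a. m0 / (16 * C1) * gauss_mean * L2_set a I \<le> h (\<lambda>j. \<Sum>i\<in>I. a i * X i j) \<and>
        h (\<lambda>j. \<Sum>i\<in>I. a i * X i j) \<le> 168 * K * gauss_mean * L2_set a I)"
proof -
  note pn = subgauss_lawD(1)[OF law]
  note sn = subgauss_lawD(2)[OF law]
  let ?P = "iid I (iid J \<rho>)"
  define g where "g = gauss_mean"
  have g: "g > 0" using k C1 d0 by (simp add: g_def) (smt (verit) mult_pos_pos)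
  have Kp: "K > 0" "K\<^sup>2 = 10 * c" "1 \<le> K" using c by (auto simp: K)
  have "exp (- c / 2) \<le> 1" using c by simp
  then have "m0 \<le> 1" unfolding m0 by linarith
  moreover have "m0 > 0" unfolding m0 by simp
  ultimately have m0p: "m0 > 0" "m0 \<le> 1" by auto
  have Cp: "C \<ge> 4" by (simp add: C)
  have rm: "g / (2 * C1) \<le> rad_mean"
  proof -
    have "C1 * d \<le> g / 2" using k by (simp add: g_def)
    then have "g / 2 \<le> C1 * rad_mean" using C1(2) by (simp add: g_def distrib_left)
    then show ?thesis using C1(1) by (simp add: field_simps)
  qed
  define l u where "l = m0 / (8 * C1) * g" and "u = 8 * K * (7 * g)"
  have l0: "l > 0" using m0p C1 g by (simp add: l_def)
  have lu: "l \<le> u"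
  proof -
    have "m0 / (8 * C1) \<le> 1" using m0p C1 by (simp add: field_simps)
    also have "1 \<le> 56 * K" using Kp by simp
    finally have "m0 / (8 * C1) * g \<le> 56 * K * g" by (rule mult_right_mono) (use g in simp)
    then show ?thesis by (simp add: l_def u_def)
  qed
  have r1: "r \<le> 1" "r > 0"
  proof -
    have "1 * 1 \<le> C1\<^sup>2 * C" using C1 Cp by (intro mult_mono) auto
    then show "r \<le> 1" "r > 0" unfolding r using C1 Cp by (auto simp: field_simps)
  qed
  have law1: "subgauss_law c (lin_law \<rho> I a)" "(\<integral>z. z\<^sup>2 \<partial>lin_law \<rho> I a) = 1" if "L2_set a I = 1" for a
  proof -
    have b: "(\<Sum>i\<in>I. (a i)\<^sup>2) = 1" using that by (metis L2_set_sq one_power2)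
    show "subgauss_law c (lin_law \<rho> I a)" using subgauss_lin_law[OF I law, of a] b by simp
    show "(\<integral>z. z\<^sup>2 \<partial>lin_law \<rho> I a) = 1" using second_moment_lin_law[OF I pn sn z1 z2, of a] b by simp
  qed
  have "\<exists>A\<in>sets ?P. 1 - 2 * exp (- r * (g / d)\<^sup>2) * (3 * exp (256 * u\<^sup>2 / l\<^sup>2)) ^ card I \<le> measure ?P A \<and>
     (\<forall>X\<in>A. \<forall>a. l / 2 * L2_set a I \<le> h (\<lambda>j. \<Sum>i\<in>I. a i * X i j) \<and> h (\<lambda>j. \<Sum>i\<in>I. a i * X i j) \<le> 3 * u * L2_set a I)"
  proof (rule random_seminorm_bounds[OF _ I])
    show "prob_space ?P" by (intro prob_space_PiM pn)
    show "seminorm_on I (\<lambda>a. h (\<lambda>j. \<Sum>i\<in>I. a i * X i j))" for X by (rule seminorm_lin_comb[OF seminorm_h])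
    show "(\<lambda>X. h (\<lambda>j. \<Sum>i\<in>I. a i * X i j)) \<in> borel_measurable ?P" for a
      by (rule lin_comb_measurable[OF sn h_meas h_restrict])
    fix a assume a: "L2_set a I = 1"
    let ?L = "iid J (lin_law \<rho> I a)"
    have sya: "symmetric_law (lin_law \<rho> I a)" by (rule symmetric_lin_law[OF I pn sn sy])
    have "emeasure ?P {X\<in>space ?P. h (\<lambda>j. \<Sum>i\<in>I. a i * X i j) \<in> {..l}} = emeasure ?L {z\<in>space ?L. h z \<in> {..l}}"
      by (rule emeasure_lin_comb[OF I finite_J pn sn h_meas _ h_restrict]) auto
    also have "\<dots> = emeasure ?L {z\<in>space ?L. h z \<le> l}" by simp
    also have "\<dots> \<le> ennreal (exp (- r * (g / d)\<^sup>2))"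
    proof -
      define la where "la = g / (8 * C1 * C * d\<^sup>2)"
      have la: "la \<ge> 0" using g C1 Cp d0 by (simp add: la_def)
      have "emeasure ?L {z\<in>space ?L. h z \<le> l} \<le> ennreal (exp (2 * la * l / m0 + C * la\<^sup>2 * d\<^sup>2 - la * rad_mean))"
        by (rule lower_tail[OF law1(1)[OF a] sya law1(2)[OF a] _ m0 C la]) (use c l0 in auto)
      also have "\<dots> \<le> ennreal (exp (- r * (g / d)\<^sup>2))"
      proof (intro ennreal_leI, subst exp_le_cancel_iff)
        have "2 * la * l / m0 = la * g / (4 * C1)" using m0p by (simp add: l_def)
        moreover have "la * (g / (2 * C1)) \<le> la * rad_mean" by (rule mult_left_mono[OF rm la])
        moreover have "C * la\<^sup>2 * d\<^sup>2 = la * g / (8 * C1)"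
          using C1 Cp d0 by (simp add: la_def power2_eq_square field_simps)
        moreover have "r * (g / d)\<^sup>2 = la * g / (8 * C1)"
          using C1 Cp d0 by (simp add: la_def r power2_eq_square field_simps)
        moreover have "la * (g / (2 * C1)) = la * g / (4 * C1) + la * g / (8 * C1) + la * g / (8 * C1)"
          using C1 by (simp add: field_simps)
        ultimately show "2 * la * l / m0 + C * la\<^sup>2 * d\<^sup>2 - la * rad_mean \<le> - r * (g / d)\<^sup>2" by linarith
      qed
      finally show ?thesis .
    qed
    finally show "emeasure ?P {X\<in>space ?P. h (\<lambda>j. \<Sum>i\<in>I. a i * X i j) \<le> l} \<le> ennreal (exp (- r * (g / d)\<^sup>2))" by simp
    have "emeasure ?P {X\<in>space ?P. h (\<lambda>j. \<Sum>i\<in>I. a i * X i j) \<in> {u..}} = emeasure ?L {z\<in>space ?L. h z \<in> {u..}}"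
      by (rule emeasure_lin_comb[OF I finite_J pn sn h_meas _ h_restrict]) auto
    also have "\<dots> = emeasure ?L {z\<in>space ?L. 8 * K * (7 * g) \<le> h z}" by (simp add: u_def)
    also have "\<dots> \<le> ennreal (exp (- (g / d\<^sup>2) * (7 * g) + 4 * (g / d\<^sup>2)\<^sup>2 * d\<^sup>2 + 2 * (g / d\<^sup>2) * gauss_mean))"
      by (rule upper_tail[OF law1(1)[OF a] sya _ Kp(1,2)]) (use c g d0 in auto)
    also have "\<dots> \<le> ennreal (exp (- r * (g / d)\<^sup>2))"
    proof (intro ennreal_leI, subst exp_le_cancel_iff)
      have "- (g / d\<^sup>2) * (7 * g) + 4 * (g / d\<^sup>2)\<^sup>2 * d\<^sup>2 + 2 * (g / d\<^sup>2) * g = - (g / d)\<^sup>2"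
        using d0 by (simp add: power2_eq_square field_simps)
      moreover have "r * (g / d)\<^sup>2 \<le> 1 * (g / d)\<^sup>2" by (rule mult_right_mono[OF r1(1)]) simp
      ultimately show "- (g / d\<^sup>2) * (7 * g) + 4 * (g / d\<^sup>2)\<^sup>2 * d\<^sup>2 + 2 * (g / d\<^sup>2) * gauss_mean \<le> - r * (g / d)\<^sup>2"
        unfolding g_def by linarith
    qed
    finally show "emeasure ?P {X\<in>space ?P. u \<le> h (\<lambda>j. \<Sum>i\<in>I. a i * X i j)} \<le> ennreal (exp (- r * (g / d)\<^sup>2))" by simp
  qed (use l0 lu in auto)
  moreover have "256 * u\<^sup>2 / l\<^sup>2 = 256 * (56 * K)\<^sup>2 / (m0 / (8 * C1))\<^sup>2"
  proof -
    have "256 * (x * g)\<^sup>2 / (y * g)\<^sup>2 = 256 * x\<^sup>2 / y\<^sup>2" for x y :: real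
      using g by (simp add: power_mult_distrib)
    moreover have "u = (56 * K) * g" by (simp add: u_def)
    ultimately show ?thesis by (simp only: l_def)
  qed
  moreover have "l / 2 = m0 / (16 * C1) * g" "3 * u = 168 * K * g" by (auto simp: l_def u_def)
  ultimately show ?thesis unfolding g_def by simp
qed

end

section \<open>Convex bodies and duality\<close>

lemma convex_bodyD:
  assumes "convex_body n T"
  shows "compactin (powertop_real {1..n}) T" "T \<noteq> {}"
    and "x \<in> T \<Longrightarrow> y \<in> T \<Longrightarrow> 0 \<le> u \<Longrightarrow> 0 \<le> v \<Longrightarrow> u + v = 1 \<Longrightarrow> (\<lambda>i\<in>{1..n}. u * x i + v * y i) \<in> T"
    and "x \<in> T \<Longrightarrow> scale_on {1..n} (- 1) x \<in> T"
proof -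
  have "(powertop_real {1..n}) interior_of T \<subseteq> T" by (rule interior_of_subset)
  then show "T \<noteq> {}" using assms by (auto simp: convex_body_def)
qed (use assms in \<open>auto simp: convex_body_def\<close>)

lemma continuous_map_inner_on:
  "continuous_map (powertop_real {1..n :: nat}) euclideanreal (inner_on {1..n} x)"
  unfolding inner_on_def by (intro continuous_intros) auto

lemma compactin_attains:
  assumes T: "compactin X T" "T \<noteq> {}" and f: "continuous_map X euclideanreal f"
  shows "\<exists>t\<in>T. \<forall>t'\<in>T. f t' \<le> f t"
proof -
  have "compactin euclideanreal (f ` T)" by (rule image_compactin[OF T(1) f])
  then have "compact (f ` T)" by simp
  from compact_attains_sup[OF this] T(2) show ?thesis by auto
qed

lemma polar_norm_attained:
  assumes T: "convex_body n T"
  shows "\<exists>t\<in>T. polar_norm n T x = inner_on {1..n} x t" "t \<in> T \<Longrightarrow> inner_on {1..n} x t \<le> polar_norm n T x"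
proof -
  obtain s where s: "s \<in> T" "\<And>t. t \<in> T \<Longrightarrow> inner_on {1..n} x t \<le> inner_on {1..n} x s"
    using compactin_attains[OF convex_bodyD(1,2)[OF T] continuous_map_inner_on] by blast
  have "polar_norm n T x = inner_on {1..n} x s"
    unfolding polar_norm_def using s by (intro cSup_eq_maximum) auto
  then show "\<exists>t\<in>T. polar_norm n T x = inner_on {1..n} x t" "t \<in> T \<Longrightarrow> inner_on {1..n} x t \<le> polar_norm n T x"
    using s by auto
qed

lemma radius_upper:
  assumes T: "convex_body n T" and t: "t \<in> T"
  shows "L2_set t {1..n} \<le> radius n T"
proof -
  have "continuous_map (powertop_real {1..n}) euclideanreal (\<lambda>t. \<Sum>i\<in>{1..n}. (t i)\<^sup>2)"
    by (intro continuous_intros) auto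
  from compactin_attains[OF convex_bodyD(1,2)[OF T] this]
  obtain s where s: "s \<in> T" "\<And>t. t \<in> T \<Longrightarrow> (\<Sum>i\<in>{1..n}. (t i)\<^sup>2) \<le> (\<Sum>i\<in>{1..n}. (s i)\<^sup>2)" by blast
  have "bdd_above ((\<lambda>t. L2_set t {1..n}) ` T)"
    by (rule bdd_aboveI[of _ "L2_set s {1..n}"]) (use s(2) in \<open>auto simp: L2_set_def\<close>)
  then show ?thesis unfolding radius_def by (rule cSUP_upper[OF t])
qed

text \<open>
  The supremum may be taken over a countable dense subset of \<open>T\<close>.
\<close>

lemma polar_norm_measurable:
  assumes T: "convex_body n T"
  shows "polar_norm n T \<in> borel_measurable (Pi\<^sub>M {1..n} (\<lambda>_. borel))"
proof -
  obtain D where D: "countable D" "D \<subseteq> T" "T \<subseteq> closure D" by (rule separable[of T])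
  have D0: "D \<noteq> {}" using D convex_bodyD(2)[OF T] by auto
  have bdd: "bdd_above (inner_on {1..n} x ` D)" for x
    by (rule bdd_aboveI[of _ "polar_norm n T x"]) (use D(2) polar_norm_attained(2)[OF T] in auto)
  have "polar_norm n T x = (SUP t\<in>D. inner_on {1..n} x t)" for x
  proof (rule order_antisym)
    have "continuous_on UNIV (inner_on {1..n} x)"
      unfolding inner_on_def by (intro continuous_intros) auto
    then have "closed {t. inner_on {1..n} x t \<le> (SUP t\<in>D. inner_on {1..n} x t)}"
      by (intro closed_Collect_le continuous_on_const)
    moreover have "D \<subseteq> {t. inner_on {1..n} x t \<le> (SUP t\<in>D. inner_on {1..n} x t)}"
      using cSUP_upper[OF _ bdd] by blast
    ultimately have "closure D \<subseteq> {t. inner_on {1..n} x t \<le> (SUP t\<in>D. inner_on {1..n} x t)}"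
      by (intro closure_minimal)
    then show "polar_norm n T x \<le> (SUP t\<in>D. inner_on {1..n} x t)"
      using polar_norm_attained(1)[OF T, of x] D(3) by auto
    show "(SUP t\<in>D. inner_on {1..n} x t) \<le> polar_norm n T x"
      by (rule cSUP_least[OF D0]) (use D(2) polar_norm_attained(2)[OF T] in auto)
  qed
  then have e: "polar_norm n T = (\<lambda>x. SUP t\<in>D. inner_on {1..n} x t)" by auto
  show ?thesis unfolding e
    by (rule borel_measurable_cSUP[OF D(1)]) (use bdd in \<open>auto simp: inner_on_def\<close>)
qed

lemma support_functional_convex_body:
  assumes T: "convex_body n T"
  shows "support_functional {1..n} T (polar_norm n T) (radius n T)"
proof
  show "finite {1..n}" by simp
  show "\<exists>t\<in>T. polar_norm n T x = inner_on {1..n} x t" for x by (rule polar_norm_attained(1)[OF T])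
  show "t \<in> T \<Longrightarrow> inner_on {1..n} x t \<le> polar_norm n T x" for t x by (rule polar_norm_attained(2)[OF T])
  show "t \<in> T \<Longrightarrow> L2_set t {1..n} \<le> radius n T" for t by (rule radius_upper[OF T])
  show "polar_norm n T \<in> borel_measurable (Pi\<^sub>M {1..n} (\<lambda>_. borel))" by (rule polar_norm_measurable[OF T])
  have le: "polar_norm n T (\<lambda>j. - x j) \<le> polar_norm n T x" for x
  proof -
    obtain t where t: "t \<in> T" "polar_norm n T (\<lambda>j. - x j) = inner_on {1..n} (\<lambda>j. - x j) t"
      using polar_norm_attained(1)[OF T] by blast
    have "inner_on {1..n} (\<lambda>j. - x j) t = inner_on {1..n} x (scale_on {1..n} (- 1) t)"
      by (simp add: inner_on_def scale_on_def)
    also have "\<dots> \<le> polar_norm n T x" by (intro polar_norm_attained(2)[OF T] convex_bodyD(4)[OF T] t)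
    finally show ?thesis using t by simp
  qed
  show "polar_norm n T (\<lambda>j. - x j) = polar_norm n T x" for x
    using le[of x] le[of "\<lambda>j. - x j"] by simp
qed

lemma ell_star_eq: "ell_star n T = (\<integral>x. polar_norm n T x \<partial>iid {1..n} gaussian)"
  by (simp add: ell_star_def gauss_def polar_norm_def inner_on_def)

lemma cotype_bound:
  fixes m :: nat and x :: "nat \<Rightarrow> nat \<Rightarrow> real"
  assumes cot: "gaussian_cotype2_const n T \<le> ereal \<kappa>" and k: "\<kappa> > 0" and T: "convex_body n T"
  shows "ennreal (\<Sum>i\<in>{1..m}. (polar_norm n T (x i))\<^sup>2)
      \<le> ennreal ((2 * \<kappa>)\<^sup>2) * (\<integral>\<^sup>+g. ennreal ((polar_norm n T (\<lambda>j. \<Sum>i\<in>{1..m}. g i * x i j))\<^sup>2) \<partial>iid {1..m} gaussian)"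
proof -
  interpret support_functional "{1..n}" T "polar_norm n T" "radius n T" by (rule support_functional_convex_body[OF T])
  have "gaussian_cotype2_const n T < ereal (2 * \<kappa>)" using cot k by (auto intro: le_less_trans)
  then obtain C where C: "0 \<le> C" "C < 2 * \<kappa>" and
    b: "\<And>m x. (\<forall>i\<in>{1..m}. x i \<in> Rvec {1..n}) \<Longrightarrow> sqrt (\<Sum>i\<in>{1..m}. (polar_norm n T (x i))\<^sup>2)
      \<le> C * sqrt (\<integral>g. (polar_norm n T (\<lambda>j\<in>{1..n}. \<Sum>i\<in>{1..m}. g i * x i j))\<^sup>2 \<partial>gauss m)"
    unfolding gaussian_cotype2_const_def Inf_less_iff by auto
  define S where "S = (\<Sum>i\<in>{1..m}. (polar_norm n T (x i))\<^sup>2)"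
  define G where "G = (\<integral>g. (polar_norm n T (\<lambda>j. \<Sum>i\<in>{1..m}. g i * x i j))\<^sup>2 \<partial>iid {1..m} gaussian)"
  have G0: "G \<ge> 0" by (simp add: G_def)
  have "sqrt (\<Sum>i\<in>{1..m}. (polar_norm n T (restrict (x i) {1..n}))\<^sup>2)
      \<le> C * sqrt (\<integral>g. (polar_norm n T (\<lambda>j\<in>{1..n}. \<Sum>i\<in>{1..m}. g i * restrict (x i) {1..n} j))\<^sup>2 \<partial>gauss m)"
    by (rule b) (auto simp: Rvec_def)
  also have "(\<lambda>g. polar_norm n T (\<lambda>j\<in>{1..n}. \<Sum>i\<in>{1..m}. g i * restrict (x i) {1..n} j)) = (\<lambda>g. polar_norm n T (\<lambda>j. \<Sum>i\<in>{1..m}. g i * x i j))"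
    by (intro ext h_cong) simp
  finally have "sqrt S \<le> C * sqrt G" by (simp only: S_def G_def gauss_def h_restrict)
  then have "(sqrt S)\<^sup>2 \<le> (C * sqrt G)\<^sup>2" by (intro power_mono) (auto simp: S_def intro: sum_nonneg)
  then have "S \<le> C\<^sup>2 * G" using G0 by (simp add: power_mult_distrib S_def sum_nonneg)
  also have "\<dots> \<le> (2 * \<kappa>)\<^sup>2 * G" using C G0 by (intro mult_right_mono power_mono) auto
  finally have "ennreal S \<le> ennreal ((2 * \<kappa>)\<^sup>2 * G)" by (rule ennreal_leI)
  also have "\<dots> = ennreal ((2 * \<kappa>)\<^sup>2) * ennreal G" using G0 by (intro ennreal_mult) auto
  also have "ennreal G \<le> (\<integral>\<^sup>+g. ennreal ((polar_norm n T (\<lambda>j. \<Sum>i\<in>{1..m}. g i * x i j))\<^sup>2) \<partial>iid {1..m} gaussian)"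
  proof (cases "integrable (iid {1..m} gaussian) (\<lambda>g. (polar_norm n T (\<lambda>j. \<Sum>i\<in>{1..m}. g i * x i j))\<^sup>2)")
    case True
    then show ?thesis unfolding G_def by (subst nn_integral_eq_integral) auto
  qed (simp add: G_def not_integrable_integral_eq)
  finally show ?thesis unfolding S_def by (simp add: mult_left_mono)
qed

lemma row_op_image_subset_ball:
  assumes T: "convex_body n T" and J: "finite J" and R: "R > 0"
    and ub: "\<And>b. polar_norm n T (\<lambda>i. \<Sum>j\<in>J. b j * B j i) \<le> R * L2_set b J"
  shows "row_op J {1..n} B ` T \<subseteq> scale_on J R ` B2 J"
proof (rule image_subsetI)
  fix t assume t: "t \<in> T"
  define y where "y = row_op J {1..n} B t"
  have y: "y j = inner_on {1..n} (B j) t" if "j \<in> J" for j using that by (simp add: y_def row_op_def)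
  have "(L2_set y J)\<^sup>2 = (\<Sum>j\<in>J. y j * inner_on {1..n} (B j) t)"
    unfolding L2_set_sq by (intro sum.cong refl) (simp add: y power2_eq_square)
  also have "\<dots> = inner_on {1..n} (\<lambda>i. \<Sum>j\<in>J. y j * B j i) t"
    unfolding inner_on_def sum_distrib_left sum_distrib_right by (subst sum.swap) (simp add: mult.assoc)
  also have "\<dots> \<le> R * L2_set y J" by (rule order_trans[OF polar_norm_attained(2)[OF T t] ub])
  finally have "L2_set y J * L2_set y J \<le> R * L2_set y J" by (simp add: power2_eq_square)
  then have yR: "L2_set y J \<le> R" using R L2_set_nonneg[of y J]
    by (cases "L2_set y J = 0") (auto simp: mult_le_cancel_right)
  define z where "z = (\<lambda>j\<in>J. (1 / R) * y j)"
  have "L2_set z J = L2_set (\<lambda>j. (1 / R) * y j) J" unfolding z_def by (rule L2_set_cong) auto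
  also have "\<dots> = (1 / R) * L2_set y J" unfolding L2_set_scale using R by simp
  finally have "z \<in> B2 J" using yR R by (auto simp: B2_def Rvec_def z_def)
  moreover have "y = scale_on J R z"
    using R by (auto simp: scale_on_def z_def y_def row_op_def)
  ultimately show "row_op J {1..n} B t \<in> scale_on J R ` B2 J" unfolding y_def by blast
qed

text \<open>
  Separation by the nearest point: if \<open>p\<close> minimises the distance from the image to \<open>y\<close>, then \<open>a\<close>, the
  difference of \<open>y\<close> and the image of \<open>p\<close>, satisfies \<open>r * L2_set a J \<le> (\<Sum>j\<in>J. a j * y j) - (L2_set a J)\<^sup>2\<close>,
  which forces \<open>a = 0\<close> for \<open>y\<close> in the ball of radius \<open>r\<close>.
\<close>

lemma ball_subset_row_op_image:
  assumes T: "convex_body n T" and J: "finite J" and r: "r \<ge> 0"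
    and lb: "\<And>b. r * L2_set b J \<le> polar_norm n T (\<lambda>i. \<Sum>j\<in>J. b j * B j i)"
  shows "scale_on J r ` B2 J \<subseteq> row_op J {1..n} B ` T"
proof (rule image_subsetI)
  fix x assume x: "x \<in> B2 J"
  define y where "y = scale_on J r x"
  have "L2_set y J = L2_set (\<lambda>j. r * x j) J" unfolding y_def scale_on_def by (rule L2_set_cong) auto
  also have "\<dots> = r * L2_set x J" unfolding L2_set_scale using r by simp
  also have "\<dots> \<le> r * 1" using x r by (intro mult_left_mono) (auto simp: B2_def)
  finally have yr: "L2_set y J \<le> r" by simp
  let ?e = "\<lambda>j t. inner_on {1..n} (B j) t"
  define f where "f t = (\<Sum>j\<in>J. (y j - ?e j t)\<^sup>2)" for t
  have "continuous_map (powertop_real {1..n}) euclideanreal (\<lambda>t. - f t)"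
    unfolding f_def by (intro continuous_intros continuous_map_inner_on J)
  from compactin_attains[OF convex_bodyD(1,2)[OF T] this]
  obtain p where p: "p \<in> T" "\<And>t. t \<in> T \<Longrightarrow> f p \<le> f t" by auto
  define a where "a j = y j - ?e j p" for j
  have opt: "(\<Sum>j\<in>J. a j * (?e j z - ?e j p)) \<le> 0" if z: "z \<in> T" for z
  proof (rule ccontr)
    define s q where "s = (\<Sum>j\<in>J. a j * (?e j z - ?e j p))" and "q = (\<Sum>j\<in>J. (?e j z - ?e j p)\<^sup>2)"
    assume "\<not> (\<Sum>j\<in>J. a j * (?e j z - ?e j p)) \<le> 0"
    then have s: "s > 0" by (simp add: s_def)
    have q: "q \<ge> 0" by (simp add: q_def sum_nonneg)
      (* Along the segment to z the squared distance is f p - 2 * u * s + u^2 * q; this u keeps the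
       quadratic term below the linear one, also when q = 0. *)
    define u where "u = s / (s + q)"
    have u: "0 < u" "u \<le> 1" using s q by (auto simp: u_def field_simps)
    define t where "t = (\<lambda>i\<in>{1..n}. (1 - u) * p i + u * z i)"
    have "t \<in> T" unfolding t_def using u by (intro convex_bodyD(3)[OF T p(1) z]) auto
    then have "f p \<le> f t" by (rule p(2))
    moreover have "f t = f p - 2 * u * s + u\<^sup>2 * q"
    proof -
      have et: "?e j t = ?e j p + u * (?e j z - ?e j p)" for j
        unfolding inner_on_def t_def by (simp add: sum_distrib_left sum.distrib[symmetric] sum_subtractf[symmetric] algebra_simps)
      have "f t = (\<Sum>j\<in>J. (a j)\<^sup>2 - 2 * u * (a j * (?e j z - ?e j p)) + u\<^sup>2 * (?e j z - ?e j p)\<^sup>2)"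
        unfolding f_def et by (intro sum.cong refl) (simp add: a_def power2_eq_square algebra_simps)
      then show ?thesis by (simp add: f_def a_def s_def q_def sum.distrib sum_subtractf sum_distrib_left)
    qed
    ultimately have "2 * u * s \<le> u * (u * q)" by (simp add: power2_eq_square)
    then have "2 * s \<le> u * q" using u by simp
    moreover have "u * q \<le> s"
    proof -
      have "u * q = s * (q / (s + q))" by (simp add: u_def)
      also have "\<dots> \<le> s * 1" using s q by (intro mult_left_mono) auto
      finally show ?thesis by simp
    qed
    ultimately show False using s by linarith
  qed
  have comb: "inner_on {1..n} (\<lambda>i. \<Sum>j\<in>J. a j * B j i) t = (\<Sum>j\<in>J. a j * ?e j t)" for t
    unfolding inner_on_def sum_distrib_left sum_distrib_right by (subst sum.swap) (simp add: mult.assoc)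
  obtain z where z: "z \<in> T" "polar_norm n T (\<lambda>i. \<Sum>j\<in>J. a j * B j i) = inner_on {1..n} (\<lambda>i. \<Sum>j\<in>J. a j * B j i) z"
    using polar_norm_attained(1)[OF T] by blast
  have "r * L2_set a J \<le> (\<Sum>j\<in>J. a j * ?e j z)" using lb[of a] by (simp only: z(2) comb)
  also have "\<dots> \<le> (\<Sum>j\<in>J. a j * ?e j p)" using opt[OF z(1)] by (simp add: right_diff_distrib sum_subtractf)
  also have "\<dots> = (\<Sum>j\<in>J. a j * y j) - (L2_set a J)\<^sup>2"
    unfolding L2_set_sq sum_subtractf[symmetric] by (intro sum.cong refl) (simp add: a_def power2_eq_square algebra_simps)
  also have "(\<Sum>j\<in>J. a j * y j) \<le> (\<Sum>j\<in>J. \<bar>a j\<bar> * \<bar>y j\<bar>)" by (intro sum_mono) (metis abs_ge_self abs_mult)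
  also have "\<dots> \<le> L2_set a J * L2_set y J" by (rule L2_set_mult_ineq)
  also have "\<dots> \<le> L2_set a J * r" by (intro mult_left_mono yr) simp
  finally have "(L2_set a J)\<^sup>2 \<le> 0" by (simp add: mult.commute)
  then have "L2_set a J = 0" by simp
  then have "\<forall>j\<in>J. a j = 0" by (simp add: L2_set_eq_0_iff[OF J])
  then have "y = row_op J {1..n} B p"
    by (auto simp: row_op_def a_def y_def scale_on_def)
  then show "scale_on J r x \<in> row_op J {1..n} B ` T" unfolding y_def using p(1) by blast
qed

lemma row_op_row_op:
  assumes "finite I"
  shows "row_op K I Y (row_op I {1..n} X t) = row_op K {1..n} (\<lambda>m j. \<Sum>i\<in>I. Y m i * X i j) t"
proof
  fix m
  have "inner_on I (Y m) (row_op I {1..n} X t) = inner_on {1..n} (\<lambda>j. \<Sum>i\<in>I. Y m i * X i j) t"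
    unfolding inner_on_def row_op_def sum_distrib_right
    by (subst sum.swap) (simp add: inner_on_def sum_distrib_left mult.assoc)
  then show "row_op K I Y (row_op I {1..n} X t) m = row_op K {1..n} (\<lambda>m j. \<Sum>i\<in>I. Y m i * X i j) t m"
    by (simp add: row_op_def)
qed

lemma scale_Binf_subset:
  assumes I: "finite I" "I \<noteq> {}" and r: "r \<ge> 0"
  shows "scale_on I (r / sqrt (real (card I))) ` Binf I \<subseteq> scale_on I r ` B2 I"
proof (rule image_subsetI)
  fix x assume x: "x \<in> Binf I"
  have N: "real (card I) > 0" using I by (simp add: card_gt_0_iff)
  define z where "z = (\<lambda>i\<in>I. (1 / sqrt (real (card I))) * x i)"
  have "L2_set z I = L2_set (\<lambda>i. (1 / sqrt (real (card I))) * x i) I" unfolding z_def by (rule L2_set_cong) auto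
  also have "\<dots> = 1 / sqrt (real (card I)) * L2_set x I" unfolding L2_set_scale by simp
  also have "L2_set x I \<le> sqrt (real (card I))"
  proof -
    have "(x i)\<^sup>2 \<le> 1" if "i \<in> I" for i using x that by (auto simp: Binf_def PiE_iff abs_square_le_1 abs_le_iff)
    then have "(\<Sum>i\<in>I. (x i)\<^sup>2) \<le> (\<Sum>i\<in>I. 1)" by (rule sum_mono)
    then show ?thesis by (simp add: L2_set_def)
  qed
  finally have "L2_set z I \<le> 1" using N by (simp add: divide_right_mono mult_left_mono)
  then have "z \<in> B2 I" by (auto simp: B2_def Rvec_def z_def)
  moreover have "scale_on I (r / sqrt (real (card I))) x = scale_on I r z" by (auto simp: scale_on_def z_def)
  ultimately show "scale_on I (r / sqrt (real (card I))) x \<in> scale_on I r ` B2 I" by simp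
qed

section \<open>The main theorem\<close>

lemma symmetric_law_mean:
  assumes "symmetric_law \<rho>" and [measurable_cong]: "sets \<rho> = sets borel"
  shows "(\<integral>z. z \<partial>\<rho>) = 0"
proof -
  have "(\<integral>z. z \<partial>\<rho>) = (\<integral>z. z \<partial>distr \<rho> borel uminus)" using assms(1) by (simp add: symmetric_law_def)
  also have "\<dots> = (\<integral>z. - z \<partial>\<rho>)" by (rule integral_distr) auto
  finally show ?thesis by simp
qed

lemma iid_coordinates_law:
  assumes n: "n \<ge> 1" and vl: "vector_law n \<mu>" and iso: "isotropic_law n \<mu>" and sg: "subgaussian_law n L \<mu>"
    and iid: "iid_coordinates n \<mu>" and L: "L > 1"
  obtains \<rho> where "\<mu> = iid {1..n} \<rho>" "subgauss_law (4 * L\<^sup>2) \<rho>" "symmetric_law \<rho>" "(\<integral>z. z\<^sup>2 \<partial>\<rho>) = 1"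
proof -
  from vl have pm: "prob_space \<mu>" and sm[measurable_cong]: "sets \<mu> = sets (Pi\<^sub>M {1..n} (\<lambda>_. borel))"
    by (auto simp: vector_law_def)
  interpret prob_space \<mu> by (rule pm)
  have sp: "space \<mu> = PiE {1..n} (\<lambda>_. UNIV)" using sets_eq_imp_space_eq[OF sm] by (simp add: space_PiM)
  have n1: "1 \<in> {1..n}" using n by simp
  have [measurable]: "(\<lambda>x. x i) \<in> borel_measurable \<mu>" if "i \<in> {1..n}" for i
    using that by measurable
  define \<rho> where "\<rho> = distr \<mu> borel (\<lambda>x. x 1)"
  have X1[measurable]: "(\<lambda>x. x 1) \<in> borel_measurable \<mu>" using n1 by measurable
  have s\<rho>[measurable_cong]: "sets \<rho> = sets borel" by (simp add: \<rho>_def)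
  have p\<rho>: "prob_space \<rho>" unfolding \<rho>_def by (rule prob_space_distr) (rule X1)
  have "distr \<mu> (Pi\<^sub>M {1..n} (\<lambda>_. borel)) (\<lambda>x. \<lambda>i\<in>{1..n}. x i) = Pi\<^sub>M {1..n} (\<lambda>i. distr \<mu> borel (\<lambda>x. x i))"
    using iid n1 by (subst indep_vars_iff_distr_eq_PiM'[symmetric]) (auto simp: iid_coordinates_def)
  also have "\<dots> = iid {1..n} \<rho>"
  proof (rule PiM_cong)
    fix i assume i: "i \<in> {1..n}"
    show "distr \<mu> borel (\<lambda>x. x i) = \<rho>" using iid i n1 unfolding iid_coordinates_def \<rho>_def by blast
  qed simp
  also have "distr \<mu> (Pi\<^sub>M {1..n} (\<lambda>_. borel)) (\<lambda>x. \<lambda>i\<in>{1..n}. x i) = distr \<mu> (Pi\<^sub>M {1..n} (\<lambda>_. borel)) (\<lambda>x. x)"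
    by (rule distr_cong) (auto simp: sp PiE_restrict)
  also have "\<dots> = \<mu>" by (rule distr_id2) (simp add: sm)
  finally have mu: "\<mu> = iid {1..n} \<rho>" .
  (* The first unit vector turns the hypotheses on marginals into statements on one coordinate. *)
  define t :: "nat \<Rightarrow> real" where "t = (\<lambda>i\<in>{1..n}. if i = 1 then 1 else 0)"
  have tR: "t \<in> Rvec {1..n}" by (auto simp: t_def Rvec_def)
  have inner: "inner_on {1..n} x t = x 1" for x
  proof -
    have "inner_on {1..n} x t = (\<Sum>i\<in>{1..n}. if i = 1 then x i else 0)"
      unfolding inner_on_def t_def by (intro sum.cong) auto
    then show ?thesis using n1 by simp
  qed
  have t2: "(L2_set t {1..n})\<^sup>2 = 1"
  proof -
    have "(\<Sum>i\<in>{1..n}. (t i)\<^sup>2) = (\<Sum>i\<in>{1..n}. if i = 1 then 1 else 0)"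
      unfolding t_def by (intro sum.cong) auto
    then show ?thesis using n1 by (simp add: L2_set_sq)
  qed
  have m2: "(\<integral>x. (x 1)\<^sup>2 \<partial>\<mu>) = 1"
  proof -
    have "(\<integral>x. (inner_on {1..n} x t)\<^sup>2 \<partial>\<mu>) = (L2_set t {1..n})\<^sup>2" using iso tR unfolding isotropic_law_def by blast
    then show ?thesis by (simp only: inner t2)
  qed
  then have z2: "(\<integral>z. z\<^sup>2 \<partial>\<rho>) = 1" unfolding \<rho>_def by (subst integral_distr[OF X1]) auto
  have sy: "symmetric_law \<rho>"
    unfolding symmetric_law_def
  proof -
    let ?B = "Pi\<^sub>M {1..n} (\<lambda>_. borel :: real measure)"
    have sc: "scale_on {1..n} (- 1) \<in> measurable \<mu> ?B"
      unfolding scale_on_def by (rule measurable_restrict) auto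
    have c1: "(\<lambda>x. x 1) \<in> borel_measurable ?B" using n1 by measurable
    have "distr \<rho> borel uminus = distr \<mu> borel (uminus \<circ> (\<lambda>x. x 1))"
      unfolding \<rho>_def by (rule distr_distr[OF _ X1]) auto
    also have "uminus \<circ> (\<lambda>x. x 1) = (\<lambda>x :: nat \<Rightarrow> real. x 1) \<circ> scale_on {1..n} (- 1)"
      using n1 by (auto simp: scale_on_def)
    also have "distr \<mu> borel \<dots> = distr (distr \<mu> ?B (scale_on {1..n} (- 1))) borel (\<lambda>x. x 1)"
      by (rule distr_distr[symmetric]) (use sc c1 in auto)
    also have "distr \<mu> ?B (scale_on {1..n} (- 1)) = \<mu>" using iso by (simp add: isotropic_law_def)
    finally show "distr \<rho> borel uminus = \<rho>" by (simp add: \<rho>_def)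
  qed
  have z1: "(\<integral>x. x 1 \<partial>\<mu>) = 0"
  proof -
    have "(\<integral>z. z \<partial>\<rho>) = (\<integral>x. x 1 \<partial>\<mu>)" unfolding \<rho>_def by (rule integral_distr[OF X1]) auto
    then show ?thesis using symmetric_law_mean[OF sy s\<rho>] by simp
  qed
  have "subgaussian \<mu> L (\<lambda>x. x 1)"
  proof -
    have "subgaussian \<mu> L (\<lambda>x. inner_on {1..n} x t)" using sg tR unfolding subgaussian_law_def by blast
    then show ?thesis by (simp only: inner)
  qed
  note mg = subgaussian_mgf[OF pm X1 z1 m2 L this]
  have "(\<integral>\<^sup>+z. ennreal (exp (s * z)) \<partial>\<rho>) \<le> ennreal (exp (4 * L\<^sup>2 * s\<^sup>2))" for s
  proof -
    have "(\<integral>\<^sup>+z. ennreal (exp (s * z)) \<partial>\<rho>) = (\<integral>\<^sup>+x. ennreal (exp (s * x 1)) \<partial>\<mu>)"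
      unfolding \<rho>_def by (rule nn_integral_distr[OF X1]) auto
    then show ?thesis using mg[of s] by simp
  qed
  then have "subgauss_law (4 * L\<^sup>2) \<rho>" using p\<rho> s\<rho> by (auto simp: subgauss_law_def)
  from that[OF mu this sy z2] show thesis .
qed

lemma real_distribution_subgauss_law:
  assumes nu: "real_distribution \<nu>" and e: "prob_space.expectation \<nu> (\<lambda>x. x) = 0"
    and v: "prob_space.variance \<nu> (\<lambda>x. x) = 1" and sg: "subgaussian \<nu> L (\<lambda>x. x)" and L: "L > 1"
  shows "subgauss_law (4 * L\<^sup>2) \<nu>" "(\<integral>z. z \<partial>\<nu>) = 0" "(\<integral>z. z\<^sup>2 \<partial>\<nu>) = 1"
proof -
  interpret real_distribution \<nu> by fact
  show z1: "(\<integral>z. z \<partial>\<nu>) = 0" using e by simp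
  show z2: "(\<integral>z. z\<^sup>2 \<partial>\<nu>) = 1" using v e by simp
  show "subgauss_law (4 * L\<^sup>2) \<nu>"
    using subgaussian_mgf[OF prob_space_axioms _ z1 z2 L sg] prob_space_axioms by (auto simp: subgauss_law_def)
qed

lemma round_pos_bounds:
  assumes "x > 0"
  shows "x \<le> real (round_pos x)" "real (round_pos x) \<le> x + 1" "1 \<le> round_pos x"
proof -
  have "0 < \<lceil>x\<rceil>" using assms by simp
  then have e: "real (round_pos x) = real_of_int \<lceil>x\<rceil>" by (simp add: round_pos_def)
  show "x \<le> real (round_pos x)" "real (round_pos x) \<le> x + 1" unfolding e by linarith+
  show "1 \<le> round_pos x" unfolding round_pos_def using \<open>0 < \<lceil>x\<rceil>\<close> by linarith
qed

lemma with_prob_trivial: "p \<le> 0 \<Longrightarrow> with_prob_at_least P p Q"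
  unfolding with_prob_at_least_def by (rule bexI[of _ "{}"]) auto

lemma one_minus_exp_ln2: "x \<le> ln 2 \<Longrightarrow> 1 - 2 * exp (- x) \<le> 0" for x :: real
proof -
  assume "x \<le> ln 2"
  then have "exp (- ln 2) \<le> exp (- x)" by simp
  then show ?thesis by (simp add: exp_minus)
qed

text \<open>
  The norm of the composition at \<open>b\<close> is the norm of the first operator at the transposed matrix
  applied to \<open>b\<close>. For \<open>M = 1\<close>, where rounding spoils the comparison of \<open>M\<close> with \<open>c5 * k\<close>, the claimed
  probability is \<open>0\<close>.
\<close>

lemma second_operator_bounds:
  fixes I :: "nat set" and k :: real
  assumes T: "convex_body n T" and I: "finite I" "I \<noteq> {}" and c: "c \<ge> 1"
    and law: "subgauss_law c \<nu>" "(\<integral>z. z \<partial>\<nu>) = 0" "(\<integral>z. z\<^sup>2 \<partial>\<nu>) = 1"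
    and HX: "\<And>a. cl * L2_set a I \<le> polar_norm n T (\<lambda>j. \<Sum>i\<in>I. a i * X i j)"
            "\<And>a. polar_norm n T (\<lambda>j. \<Sum>i\<in>I. a i * X i j) \<le> cu * L2_set a I"
    and cl: "cl > 0" "cu > 0" and s: "s = exp (- c) / 512" and G: "G = 3 * exp (16384 * c)"
    and k: "k > 0" and c0: "c0 > 0" "c0 * k \<le> card I" "card I \<le> 2 * c0 * k"
    and c5: "c5 = s * c0 / (2 * (ln G + 1))" and M: "M = round_pos (c5 * k)"
  shows "with_prob_at_least (iid {1..M} (iid I \<nu>)) (1 - 2 * exp (- ln 2 * real M)) (\<lambda>Y.
              scale_on {1..M} (cl * sqrt c0 / 4 * sqrt k) ` B2 {1..M}
                \<subseteq> row_op {1..M} I Y ` row_op I {1..n} X ` T \<and>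
              row_op {1..M} I Y ` row_op I {1..n} X ` T
                \<subseteq> scale_on {1..M} (cu * 12 * sqrt c * sqrt (2 * c0) * sqrt k) ` B2 {1..M})"
proof -
  have G1: "G \<ge> 3" using c by (simp add: G)
  have lG: "ln G \<ge> 0" using G1 by simp
  have s0: "s > 0" by (simp add: s)
  have c50: "c5 > 0" unfolding c5 using s0 c0 lG by (intro divide_pos_pos mult_pos_pos) auto
  have ck: "c5 * k > 0" using c50 k by simp
  note Mb = round_pos_bounds[OF ck, folded M]
  show ?thesis
  proof (cases "M = 1")
    case True
    then show ?thesis using one_minus_exp_ln2[of "ln 2"] by (intro with_prob_trivial) simp
  next
    case False
    then have M2: "2 \<le> M" using Mb(3) by simp
    then have "real M \<le> 2 * (c5 * k)" using Mb(2) by linarith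
    then have "real M * (ln G + 1) \<le> 2 * (c5 * k) * (ln G + 1)" using lG by (intro mult_right_mono) auto
    also have "\<dots> = s * (c0 * k)"
    proof -
      have "ln G + 1 \<noteq> 0" using lG by linarith
      then show ?thesis unfolding c5 by (simp add: field_simps)
    qed
    also have "\<dots> \<le> s * card I" using s0 c0 by (intro mult_left_mono) auto
    finally have key: "real M * ln G + real M \<le> s * card I" by (simp add: distrib_left)
    have prob: "exp (- s * card I) * G ^ M \<le> exp (- ln 2 * real M)"
    proof -
      have "G ^ M = exp (ln G) ^ M" using G1 by simp
      also have "\<dots> = exp (real M * ln G)" by (rule exp_of_nat_mult[symmetric])
      finally have "exp (- s * card I) * G ^ M = exp (- s * card I + real M * ln G)" by (simp add: exp_add[symmetric])
      also have "\<dots> \<le> exp (- real M)" using key by simp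
      also have "\<dots> \<le> exp (- ln 2 * real M)"
      proof -
        have "ln 2 \<le> (1 :: real)" using ln_le_minus_one[of 2] by simp
        then have "ln 2 * real M \<le> 1 * real M" by (intro mult_right_mono) auto
        then show ?thesis by simp
      qed
      finally show ?thesis .
    qed
    let ?P = "iid {1..M} (iid I \<nu>)"
    obtain A where A: "A \<in> sets ?P" "1 - 2 * exp (- s * card I) * G ^ card {1..M} \<le> measure ?P A"
      and Y: "\<And>Y b. Y \<in> A \<Longrightarrow> sqrt (card I) / 4 * L2_set b {1..M} \<le> L2_set (\<lambda>i. \<Sum>m\<in>{1..M}. b m * Y m i) I"
         "\<And>Y b. Y \<in> A \<Longrightarrow> L2_set (\<lambda>i. \<Sum>m\<in>{1..M}. b m * Y m i) I \<le> 12 * sqrt c * sqrt (card I) * L2_set b {1..M}"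
      using random_matrix_bounds[OF I, of "{1..M}", OF _ law(1) c law(2,3) s] unfolding G by blast
    have "1 - 2 * exp (- ln 2 * real M) \<le> measure ?P A" using A(2) prob by simp
    moreover have "scale_on {1..M} (cl * sqrt c0 / 4 * sqrt k) ` B2 {1..M} \<subseteq> row_op {1..M} I Y ` row_op I {1..n} X ` T \<and>
        row_op {1..M} I Y ` row_op I {1..n} X ` T \<subseteq> scale_on {1..M} (cu * 12 * sqrt c * sqrt (2 * c0) * sqrt k) ` B2 {1..M}"
      if YA: "Y \<in> A" for Y
    proof -
      define B where "B m j = (\<Sum>i\<in>I. Y m i * X i j)" for m j
      have comp: "row_op {1..M} I Y ` row_op I {1..n} X ` T = row_op {1..M} {1..n} B ` T"
        by (simp only: image_image row_op_row_op[OF I(1)] B_def[abs_def])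
      have Bsum: "(\<lambda>j. \<Sum>m\<in>{1..M}. b m * B m j) = (\<lambda>j. \<Sum>i\<in>I. (\<Sum>m\<in>{1..M}. b m * Y m i) * X i j)" for b
        unfolding B_def sum_distrib_left sum_distrib_right by (rule ext, subst sum.swap) (simp add: mult.assoc)
      have rts: "sqrt c0 * sqrt k \<le> sqrt (card I)" "sqrt (card I) \<le> sqrt (2 * c0) * sqrt k"
        using c0 by (simp_all add: real_sqrt_mult[symmetric])
      have "cl * sqrt c0 / 4 * sqrt k * L2_set b {1..M} \<le> polar_norm n T (\<lambda>j. \<Sum>m\<in>{1..M}. b m * B m j)" for b
      proof -
        have "(cl / 4) * (sqrt c0 * sqrt k) * L2_set b {1..M} \<le> (cl / 4) * sqrt (card I) * L2_set b {1..M}"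
          using cl by (intro mult_right_mono mult_left_mono rts) auto
        also have "\<dots> = cl * (sqrt (card I) / 4 * L2_set b {1..M})" by simp
        also have "\<dots> \<le> cl * L2_set (\<lambda>i. \<Sum>m\<in>{1..M}. b m * Y m i) I"
          using cl by (intro mult_left_mono Y YA) auto
        also have "\<dots> \<le> polar_norm n T (\<lambda>j. \<Sum>m\<in>{1..M}. b m * B m j)" unfolding Bsum by (rule HX)
        finally show ?thesis by (simp add: mult.assoc)
      qed
      moreover have "polar_norm n T (\<lambda>j. \<Sum>m\<in>{1..M}. b m * B m j) \<le> cu * 12 * sqrt c * sqrt (2 * c0) * sqrt k * L2_set b {1..M}" for b
      proof -
        have "polar_norm n T (\<lambda>j. \<Sum>m\<in>{1..M}. b m * B m j) \<le> cu * L2_set (\<lambda>i. \<Sum>m\<in>{1..M}. b m * Y m i) I"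
          unfolding Bsum by (rule HX)
        also have "\<dots> \<le> cu * (12 * sqrt c * sqrt (card I) * L2_set b {1..M})"
          using cl by (intro mult_left_mono Y YA) auto
        also have "\<dots> \<le> cu * (12 * sqrt c * (sqrt (2 * c0) * sqrt k) * L2_set b {1..M})"
          using cl c by (intro mult_left_mono mult_right_mono rts) auto
        finally show ?thesis by (simp add: mult.assoc)
      qed
      moreover have "0 \<le> cl * sqrt c0 / 4 * sqrt k" "0 < cu * 12 * sqrt c * sqrt (2 * c0) * sqrt k"
        using cl c c0 k by auto
      ultimately show ?thesis unfolding comp
        using ball_subset_row_op_image[OF T, of "{1..M}" "cl * sqrt c0 / 4 * sqrt k" B]
          row_op_image_subset_ball[OF T, of "{1..M}" "cu * 12 * sqrt c * sqrt (2 * c0) * sqrt k" B] by auto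
    qed
    ultimately show ?thesis unfolding with_prob_at_least_def using A(1) by blast
  qed
qed

theorem mainTheorem2:
  fixes L \<kappa> :: real
  assumes "L > 1" and "\<kappa> > 0"
  shows "\<exists>c0 c1 c2 c3 c4 c5 c6 c7 c8 :: real.
    c0 > 0 \<and> c1 > 0 \<and> c2 > 0 \<and> c3 > 0 \<and> c4 > 0 \<and> c5 > 0 \<and> c6 > 0 \<and> c7 > 0 \<and> c8 > 0 \<and>
    (\<forall>(n::nat) (T :: (nat \<Rightarrow> real) set) (\<mu> :: (nat \<Rightarrow> real) measure) (N::nat) (M::nat).
      n \<ge> 1 \<longrightarrow> convex_body n T \<longrightarrow> gaussian_cotype2_const n T \<le> ereal \<kappa> \<longrightarrow>
      vector_law n \<mu> \<longrightarrow> isotropic_law n \<mu> \<longrightarrow> subgaussian_law n L \<mu> \<longrightarrow> iid_coordinates n \<mu> \<longrightarrow>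
      N = round_pos (c0 * k_star n T) \<longrightarrow> M = round_pos (c5 * k_star n T) \<longrightarrow>
      with_prob_at_least (Pi\<^sub>M {1..N} (\<lambda>_. \<mu>)) (1 - 2 * exp (- c1 * k_star n T)) (\<lambda>X.
        \<exists>I \<subseteq> {1..N}. real (card I) \<ge> c2 * k_star n T \<and>
          scale_on I (c3 * ell_star n T / sqrt (real (card I))) ` Binf I
            \<subseteq> row_op I {1..n} X ` T \<and>
          row_op I {1..n} X ` T \<subseteq> scale_on I (c4 * ell_star n T) ` B2 I \<and>
          (\<forall>\<nu> :: real measure.
            real_distribution \<nu> \<longrightarrow> prob_space.expectation \<nu> (\<lambda>x. x) = 0 \<longrightarrow>
            prob_space.variance \<nu> (\<lambda>x. x) = 1 \<longrightarrow> subgaussian \<nu> L (\<lambda>x. x) \<longrightarrow>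
            with_prob_at_least (Pi\<^sub>M {1..M} (\<lambda>_. Pi\<^sub>M I (\<lambda>_. \<nu>))) (1 - 2 * exp (- c6 * real M)) (\<lambda>Y.
              scale_on {1..M} (c7 * sqrt (k_star n T) * ell_star n T) ` B2 {1..M}
                \<subseteq> row_op {1..M} I Y ` row_op I {1..n} X ` T \<and>
              row_op {1..M} I Y ` row_op I {1..n} X ` T
                \<subseteq> scale_on {1..M} (c8 * sqrt (k_star n T) * ell_star n T) ` B2 {1..M}))))"
proof -
  define c where "c = 4 * L\<^sup>2"
  define C1 where "C1 = max 1 (24 * \<kappa> * exp 17)"
  define m0 where "m0 = exp (- c / 2) / 32"
  define C where "C = max 4 (32 * c / m0\<^sup>2)"
  define r where "r = 1 / (64 * C1\<^sup>2 * C)"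
  define K where "K = sqrt (10 * c)"
  define G where "G = 3 * exp (256 * (56 * K)\<^sup>2 / (m0 / (8 * C1))\<^sup>2)"
  define c0 where "c0 = r / (4 * ln G)"
  define K0 where "K0 = max (4 * C1\<^sup>2) (1 / c0)"
  (* For k_star below K0 the claimed probability is not positive; above it, N is at most 2 * c0 * k_star
     and the net costs at most half of the exponent r. *)
  define c1 where "c1 = min (r / 2) (ln 2 / K0)"
  define s where "s = exp (- c) / 512"
  define G2 where "G2 = 3 * exp (16384 * c)"
  define c5 where "c5 = s * c0 / (2 * (ln G2 + 1))"
  define c3 c4 where "c3 = m0 / (16 * C1)" and "c4 = 168 * K"
  define c7 c8 where "c7 = c3 * sqrt c0 / 4" and "c8 = c4 * 12 * sqrt c * sqrt (2 * c0)"
  have "1\<^sup>2 \<le> L\<^sup>2" using assms(1) by (intro power_mono) auto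
  then have c: "c \<ge> 1" by (simp add: c_def)
  have C1: "C1 \<ge> 1" "24 * \<kappa> * exp 17 \<le> C1" by (auto simp: C1_def)
  have m0p: "m0 > 0" by (simp add: m0_def)
  have C4: "C \<ge> 4" by (simp add: C_def)
  have rp: "r > 0" using C1 C4 by (simp add: r_def)
  have Kp: "K > 0" using c by (simp add: K_def)
  have G3: "G \<ge> 3" by (simp add: G_def)
  then have lG: "ln G > 0" by simp
  have c0p: "c0 > 0" using rp lG by (simp add: c0_def)
  have K0p: "K0 > 0" using C1 by (auto simp: K0_def less_max_iff_disj)
  have c1p: "c1 > 0" "c1 \<le> r / 2" "c1 * K0 \<le> ln 2"
    using rp K0p by (auto simp: c1_def min_def field_simps)
  have "1 \<le> exp (16384 * c)" using c by simp
  then have "1 \<le> G2" unfolding G2_def by linarith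
  then have lG2: "ln G2 \<ge> 0" by (rule ln_ge_zero)
  have c5p: "c5 > 0" unfolding c5_def s_def using c0p lG2 by (intro divide_pos_pos mult_pos_pos) auto
  have c34: "c3 > 0" "c4 > 0" "c7 > 0" "c8 > 0"
    using m0p C1 Kp c0p c by (auto simp: c3_def c4_def c7_def c8_def)
  show ?thesis
  proof (rule exI[of _ c0], rule exI[of _ c1], rule exI[of _ c0], rule exI[of _ c3], rule exI[of _ c4],
      rule exI[of _ c5], rule exI[of _ "ln 2"], rule exI[of _ c7], rule exI[of _ c8],
      intro conjI allI impI)
    fix n :: nat and T :: "(nat \<Rightarrow> real) set" and \<mu> :: "(nat \<Rightarrow> real) measure" and N M :: nat
    assume n: "n \<ge> 1" and T: "convex_body n T" and cot: "gaussian_cotype2_const n T \<le> ereal \<kappa>"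
      and vl: "vector_law n \<mu>" and iso: "isotropic_law n \<mu>" and sg: "subgaussian_law n L \<mu>" and iid: "iid_coordinates n \<mu>"
      and N: "N = round_pos (c0 * k_star n T)" and M: "M = round_pos (c5 * k_star n T)"
    interpret SF: support_functional "{1..n}" T "polar_norm n T" "radius n T"
      by (rule support_functional_convex_body[OF T])
    obtain \<rho> where mu: "\<mu> = iid {1..n} \<rho>" and law: "subgauss_law c \<rho>" and sy: "symmetric_law \<rho>"
      and z2: "(\<integral>z. z\<^sup>2 \<partial>\<rho>) = 1"
      using iid_coordinates_law[OF n vl iso sg iid assms(1)] unfolding c_def by blast
    have z1: "(\<integral>z. z \<partial>\<rho>) = 0" by (rule symmetric_law_mean[OF sy subgauss_lawD(2)[OF law]])
    define k where "k = k_star n T"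
    define g where "g = ell_star n T"
    have gm: "SF.gauss_mean = g" unfolding SF.gauss_mean_def g_def ell_star_eq by (rule refl)
    have g0: "g \<ge> 0" unfolding gm[symmetric] SF.gauss_mean_def
      by (rule Bochner_Integration.integral_nonneg) (rule SF.h_nonneg)
    have kg: "k = (g / radius n T)\<^sup>2" by (simp add: k_def k_star_def g_def)
    let ?Q = "\<lambda>X. \<exists>I \<subseteq> {1..N}. real (card I) \<ge> c0 * k_star n T \<and>
          scale_on I (c3 * ell_star n T / sqrt (real (card I))) ` Binf I
            \<subseteq> row_op I {1..n} X ` T \<and>
          row_op I {1..n} X ` T \<subseteq> scale_on I (c4 * ell_star n T) ` B2 I \<and>
          (\<forall>\<nu> :: real measure.
            real_distribution \<nu> \<longrightarrow> prob_space.expectation \<nu> (\<lambda>x. x) = 0 \<longrightarrow>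
            prob_space.variance \<nu> (\<lambda>x. x) = 1 \<longrightarrow> subgaussian \<nu> L (\<lambda>x. x) \<longrightarrow>
            with_prob_at_least (iid {1..M} (iid I \<nu>)) (1 - 2 * exp (- ln 2 * real M)) (\<lambda>Y.
              scale_on {1..M} (c7 * sqrt (k_star n T) * ell_star n T) ` B2 {1..M}
                \<subseteq> row_op {1..M} I Y ` row_op I {1..n} X ` T \<and>
              row_op {1..M} I Y ` row_op I {1..n} X ` T
                \<subseteq> scale_on {1..M} (c8 * sqrt (k_star n T) * ell_star n T) ` B2 {1..M}))"
    show "with_prob_at_least (iid {1..N} \<mu>) (1 - 2 * exp (- c1 * k_star n T)) ?Q"
    proof (cases "k < K0")
      case True
      have "c1 * k \<le> c1 * K0" using True c1p by (intro mult_left_mono) auto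
      then have "c1 * k \<le> ln 2" using c1p by linarith
      from one_minus_exp_ln2[OF this] show ?thesis by (intro with_prob_trivial) (simp add: k_def)
    next
      case False
      then have k: "4 * C1\<^sup>2 \<le> k" "1 / c0 \<le> k" by (auto simp: K0_def)
      have kp: "k > 0" using False K0p by linarith
      have dp: "radius n T > 0"
      proof -
        have "radius n T \<noteq> 0" using kp kg by auto
        then show ?thesis using SF.d_nonneg by simp
      qed
      have "(2 * C1)\<^sup>2 \<le> (g / radius n T)\<^sup>2" using k(1) unfolding kg by (simp add: power_mult_distrib)
      then have "2 * C1 \<le> g / radius n T" by (rule power2_le_imp_le) (use g0 dp in auto)
      then have kC: "2 * C1 * radius n T \<le> SF.gauss_mean" using dp unfolding gm by (simp add: field_simps)
      have "0 \<le> SF.rad_mean" unfolding SF.rad_mean_def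
        by (rule Bochner_Integration.integral_nonneg) (rule SF.h_nonneg)
      then have rd: "0 \<le> SF.rad_mean + radius n T" using dp by simp
      have "SF.gauss_mean \<le> 12 * (2 * \<kappa>) * exp 17 * (SF.rad_mean + radius n T)"
        by (rule SF.gauss_mean_le[OF cotype_bound[OF cot assms(2) T]]) (use assms(2) in simp)
      also have "\<dots> \<le> C1 * (SF.rad_mean + radius n T)" using C1(2) rd by (intro mult_right_mono) auto
      finally have gC: "SF.gauss_mean \<le> C1 * (SF.rad_mean + radius n T)" .
      have gp: "g > 0"
      proof -
        have "0 < 2 * C1 * radius n T" using C1 dp by simp
        then show ?thesis using kC gm by linarith
      qed
      have ck: "c0 * k > 0" using c0p kp by simp
      have ck1: "1 \<le> c0 * k" using k(2) c0p by (simp add: field_simps)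
      note Nb = round_pos_bounds[OF ck, unfolded k_def, folded N, folded k_def]
      have N2: "real N \<le> 2 * c0 * k" using Nb(2) ck1 by linarith
      let ?I = "{1..N}"
      have I: "finite ?I" "?I \<noteq> {}" "card ?I = N" using Nb(3) by auto
      let ?P = "iid {1..N} (iid {1..n} \<rho>)"
      obtain A where A: "A \<in> sets ?P"
          "1 - 2 * exp (- r * (SF.gauss_mean / radius n T)\<^sup>2) * (3 * exp (256 * (56 * K)\<^sup>2 / (m0 / (8 * C1))\<^sup>2)) ^ card ?I \<le> measure ?P A"
        and X: "\<And>X a. X \<in> A \<Longrightarrow> m0 / (16 * C1) * SF.gauss_mean * L2_set a ?I \<le> polar_norm n T (\<lambda>j. \<Sum>i\<in>?I. a i * X i j)"
          "\<And>X a. X \<in> A \<Longrightarrow> polar_norm n T (\<lambda>j. \<Sum>i\<in>?I. a i * X i j) \<le> 168 * K * SF.gauss_mean * L2_set a ?I"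
        using SF.random_operator_bounds[OF I(1) law sy c z1 z2 C1(1) gC dp kC m0_def C_def r_def K_def] by blast
      have "1 - 2 * exp (- c1 * k) \<le> measure ?P A"
      proof -
        have "G ^ N = exp (ln G) ^ N" using G3 by simp
        also have "\<dots> = exp (real N * ln G)" by (rule exp_of_nat_mult[symmetric])
        also have "\<dots> \<le> exp (r * k / 2)"
        proof (subst exp_le_cancel_iff)
          have "real N * ln G \<le> 2 * c0 * k * ln G" using N2 lG by (intro mult_right_mono) auto
          also have "\<dots> = r * k / 2" using lG by (simp add: c0_def)
          finally show "real N * ln G \<le> r * k / 2" .
        qed
        finally have "exp (- r * k) * G ^ N \<le> exp (- r * k) * exp (r * k / 2)" by (intro mult_left_mono) auto
        also have "\<dots> = exp (- (r / 2) * k)" by (simp add: exp_add[symmetric])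
        also have "\<dots> \<le> exp (- c1 * k)" using c1p(2) kp by simp
        finally have "exp (- r * k) * G ^ N \<le> exp (- c1 * k)" .
        moreover have "1 - 2 * exp (- r * k) * G ^ N \<le> measure ?P A"
          using A(2) by (simp only: gm kg I(3) G_def)
        ultimately show ?thesis by linarith
      qed
      moreover have "?Q X" if XA: "X \<in> A" for X
      proof (intro exI[of _ ?I] conjI allI impI)
        have lb: "c3 * g * L2_set a ?I \<le> polar_norm n T (\<lambda>j. \<Sum>i\<in>?I. a i * X i j)"
          and ub: "polar_norm n T (\<lambda>j. \<Sum>i\<in>?I. a i * X i j) \<le> c4 * g * L2_set a ?I" for a
          using X[OF XA, of a] unfolding c3_def c4_def gm by simp_all
        have cg: "c3 * g > 0" "c4 * g > 0" using c34 gp by auto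
        show "?I \<subseteq> {1..N}" by simp
        show "c0 * k_star n T \<le> real (card ?I)" using Nb(1) I(3) by (simp add: k_def)
        have "scale_on ?I (c3 * g / sqrt (real (card ?I))) ` Binf ?I \<subseteq> scale_on ?I (c3 * g) ` B2 ?I"
          using cg by (intro scale_Binf_subset I) auto
        also have "\<dots> \<subseteq> row_op ?I {1..n} X ` T"
          using cg lb by (intro ball_subset_row_op_image[OF T]) auto
        finally show "scale_on ?I (c3 * ell_star n T / sqrt (real (card ?I))) ` Binf ?I \<subseteq> row_op ?I {1..n} X ` T"
          by (simp only: g_def)
        show "row_op ?I {1..n} X ` T \<subseteq> scale_on ?I (c4 * ell_star n T) ` B2 ?I"
          using cg(2) ub unfolding g_def by (intro row_op_image_subset_ball[OF T]) auto
        fix \<nu> :: "real measure"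
        assume nu: "real_distribution \<nu>" "prob_space.expectation \<nu> (\<lambda>x. x) = 0"
          "prob_space.variance \<nu> (\<lambda>x. x) = 1" "subgaussian \<nu> L (\<lambda>x. x)"
        note nul = real_distribution_subgauss_law[OF nu assms(1), folded c_def]
        have e: "c3 * g * sqrt c0 / 4 * sqrt k = c7 * sqrt (k_star n T) * ell_star n T"
          "c4 * g * 12 * sqrt c * sqrt (2 * c0) * sqrt k = c8 * sqrt (k_star n T) * ell_star n T"
          by (simp_all add: c7_def c8_def g_def k_def)
        have Nk: "c0 * k \<le> real (card ?I)" "real (card ?I) \<le> 2 * c0 * k" using Nb(1) N2 I(3) by simp_all
        show "with_prob_at_least (iid {1..M} (iid ?I \<nu>)) (1 - 2 * exp (- ln 2 * real M)) (\<lambda>Y.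
              scale_on {1..M} (c7 * sqrt (k_star n T) * ell_star n T) ` B2 {1..M}
                \<subseteq> row_op {1..M} ?I Y ` row_op ?I {1..n} X ` T \<and>
              row_op {1..M} ?I Y ` row_op ?I {1..n} X ` T
                \<subseteq> scale_on {1..M} (c8 * sqrt (k_star n T) * ell_star n T) ` B2 {1..M})"
          using second_operator_bounds[OF T I(1,2) c nul lb ub cg s_def G2_def kp c0p Nk c5_def M[folded k_def]]
          unfolding e .
      qed
      ultimately show ?thesis unfolding with_prob_at_least_def mu k_def using A(1) by blast
    qed
  qed (use c0p c1p c34 c5p in auto)
qed

end
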